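(* Let $K\ge 1$ be fixed. There is a constant $c>0$ such that the following holds. Let $N$ and $m_1$ be powers of two, $\epsilon\in(0,1/9)$, $\delta\in(0,1)$, and $a_i\ge 1$ for $i=1,\dots,K$. Suppose $r\ge c\,\epsilon^{-2}[d+\log(N/\delta)]\log(ed/\delta)$ and $m_1>r$. Let $T\ge T^\dagger$, $s=T-T^\dagger$ and $\theta=1/4$. Then, for any $\beta_0\in\mathbb{R}^d$, with probability at least $1-2\delta$ (over the sketching matrices), $$\mathbb{E}\|X(\beta_T-\beta)\|\le\theta^T\,\mathbb{E}\|X(\beta_0-\beta)\|+\sum_{i=1}^K(1+\theta^{a_i})\,\theta^{T-\mathcal T_i}\,\delta_i+(1+\theta^s)\,\delta_{\rm OLS}.$$ Furthermore (on the same event), if $\delta_i\le C\delta_{\rm OLS}$ for $i=1,\dots,K$, where $C>0$ is a constant independent of $i$, then $$\mathbb{E}\|X(\beta_T-\beta)\|\le\theta^T\,\mathbb{E}\|X(\beta_0-\beta)\|+\Big[1+\theta^s\Big(1+\tfrac53 C\Big)\Big]\delta_{\rm OLS}.$$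
   Context: Model. $X\in\mathbb{R}^{N\times d}$ has full column rank, $N\gg d$, and $Y=X\beta+\zeta\in\mathbb{R}^N$, where $\beta\in\mathbb{R}^d$ is the true parameter and $\zeta$ is a zero-mean noise vector with covariance $\sigma^2 I_N$, independent of the sketching matrices. $\|\cdot\|$ is the Euclidean norm (spectral norm for matrices); logarithms are natural. $\mathbb{E}$ is expectation with respect to the noise $\zeta$ only (sketches held fixed); probabilities are over the sketching matrices. Sketches. An SRHT matrix of size $m\times N$ ($N$ a power of two) is $S=\sqrt{N/m}\,(HDP)_{\mathcal I,:}$, where $H$ is the normalized $N\times N$ Walsh–Hadamard matrix, $D$ is a diagonal matrix of independent Rademacher signs, $P$ is a random permutation matrix, and $\mathcal I$ is a uniformly sampled set of $m$ row indices. Let $d<m_1<\dots<m_K<N$ with $m_{i}=2m_{i-1}$ for $i\ge 2$. The sketches $S_i=\sqrt{N/m_i}\,(HDP)_{\mathcal I_i,:}\in\mathbb{R}^{m_i\times N}$ share the same $H,D,P$ and use nested random index sets $\mathcal I_1\subset\dots\subset\mathcal I_K$, $|\mathcal I_i|=m_i$, each $\mathcal I_i$ being a uniformly sampled set of $m_i$ row indices. $\widehat S\in\mathbb{R}^{r\times N}$ is an SRHT matrix independent of the $S_i$, and $\widehat H=(\widehat SX)^\top\widehat SX$. Estimators. $\tilde\beta^i=\arg\min_{u\in\mathbb{R}^d}\frac12\|S_iXu-S_iY\|^2$ and $\delta_i=\mathbb{E}\|X(\tilde\beta^i-\beta)\|$; $\hat\beta=(X^\top X)^{-1}X^\top Y$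 is the ordinary least-squares estimator and $\delta_{\rm OLS}=\mathbb{E}\|X(\hat\beta-\beta)\|$. PCG. $\mathrm{PCG}(A,b,\widehat H,\beta_{\rm init},a)$ is the iterate obtained after $a$ iterations (exact arithmetic) of the conjugate gradient method preconditioned by $\widehat H$ for $\min_u\frac12\|Au-b\|^2$ started at $\beta_{\rm init}$, i.e. $\widehat H^{-1/2}$ times the $a$-th CG iterate for the system $\widehat H^{-1/2}A^\top A\widehat H^{-1/2}\check u=\widehat H^{-1/2}A^\top b$ started at $\widehat H^{1/2}\beta_{\rm init}$ (if CG reaches the exact solution, subsequent iterates stay there). SPCG. Given $\beta_0\in\mathbb{R}^d$ and integers $a_1,\dots,a_K$, set $\mathcal T_0=0$, $\mathcal T_i=\sum_{\ell=1}^i a_\ell$, $T^\dagger=\mathcal T_K$. Stage I: for $i=1,\dots,K$, $\beta_{\mathcal T_i}=\mathrm{PCG}(S_iX,S_iY,\widehat H,\beta_{\mathcal T_{i-1}},a_i)$. Stage II (full problem): for an integer $T\ge T^\dagger$, $\beta_T=\mathrm{PCG}(X,Y,\widehat H,\beta_{T^\dagger},T-T^\dagger)$. *)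

theory Defs
  imports
    "HOL-Probability.Probability"
    "HOL-Probability.Product_PMF"
    "Jordan_Normal_Form.Gauss_Jordan_Elimination"
    "Jordan_Normal_Form.DL_Rank"
    "Jordan_Normal_Form.DL_Submatrix"
begin

text \<open>
  The dimensions \<open>N, d, r, m\<^sub>i\<close> are quantified inside the theorem (after the constant \<open>c\<close>), so
  vectors and matrices are those of Jordan Normal Form, with their dimensions given by carriers.
\<close>

hide_const (open) Finite_Cartesian_Product.vec Finite_Cartesian_Product.mat
hide_type (open) Finite_Cartesian_Product.vec

type_synonym rvec = "real Matrix.vec"
type_synonym rmat = "real Matrix.mat"

definition vnorm :: "rvec \<Rightarrow> real" where
  "vnorm v = sqrt (scalar_prod v v)"

text \<open>Junk value \<open>the None\<close> if the matrix is singular.\<close>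

definition minv :: "rmat \<Rightarrow> rmat" where
  "minv A = the (mat_inverse A)"

text \<open>The positive semidefinite square root of a symmetric positive semidefinite matrix.\<close>

definition msqrt :: "rmat \<Rightarrow> rmat" where
  "msqrt A = (THE R. R \<in> carrier_mat (dim_row A) (dim_row A) \<and> transpose_mat R = R
      \<and> (\<forall>v \<in> carrier_vec (dim_row A). 0 \<le> scalar_prod v (R *\<^sub>v v))
      \<and> R * R = A)"

definition full_column_rank :: "rmat \<Rightarrow> bool" where
  "full_column_rank A \<longleftrightarrow> vec_space.rank (dim_row A) A = dim_col A"


section \<open>Sketching matrices\<close>

text \<open>The normalized Walsh--Hadamard matrix of size \<open>2\<^sup>p\<close> (Sylvester's construction).\<close>

fun walsh_hadamard :: "nat \<Rightarrow> rmat" where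
  "walsh_hadamard 0 = 1\<^sub>m 1"
| "walsh_hadamard (Suc p) = (let H = walsh_hadamard p in
     (1 / sqrt 2) \<cdot>\<^sub>m four_block_mat H H H (- H))"

definition perm_mat :: "nat \<Rightarrow> (nat \<Rightarrow> nat) \<Rightarrow> rmat" where
  "perm_mat n f = Matrix.mat n n (\<lambda>(i, j). if j = f i then 1 else 0)"

text \<open>The matrix \<open>\<surd>(N/m) (H D P)\<^bsub>I,:\<^esub>\<close> with \<open>N = 2\<^sup>p\<close>, \<open>D\<close> having diagonal \<open>\<xi>\<close> and \<open>P\<close> the matrix of
  the permutation \<open>f\<close>.\<close>

definition srht :: "nat \<Rightarrow> nat \<Rightarrow> (nat \<Rightarrow> real) \<Rightarrow> (nat \<Rightarrow> nat) \<Rightarrow> nat set \<Rightarrow> rmat" where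
  "srht p m \<xi> f I =
     sqrt (2 ^ p / real m) \<cdot>\<^sub>m
       submatrix (walsh_hadamard p * mat_diag (2 ^ p) \<xi> * perm_mat (2 ^ p) f) I UNIV"

definition rademacher_pmf :: "nat \<Rightarrow> (nat \<Rightarrow> real) pmf" where
  "rademacher_pmf n = Pi_pmf {..<n} 1 (\<lambda>_. pmf_of_set {-1, 1})"

definition perm_pmf :: "nat \<Rightarrow> (nat \<Rightarrow> nat) pmf" where
  "perm_pmf n = pmf_of_set {f. f permutes {..<n}}"

definition index_pmf :: "nat \<Rightarrow> nat \<Rightarrow> nat set pmf" where
  "index_pmf n m = pmf_of_set {I. I \<subseteq> {..<n} \<and> card I = m}"

definition srht_pmf :: "nat \<Rightarrow> nat \<Rightarrow> rmat pmf" where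
  "srht_pmf p m =
     map_pmf (\<lambda>(\<xi>, f, I). srht p m \<xi> f I)
       (pair_pmf (rademacher_pmf (2 ^ p)) (pair_pmf (perm_pmf (2 ^ p)) (index_pmf (2 ^ p) m)))"

text \<open>\<open>Q\<close> is a joint law of index sets \<open>I\<^sub>1 \<subset> \<dots> \<subset> I\<^sub>K\<close> with each \<open>I\<^sub>i\<close> uniform among the \<open>m\<^sub>i\<close>-subsets of
  \<open>{0,\<dots>,n-1}\<close>; these two properties do not determine \<open>Q\<close>, and nothing more is required of it.\<close>

definition nested_index_law :: "nat \<Rightarrow> nat \<Rightarrow> (nat \<Rightarrow> nat) \<Rightarrow> (nat \<Rightarrow> nat set) pmf \<Rightarrow> bool" where
  "nested_index_law n K m Q \<longleftrightarrow>
     (\<forall>i\<in>{1..K}. map_pmf (\<lambda>I. I i) Q = index_pmf n (m i)) \<and>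
     (\<forall>I\<in>set_pmf Q. \<forall>i\<in>{1..<K}. I i \<subset> I (Suc i))"

definition nested_srht_pmf ::
    "nat \<Rightarrow> (nat \<Rightarrow> nat) \<Rightarrow> (nat \<Rightarrow> nat set) pmf \<Rightarrow> (nat \<Rightarrow> rmat) pmf" where
  "nested_srht_pmf p m Q =
     map_pmf (\<lambda>(\<xi>, f, I). \<lambda>i. srht p (m i) \<xi> f (I i))
       (pair_pmf (rademacher_pmf (2 ^ p)) (pair_pmf (perm_pmf (2 ^ p)) Q))"


section \<open>Noise and estimators\<close>

text \<open>The noise enters through its law on \<open>\<real>\<^sup>n\<close>, so that arbitrary noise can be quantified over after
  the constant of the theorem; taking \<open>\<E>\<close> with respect to this law, with the sketches held fixed,
  is what their independence from the noise amounts to.\<close>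

definition noise_law :: "nat \<Rightarrow> real \<Rightarrow> (nat \<Rightarrow> real) measure \<Rightarrow> bool" where
  "noise_law n \<sigma> \<mu> \<longleftrightarrow>
     prob_space \<mu> \<and> sets \<mu> = sets (Pi\<^sub>M {..<n} (\<lambda>_. borel)) \<and>
     (\<forall>i<n. integrable \<mu> (\<lambda>\<zeta>. \<zeta> i) \<and> (\<integral>\<zeta>. \<zeta> i \<partial>\<mu>) = 0) \<and>
     (\<forall>i<n. \<forall>j<n. integrable \<mu> (\<lambda>\<zeta>. \<zeta> i * \<zeta> j) \<and>
        (\<integral>\<zeta>. \<zeta> i * \<zeta> j \<partial>\<mu>) = (if i = j then \<sigma>\<^sup>2 else 0))"

definition response :: "rmat \<Rightarrow> rvec \<Rightarrow> (nat \<Rightarrow> real) \<Rightarrow> rvec" where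
  "response X \<beta> \<zeta> = X *\<^sub>v \<beta> + Matrix.vec (dim_row X) \<zeta>"

text \<open>\<open>\<E>\<parallel>X (b - \<beta>)\<parallel>\<close> for an estimator \<open>b\<close> given as a function of the response \<open>Y\<close>.\<close>

definition pred_error ::
    "(nat \<Rightarrow> real) measure \<Rightarrow> rmat \<Rightarrow> rvec \<Rightarrow> (rvec \<Rightarrow> rvec) \<Rightarrow> real" where
  "pred_error \<mu> X \<beta> b = (\<integral>\<zeta>. vnorm (X *\<^sub>v (b (response X \<beta> \<zeta>) - \<beta>)) \<partial>\<mu>)"

definition least_squares :: "rmat \<Rightarrow> rvec \<Rightarrow> rvec" where
  "least_squares A b =
     arg_min (\<lambda>u. 1 / 2 * (vnorm (A *\<^sub>v u - b))\<^sup>2) (\<lambda>u. u \<in> carrier_vec (dim_col A))"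

definition ols :: "rmat \<Rightarrow> rvec \<Rightarrow> rvec" where
  "ols X Y = minv (transpose_mat X * X) *\<^sub>v (transpose_mat X *\<^sub>v Y)"


section \<open>Conjugate gradients\<close>

text \<open>State (iterate, residual, search direction) after the given number of steps of the conjugate
  gradient method for \<open>B u = f\<close> started at \<open>x\<close>.\<close>

fun cg :: "rmat \<Rightarrow> rvec \<Rightarrow> rvec \<Rightarrow> nat \<Rightarrow> rvec \<times> rvec \<times> rvec" where
  "cg B f x 0 = (x, f - B *\<^sub>v x, f - B *\<^sub>v x)"
| "cg B f x (Suc k) =
     (let (u, g, q) = cg B f x k in
      if g = 0\<^sub>v (dim_vec g) then (u, g, q)
      else
        let \<alpha> = scalar_prod g g / scalar_prod q (B *\<^sub>v q);
            g' = g - \<alpha> \<cdot>\<^sub>v (B *\<^sub>v q);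
            \<gamma> = scalar_prod g' g' / scalar_prod g g
        in (u + \<alpha> \<cdot>\<^sub>v q, g', g' + \<gamma> \<cdot>\<^sub>v q))"

definition pcg :: "rmat \<Rightarrow> rvec \<Rightarrow> rmat \<Rightarrow> rvec \<Rightarrow> nat \<Rightarrow> rvec" where
  "pcg A b M x k =
     (let W = minv (msqrt M);
          B = W * (transpose_mat A * A) * W;
          f = W *\<^sub>v (transpose_mat A *\<^sub>v b)
      in W *\<^sub>v fst (cg B f (msqrt M *\<^sub>v x) k))"

definition stage_end :: "(nat \<Rightarrow> nat) \<Rightarrow> nat \<Rightarrow> nat" where
  "stage_end a i = (\<Sum>l = 1..i. a l)"

text \<open>The Stage I iterate \<open>\<beta>\<^bsub>\<T>\<^sub>i\<^esub>\<close>, for the preconditioner \<open>M\<close>.\<close>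

fun spcg_stage1 ::
    "rmat \<Rightarrow> rvec \<Rightarrow> (nat \<Rightarrow> rmat) \<Rightarrow> rmat \<Rightarrow> (nat \<Rightarrow> nat) \<Rightarrow> rvec \<Rightarrow> nat \<Rightarrow> rvec" where
  "spcg_stage1 X Y S M a \<beta>\<^sub>0 0 = \<beta>\<^sub>0"
| "spcg_stage1 X Y S M a \<beta>\<^sub>0 (Suc i) =
     pcg (S (Suc i) * X) (S (Suc i) *\<^sub>v Y) M (spcg_stage1 X Y S M a \<beta>\<^sub>0 i) (a (Suc i))"

text \<open>The iterate \<open>\<beta>\<^sub>T\<close>, for \<open>T \<ge> stage_end a K\<close>; \<open>R\<close> is the sketch defining the preconditioner.\<close>

definition spcg ::
    "nat \<Rightarrow> rmat \<Rightarrow> rvec \<Rightarrow> (nat \<Rightarrow> rmat) \<Rightarrow> rmat \<Rightarrow> (nat \<Rightarrow> nat) \<Rightarrow> rvec \<Rightarrow> nat \<Rightarrow> rvec" where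
  "spcg K X Y S R a \<beta>\<^sub>0 T =
     (let M = transpose_mat (R * X) * (R * X)
      in pcg X Y M (spcg_stage1 X Y S M a \<beta>\<^sub>0 K) (T - stage_end a K))"

text \<open>The sketched least-squares minimizers and the inverse of the preconditioner exist (uniquely) exactly
  under these rank conditions, which depend on the random sketches.\<close>

definition well_posed :: "nat \<Rightarrow> rmat \<Rightarrow> (nat \<Rightarrow> rmat) \<Rightarrow> rmat \<Rightarrow> bool" where
  "well_posed K X S R \<longleftrightarrow>
     (\<forall>i\<in>{1..K}. full_column_rank (S i * X)) \<and> full_column_rank (R * X)"

end

theory Submission
  imports Defs
begin

text \<open>
  The error bound is a deterministic consequence of one event: every sketched matrix \<open>S\<^sub>i X\<close>, and
  the matrix \<open>R X\<close> that defines the preconditioner, preserves the squared norm of every \<open>X y\<close> up to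
  a relative error of \<open>1/100\<close>.

  On this event all the preconditioned systems have condition number at most \<open>(101/99)\<^sup>2\<close>. A
  conjugate gradient step lowers the energy of the error at least as much as a steepest descent
  step, because the search direction is the residual minus its component along the previous
  direction and so has no more energy than the residual; hence one step leaves at most the
  fraction \<open>1/25\<close> of the energy of the error (\<open>spd_mat.cg_contraction\<close>, \<open>pcg_contraction\<close>). A stage of at least
  one step is measured in the norm of \<open>S\<^sub>i X\<close>; the price for passing to the norm of \<open>X\<close> is absorbed
  in the gap between \<open>1/5\<close> and \<open>1/4\<close> (\<open>pcg_stage\<close>). Each stage thus contracts the distance to its
  own minimiser by \<open>(1/4)\<^sup>a\<close>, and the triangle inequality through the successive minimisers yields
  the sum over the stages (\<open>spcg_pointwise\<close>). The minimisers are linear in the response, so the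
  right side is integrable and the inequality may be averaged over the noise (\<open>pred_error_spcg\<close>). A
  geometric series bounds the weights of the stages by \<open>5/3\<close> (\<open>stage_weights_sum\<close>).

  It remains to see that a sketch of size of order \<open>(d + ln (N/\<delta>)) ln (d/\<delta>)\<close> preserves norms with
  probability \<open>1 - \<delta>\<close> (\<open>srht_embedding\<close>). Write \<open>X = U R\<close> with orthonormal columns of \<open>U\<close>; the rows
  of \<open>U\<close> are a tight frame of \<open>\<real>\<^sup>d\<close>, and so are the rows \<open>v\<^sub>i\<close> of \<open>H D P U\<close>. Each \<open>v\<^sub>i\<close> is a Rademacher
  sum, whose squared norm has exponential moments comparable to those of a Gaussian vector, so all
  rows have squared norm \<open>O((d + ln (N/\<delta>))/N)\<close> (\<open>rotated_row_tail\<close>). For a tight frame with short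
  vectors, the sum of \<open>v\<^sub>i v\<^sub>i\<^sup>T\<close> over a random set of \<open>m\<close> indices is close to \<open>m/N\<close> times the identity
  (\<open>tight_frame.sampling_without_replacement\<close>). This matrix concentration is proved by the method of
  exchangeable pairs: exchanging one sampled index for an unsampled one moves the deviation matrix
  towards zero on average, and a mean value inequality for traces turns this into a recursion
  between its even trace moments. The trace has \<open>d\<close> terms, which is the source of the logarithmic
  factor. A union bound over the \<open>K\<close> nested sketches, each with failure probability \<open>\<delta>/K\<close>, and the
  sketch of the preconditioner gives the total \<open>2\<delta>\<close>.
\<close>

unbundle no inner_syntax and no vec_syntax

section \<open>Orthonormal eigenbases of symmetric matrices\<close>

text \<open>
  The dimension \<open>n\<close> is a number, not a type. Vectors of \<open>\<real>\<^sup>n\<close> are functions on the naturals of which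
  only the values below \<open>n\<close> count; on these the product topology is available for compactness
  arguments.
\<close>

definition ip :: "nat \<Rightarrow> (nat \<Rightarrow> real) \<Rightarrow> (nat \<Rightarrow> real) \<Rightarrow> real" where
  "ip n x y = (\<Sum>a<n. x a * y a)"

definition mulv :: "nat \<Rightarrow> (nat \<Rightarrow> nat \<Rightarrow> real) \<Rightarrow> (nat \<Rightarrow> real) \<Rightarrow> nat \<Rightarrow> real" where
  "mulv n A x a = (\<Sum>b<n. A a b * x b)"

lemma ip_commute: "ip n x y = ip n y x"
  by (simp add: ip_def mult.commute)

lemma ip_add_left: "ip n (\<lambda>a. x a + y a) z = ip n x z + ip n y z"
  by (simp add: ip_def algebra_simps sum.distrib)

lemma ip_add_right: "ip n z (\<lambda>a. x a + y a) = ip n z x + ip n z y"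
  by (simp add: ip_def algebra_simps sum.distrib)

lemma ip_diff_left: "ip n (\<lambda>a. x a - y a) z = ip n x z - ip n y z"
  by (simp add: ip_def algebra_simps sum_subtractf)

lemma ip_diff_right: "ip n z (\<lambda>a. x a - y a) = ip n z x - ip n z y"
  by (simp add: ip_def algebra_simps sum_subtractf)

lemma ip_scale_left: "ip n (\<lambda>a. c * x a) z = c * ip n x z"
  by (simp add: ip_def algebra_simps sum_distrib_left)

lemma ip_scale_right: "ip n z (\<lambda>a. c * x a) = c * ip n z x"
  by (simp add: ip_def algebra_simps sum_distrib_left)

lemma ip_sum_left: "ip n (\<lambda>a. \<Sum>i\<in>I. f i a) z = (\<Sum>i\<in>I. ip n (f i) z)"
  by (simp add: ip_def sum_distrib_right sum.swap[of _ _ I])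

lemma ip_sum_right: "ip n z (\<lambda>a. \<Sum>i\<in>I. f i a) = (\<Sum>i\<in>I. ip n z (f i))"
  by (simp add: ip_def sum_distrib_left sum.swap[of _ _ I])

lemmas ip_linear = ip_add_left ip_add_right ip_diff_left ip_diff_right ip_scale_left
  ip_scale_right ip_sum_left ip_sum_right

lemma ip_self_nonneg: "0 \<le> ip n x x"
  by (simp add: ip_def sum_nonneg)

lemma ip_self_eq_0: "ip n x x = 0 \<longleftrightarrow> (\<forall>a<n. x a = 0)"
  by (auto simp: ip_def sum_nonneg_eq_0_iff)

lemma ip_cong: "(\<And>a. a < n \<Longrightarrow> x a = x' a) \<Longrightarrow> (\<And>a. a < n \<Longrightarrow> y a = y' a) \<Longrightarrow> ip n x y = ip n x' y'"
  by (simp add: ip_def)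

lemma ip_mulv_sym:
  assumes "\<And>a b. a < n \<Longrightarrow> b < n \<Longrightarrow> A a b = A b a"
  shows "ip n (mulv n A x) y = ip n x (mulv n A y)"
proof -
  have "ip n (mulv n A x) y = (\<Sum>a<n. \<Sum>b<n. A a b * x b * y a)"
    by (simp add: ip_def mulv_def sum_distrib_right)
  also have "\<dots> = (\<Sum>b<n. \<Sum>a<n. A a b * x b * y a)"
    by (rule sum.swap)
  also have "\<dots> = (\<Sum>b<n. \<Sum>a<n. A b a * x b * y a)"
    using assms by (intro sum.cong) auto
  finally show ?thesis
    by (simp add: ip_def mulv_def sum_distrib_left mult_ac)
qed

definition orthonormal :: "nat \<Rightarrow> nat \<Rightarrow> (nat \<Rightarrow> nat \<Rightarrow> real) \<Rightarrow> bool" where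
  "orthonormal n k u \<longleftrightarrow> (\<forall>i<k. \<forall>j<k. ip n (u i) (u j) = (if i = j then 1 else 0))"

text \<open>
  The squared coordinates of the \<open>k\<close> vectors sum to \<open>k < n\<close>, so some coordinate direction \<open>e\<^sub>a\<close> has
  a projection of squared length less than \<open>1\<close> on their span; the remainder of \<open>e\<^sub>a\<close>, normalised, is
  the new vector.
\<close>

lemma orthonormal_extend:
  assumes u: "orthonormal n k u" and "k < n"
  obtains x where "ip n x x = 1" "\<And>i. i < k \<Longrightarrow> ip n (u i) x = 0"
proof -
  have "(\<Sum>a<n. \<Sum>i<k. (u i a)\<^sup>2) = (\<Sum>i<k. ip n (u i) (u i))"
    by (subst sum.swap) (simp add: ip_def power2_eq_square)
  also have "\<dots> = real k"
    using u by (simp add: orthonormal_def)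
  also have "\<dots> < (\<Sum>a<n. 1)"
    using \<open>k < n\<close> by simp
  finally have "\<exists>a<n. (\<Sum>i<k. (u i a)\<^sup>2) < 1"
    by (meson lessThan_iff not_le sum_mono)
  then obtain a where a: "a < n" "(\<Sum>i<k. (u i a)\<^sup>2) < 1"
    by blast
  define e where "e = (\<lambda>b. if b = a then 1 else 0 :: real)"
  define x where "x = (\<lambda>b. e b - (\<Sum>i<k. u i a * u i b))"
  have ipe: "ip n y e = y a" for y
    using a(1) by (simp add: ip_def e_def if_distrib cong: if_cong)
  have orth: "ip n (u j) x = 0" if "j < k" for j
  proof -
    have "ip n (u j) x = u j a - (\<Sum>i<k. u i a * ip n (u j) (u i))"
      by (simp add: x_def ip_linear ipe)
    also have "(\<Sum>i<k. u i a * ip n (u j) (u i)) = (\<Sum>i<k. if j = i then u i a else 0)"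
      using u that by (intro sum.cong) (auto simp: orthonormal_def)
    finally show ?thesis
      using that by simp
  qed
  have "x a \<noteq> 0"
    using a by (simp add: x_def e_def power2_eq_square)
  then have pos: "ip n x x > 0"
    using ip_self_eq_0[of n x] ip_self_nonneg[of n x] a(1) by force
  show thesis
  proof
    show "ip n (\<lambda>b. (1 / sqrt (ip n x x)) * x b) (\<lambda>b. (1 / sqrt (ip n x x)) * x b) = 1"
      unfolding ip_linear using pos by simp
    show "ip n (u i) (\<lambda>b. (1 / sqrt (ip n x x)) * x b) = 0" if "i < k" for i
      unfolding ip_linear using orth[OF that] by simp
  qed
qed

lemma continuous_on_ip [continuous_intros]:
  fixes f g :: "'x::topological_space \<Rightarrow> nat \<Rightarrow> real"
  assumes "\<And>a. continuous_on S (\<lambda>x. f x a)" "\<And>a. continuous_on S (\<lambda>x. g x a)"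
  shows "continuous_on S (\<lambda>x. ip n (f x) (g x))"
  unfolding ip_def using assms by (intro continuous_intros)

text \<open>
  The unit sphere of the complement is compact after the irrelevant coordinates have been set to
  \<open>0\<close>.
\<close>

lemma rayleigh_max_exists:
  assumes S: "S = {x. ip n x x = 1 \<and> (\<forall>i<k. ip n (u i) x = 0)}" and "S \<noteq> {}"
  obtains x where "x \<in> S" "\<And>y. y \<in> S \<Longrightarrow> ip n y (mulv n A y) \<le> ip n x (mulv n A x)"
proof -
  define K where "K = PiE UNIV (\<lambda>a. if a < n then {-1..1::real} else {0})"
  have "compactin (product_topology (\<lambda>_. euclidean) UNIV) K"
    unfolding K_def by (subst compactin_PiE) (auto simp: compactin_euclidean_iff)
  then have K: "compact K"
    unfolding euclidean_product_topology by (simp add: compactin_euclidean_iff)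
  have coord: "continuous_on T (\<lambda>x. x a)" for T :: "(nat \<Rightarrow> real) set" and a
    by (rule continuous_on_subset[OF continuous_on_product_coordinates]) simp
  have "closed {x. ip n x x = 1}"
    by (intro closed_Collect_eq continuous_intros coord)
  moreover have "closed {x. \<forall>i<k. ip n (u i) x = 0}"
    by (intro closed_Collect_all closed_Collect_imp closed_Collect_eq continuous_intros coord) auto
  ultimately have "closed S"
    unfolding S by (simp add: closed_Int Collect_conj_eq)
  then have comp: "compact (K \<inter> S)"
    using K by (simp add: compact_Int_closed)
  define cut where "cut x a = (if a < n then x a else 0)" for x :: "nat \<Rightarrow> real" and a
  have cut: "cut x \<in> K \<inter> S" "ip n (cut x) (mulv n A (cut x)) = ip n x (mulv n A x)" if "x \<in> S" for x
  proof -
    have x1: "ip n x x = 1"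
      using that S by auto
    have "\<bar>x a\<bar> \<le> 1" if "a < n" for a
    proof -
      have "(x a)\<^sup>2 \<le> ip n x x"
        unfolding ip_def power2_eq_square using that by (intro member_le_sum) auto
      then show ?thesis
        using x1 by (simp add: abs_square_le_1)
    qed
    then have "cut x \<in> K"
      by (auto simp: K_def cut_def PiE_iff abs_le_iff minus_le_iff)
    moreover have "cut x \<in> S"
      using that unfolding S by (auto simp: cut_def ip_def)
    ultimately show "cut x \<in> K \<inter> S" ..
    show "ip n (cut x) (mulv n A (cut x)) = ip n x (mulv n A x)"
      by (simp add: cut_def ip_def mulv_def)
  qed
  have "K \<inter> S \<noteq> {}"
    using cut(1) \<open>S \<noteq> {}\<close> by blast
  moreover have "continuous_on (K \<inter> S) (\<lambda>x. ip n x (mulv n A x))"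
    unfolding mulv_def by (intro continuous_intros coord)
  ultimately obtain x where x: "x \<in> K \<inter> S"
      "\<forall>y\<in>K \<inter> S. ip n y (mulv n A y) \<le> ip n x (mulv n A x)"
    using continuous_attains_sup[OF comp] by blast
  show thesis
  proof
    show "x \<in> S" using x by simp
    show "ip n y (mulv n A y) \<le> ip n x (mulv n A x)" if "y \<in> S" for y
      using x(2) cut[OF that] by metis
  qed
qed

lemma linear_le_square_imp_zero:
  fixes a c :: real
  assumes "0 \<le> a" "\<And>t. 2 * t * a \<le> t\<^sup>2 * c"
  shows "a = 0"
proof (rule ccontr)
  assume "a \<noteq> 0"
  then have "a > 0" using assms by simp
  define t where "t = a / (\<bar>c\<bar> + 1)"
  have t: "t > 0" using \<open>a > 0\<close> by (simp add: t_def divide_pos_pos)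
  have "2 * a \<le> t * c"
    using assms(2)[of t] t by (simp add: power2_eq_square)
  also have "\<dots> \<le> t * (\<bar>c\<bar> + 1)"
    using t by (intro mult_left_mono) auto
  also have "\<dots> = a"
    by (simp add: t_def)
  finally show False using \<open>a > 0\<close> by simp
qed

text \<open>
  A maximiser \<open>x\<close> of the quadratic form on the unit sphere of the complement is an eigenvector:
  moving from \<open>x\<close> in the direction of \<open>A x - l x\<close>, which lies in the complement again, would
  increase the Rayleigh quotient to first order unless this vector vanishes.
\<close>

lemma eigenvector_in_complement:
  assumes sym: "\<And>a b. a < n \<Longrightarrow> b < n \<Longrightarrow> A a b = A b a"
    and u: "orthonormal n k u" and "k < n"
    and eig: "\<And>i a. i < k \<Longrightarrow> a < n \<Longrightarrow> mulv n A (u i) a = lam i * u i a"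
  obtains x l where "ip n x x = 1" "\<And>i. i < k \<Longrightarrow> ip n (u i) x = 0"
    "\<And>a. a < n \<Longrightarrow> mulv n A x a = l * x a"
proof -
  define S where "S = {x. ip n x x = 1 \<and> (\<forall>i<k. ip n (u i) x = 0)}"
  have "S \<noteq> {}"
    using orthonormal_extend[OF u \<open>k < n\<close>] unfolding S_def by blast
  then obtain x where x: "x \<in> S" and max: "\<And>y. y \<in> S \<Longrightarrow> ip n y (mulv n A y) \<le> ip n x (mulv n A x)"
    using rayleigh_max_exists[OF S_def] by blast
  define l where "l = ip n x (mulv n A x)"
  have x1: "ip n x x = 1" and xu: "\<And>i. i < k \<Longrightarrow> ip n (u i) x = 0"
    using x by (auto simp: S_def)
  have mulv_scale: "mulv n A (\<lambda>a. c * y a) = (\<lambda>a. c * mulv n A y a)" for c y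
    by (rule ext) (simp add: mulv_def sum_distrib_left mult_ac)
  have mulv_add: "mulv n A (\<lambda>a. y a + z a) = (\<lambda>a. mulv n A y a + mulv n A z a)" for y z
    by (rule ext) (simp add: mulv_def sum.distrib algebra_simps)
  have bound: "ip n y (mulv n A y) \<le> l * ip n y y" if y: "\<And>i. i < k \<Longrightarrow> ip n (u i) y = 0" for y
  proof (cases "ip n y y = 0")
    case True
    then have "ip n y (mulv n A y) = 0"
      unfolding ip_self_eq_0 by (simp add: ip_def)
    then show ?thesis using True by simp
  next
    case False
    then have pos: "ip n y y > 0" using ip_self_nonneg[of n y] by simp
    define c where "c = 1 / sqrt (ip n y y)"
    have "(\<lambda>a. c * y a) \<in> S"
      using y pos unfolding S_def mem_Collect_eq ip_linear by (simp add: c_def)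
    from max[OF this] have "c\<^sup>2 * ip n y (mulv n A y) \<le> l"
      by (simp add: mulv_scale ip_linear l_def power2_eq_square)
    then show ?thesis
      using pos by (simp add: c_def power_divide field_simps)
  qed
  define r where "r = (\<lambda>a. mulv n A x a - l * x a)"
  have ru: "ip n (u i) r = 0" if "i < k" for i
  proof -
    have "ip n (u i) (mulv n A x) = ip n (mulv n A (u i)) x"
      using ip_mulv_sym[OF sym] by simp
    also have "\<dots> = ip n (\<lambda>a. lam i * u i a) x"
      using eig[OF that] by (intro ip_cong) auto
    finally show ?thesis
      by (simp add: r_def ip_linear xu[OF that])
  qed
  have "2 * t * ip n r r \<le> t\<^sup>2 * (l * ip n r r - ip n r (mulv n A r))" for t
  proof -
    define y where "y = (\<lambda>a. x a + t * r a)"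
    have "ip n y (mulv n A y) \<le> l * ip n y y"
      by (rule bound) (simp add: y_def ip_linear xu ru)
    moreover have "ip n x (mulv n A r) = ip n (mulv n A x) r"
      using ip_mulv_sym[OF sym] by simp
    then have "ip n y (mulv n A y) = l + 2 * t * ip n (mulv n A x) r + t\<^sup>2 * ip n r (mulv n A r)"
      by (simp add: y_def mulv_add mulv_scale ip_linear l_def[symmetric] power2_eq_square
          algebra_simps ip_commute[of n r "mulv n A x"])
    moreover have "ip n y y = 1 + 2 * t * ip n x r + t\<^sup>2 * ip n r r"
      by (simp add: y_def ip_linear x1 power2_eq_square algebra_simps ip_commute[of n r x])
    moreover have "ip n r r = ip n (mulv n A x) r - l * ip n x r"
    proof -
      have "ip n r r = ip n (\<lambda>a. mulv n A x a - l * x a) r" by (simp add: r_def)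
      then show ?thesis unfolding ip_linear .
    qed
    moreover have "2 * t * (ip n (mulv n A x) r - l * ip n x r)
        = 2 * t * ip n (mulv n A x) r - l * (2 * t * ip n x r)"
      by (simp add: algebra_simps)
    moreover have "t\<^sup>2 * (l * ip n r r - ip n r (mulv n A r))
        = l * (t\<^sup>2 * ip n r r) - t\<^sup>2 * ip n r (mulv n A r)"
      by (simp add: algebra_simps)
    ultimately show ?thesis
      by (simp add: distrib_left)
  qed
  then have "ip n r r = 0"
    by (rule linear_le_square_imp_zero[OF ip_self_nonneg])
  then have "mulv n A x a = l * x a" if "a < n" for a
    using that by (simp add: ip_self_eq_0 r_def)
  then show thesis
    using that x1 xu by blast
qed

theorem spectral_theorem:
  assumes sym: "\<And>a b. a < n \<Longrightarrow> b < n \<Longrightarrow> A a b = A b a"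
  shows "\<exists>u lam. orthonormal n n u \<and> (\<forall>i<n. \<forall>a<n. mulv n A (u i) a = lam i * u i a)"
proof -
  have "\<exists>u lam. orthonormal n k u \<and> (\<forall>i<k. \<forall>a<n. mulv n A (u i) a = lam i * u i a)"
    if "k \<le> n" for k
    using that
  proof (induction k)
    case 0
    then show ?case by (simp add: orthonormal_def)
  next
    case (Suc k)
    then obtain u lam where u: "orthonormal n k u"
      and eig: "\<And>i a. i < k \<Longrightarrow> a < n \<Longrightarrow> mulv n A (u i) a = lam i * u i a"
      by auto
    from Suc.prems have "k < n" by simp
    from eigenvector_in_complement[OF sym u this eig] obtain x l
      where x: "ip n x x = 1" "\<And>i. i < k \<Longrightarrow> ip n (u i) x = 0"
        "\<And>a. a < n \<Longrightarrow> mulv n A x a = l * x a"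
      by metis
    have x': "ip n x (u i) = 0" if "i < k" for i
      using x(2)[OF that] by (simp add: ip_commute)
    have "orthonormal n (Suc k) (u(k := x))"
      using u x(1,2) x' by (auto simp: orthonormal_def less_Suc_eq)
    moreover have "\<forall>i<Suc k. \<forall>a<n. mulv n A ((u(k := x)) i) a = (lam(k := l)) i * (u(k := x)) i a"
      using eig x(3) by (auto simp: less_Suc_eq)
    ultimately show ?case by blast
  qed
  then show ?thesis by blast
qed

text \<open>
  The matrix with rows \<open>u\<^sub>i\<close> has its transpose as right inverse, hence also as left inverse.
\<close>

lemma orthonormal_expand:
  assumes u: "orthonormal n n u" and "a < n"
  shows "(\<Sum>i<n. ip n (u i) x * u i a) = x a"
proof -
  define r where "r = (\<lambda>b. x b - (\<Sum>i<n. ip n (u i) x * u i b))"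
  have orth: "ip n (u j) r = 0" if "j < n" for j
  proof -
    have "ip n (u j) r = ip n (u j) x - (\<Sum>i<n. ip n (u i) x * ip n (u j) (u i))"
      by (simp add: r_def ip_linear)
    also have "(\<Sum>i<n. ip n (u i) x * ip n (u j) (u i)) = (\<Sum>i<n. if j = i then ip n (u i) x else 0)"
      using u that by (intro sum.cong) (auto simp: orthonormal_def)
    finally show ?thesis using that by simp
  qed
  have U: "Matrix.mat n n (\<lambda>(i, b). u i b) * Matrix.mat n n (\<lambda>(b, i). u i b) = 1\<^sub>m n"
    using u by (intro eq_matI) (auto simp: scalar_prod_def orthonormal_def ip_def lessThan_atLeast0)
  have "Matrix.mat n n (\<lambda>(b, i). u i b) * Matrix.mat n n (\<lambda>(i, b). u i b) = 1\<^sub>m n"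
    by (rule mat_mult_left_right_inverse[OF _ _ U]) auto
  then have col: "(\<Sum>i<n. u i b * u i c) = (if b = c then 1 else 0)" if "b < n" "c < n" for b c
    using that by (auto dest!: arg_cong[where f = "\<lambda>M. M $$ (b, c)"]
        simp: scalar_prod_def lessThan_atLeast0)
  have "(\<Sum>i<n. ip n (u i) x * u i a) = (\<Sum>i<n. \<Sum>b<n. x b * (u i b * u i a))"
    by (simp add: ip_def sum_distrib_left sum_distrib_right mult_ac)
  also have "\<dots> = (\<Sum>b<n. x b * (\<Sum>i<n. u i b * u i a))"
    by (subst sum.swap) (simp add: sum_distrib_left)
  also have "\<dots> = (\<Sum>b<n. if b = a then x b else 0)"
    using col \<open>a < n\<close> by (intro sum.cong) auto
  finally show ?thesis using \<open>a < n\<close> by simp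
qed

lemma parseval:
  assumes u: "orthonormal n n u"
  shows "ip n x y = (\<Sum>i<n. ip n (u i) x * ip n (u i) y)"
proof -
  have "ip n x y = ip n (\<lambda>a. \<Sum>i<n. ip n (u i) x * u i a) y"
    using orthonormal_expand[OF u] by (intro ip_cong) auto
  then show ?thesis by (simp add: ip_linear)
qed

section \<open>Conjugate gradients\<close>

abbreviation sqnorm :: "rvec \<Rightarrow> real" where
  "sqnorm x \<equiv> x \<bullet> x"

lemma scalar_prod_self_nonneg: "0 \<le> x \<bullet> (x :: rvec)"
  by (simp add: scalar_prod_def sum_nonneg)

lemma scalar_prod_self_eq_0:
  "x \<in> carrier_vec n \<Longrightarrow> x \<bullet> (x :: rvec) = 0 \<longleftrightarrow> x = 0\<^sub>v n"
  by (auto simp: scalar_prod_def sum_nonneg_eq_0_iff)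

lemma scalar_prod_self_pos:
  "x \<in> carrier_vec n \<Longrightarrow> x \<noteq> 0\<^sub>v n \<Longrightarrow> 0 < x \<bullet> (x :: rvec)"
  using scalar_prod_self_nonneg[of x] scalar_prod_self_eq_0[of x n] by linarith

lemma scalar_prod_transpose_mult:
  fixes A :: rmat
  assumes "A \<in> carrier_mat m n" "x \<in> carrier_vec n" "y \<in> carrier_vec m"
  shows "x \<bullet> (transpose_mat A *\<^sub>v y) = (A *\<^sub>v x) \<bullet> y"
proof -
  have "x \<bullet> (transpose_mat A *\<^sub>v y) = (transpose_mat A *\<^sub>v y) \<bullet> x"
    using assms by (intro comm_scalar_prod[of _ n]) auto
  also have "\<dots> = y \<bullet> (A *\<^sub>v x)"
    using assms by (intro transpose_vec_mult_scalar) auto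
  also have "\<dots> = (A *\<^sub>v x) \<bullet> y"
    using assms by (intro comm_scalar_prod[of _ m]) auto
  finally show ?thesis .
qed

locale spd_mat =
  fixes n :: nat and B :: rmat
  assumes carrier [simp]: "B \<in> carrier_mat n n"
    and symmetric: "transpose_mat B = B"
    and pos: "\<And>x. x \<in> carrier_vec n \<Longrightarrow> x \<noteq> 0\<^sub>v n \<Longrightarrow> 0 < x \<bullet> (B *\<^sub>v x)"
begin

lemma dims [simp]: "dim_row B = n" "dim_col B = n"
  using carrier_matD[OF carrier] by simp_all

lemma mult_carrier [simp]: "x \<in> carrier_vec n \<Longrightarrow> B *\<^sub>v x \<in> carrier_vec n"
  by (rule mult_mat_vec_carrier[OF carrier])

lemmas form_expand = scalar_prod_add_distrib[of _ n] add_scalar_prod_distrib[of _ n]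
  smult_scalar_prod_distrib[of _ n] scalar_prod_smult_distrib[of _ n]
  scalar_prod_minus_distrib[of _ n] minus_scalar_prod_distrib[of _ n]
  mult_add_distrib_mat_vec[of _ n n] mult_mat_vec[of _ n n] mult_minus_distrib_mat_vec[of _ n n]

lemma form_sym:
  assumes "x \<in> carrier_vec n" "y \<in> carrier_vec n"
  shows "x \<bullet> (B *\<^sub>v y) = y \<bullet> (B *\<^sub>v x)"
proof -
  have "x \<bullet> (B *\<^sub>v y) = (B *\<^sub>v x) \<bullet> y"
    using scalar_prod_transpose_mult[OF carrier assms] symmetric by simp
  also have "\<dots> = y \<bullet> (B *\<^sub>v x)"
    using assms by (intro comm_scalar_prod[of _ n]) auto
  finally show ?thesis .
qed

lemma cg_step_form:
  assumes "e \<in> carrier_vec n" "q \<in> carrier_vec n"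
  shows "(e + t \<cdot>\<^sub>v q) \<bullet> (B *\<^sub>v (e + t \<cdot>\<^sub>v q))
    = e \<bullet> (B *\<^sub>v e) + 2 * t * (q \<bullet> (B *\<^sub>v e)) + t\<^sup>2 * (q \<bullet> (B *\<^sub>v q))"
  using assms form_sym[OF assms]
  by (simp add: form_expand power2_eq_square algebra_simps)

text \<open>
  The relations between residual \<open>g\<close> and search direction \<open>q\<close> that one step uses and restores. The
  last one, that \<open>q\<close> has no more energy than \<open>g\<close>, is what makes conjugate gradients at least as good
  as steepest descent; it holds because \<open>g\<close> is the sum of \<open>q\<close> and a conjugate vector, a multiple of
  the previous direction.
\<close>

definition cg_invariant :: "rvec \<Rightarrow> rvec \<times> rvec \<times> rvec \<Rightarrow> bool" where
  "cg_invariant f s \<longleftrightarrow> (case s of (u, g, q) \<Rightarrow>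
     u \<in> carrier_vec n \<and> q \<in> carrier_vec n \<and> g = f - B *\<^sub>v u \<and> g \<bullet> q = g \<bullet> g \<and>
     q \<bullet> (B *\<^sub>v g) = q \<bullet> (B *\<^sub>v q) \<and> q \<bullet> (B *\<^sub>v q) \<le> g \<bullet> (B *\<^sub>v g))"

lemma cg_step:
  assumes f: "f \<in> carrier_vec n" and inv: "cg_invariant f (u, g, q)" and g0: "g \<noteq> 0\<^sub>v n"
  defines "\<alpha> \<equiv> (g \<bullet> g) / (q \<bullet> (B *\<^sub>v q))"
  defines "g' \<equiv> g - \<alpha> \<cdot>\<^sub>v (B *\<^sub>v q)"
  defines "\<gamma> \<equiv> (g' \<bullet> g') / (g \<bullet> g)"
  shows "cg_invariant f (u + \<alpha> \<cdot>\<^sub>v q, g', g' + \<gamma> \<cdot>\<^sub>v q)" and "0 < q \<bullet> (B *\<^sub>v q)"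
proof -
  from inv have u [simp]: "u \<in> carrier_vec n" and q [simp]: "q \<in> carrier_vec n"
    and g: "g = f - B *\<^sub>v u" and gq: "g \<bullet> q = g \<bullet> g"
    and qBg: "q \<bullet> (B *\<^sub>v g) = q \<bullet> (B *\<^sub>v q)"
    by (auto simp: cg_invariant_def)
  have g_car [simp]: "g \<in> carrier_vec n" using f u by (simp add: g)
  have gg: "0 < g \<bullet> g" using g_car g0 by (rule scalar_prod_self_pos)
  have "q \<noteq> 0\<^sub>v n"
    using gg gq g_car by auto
  then show qBq: "0 < q \<bullet> (B *\<^sub>v q)" by (intro pos) auto
  have \<alpha>: "\<alpha> \<noteq> 0" "\<alpha> * (q \<bullet> (B *\<^sub>v q)) = g \<bullet> g"
    using gg qBq by (auto simp: \<alpha>_def)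
  have g'_car [simp]: "g' \<in> carrier_vec n" by (simp add: g'_def)
  have ip_g': "x \<bullet> g' = x \<bullet> g - \<alpha> * (x \<bullet> (B *\<^sub>v q))" if "x \<in> carrier_vec n" for x
    using that by (simp add: g'_def form_expand)
  have "g \<bullet> (B *\<^sub>v q) = q \<bullet> (B *\<^sub>v q)"
    using form_sym[OF g_car q] qBg by simp
  then have gg': "g \<bullet> g' = 0"
    using ip_g'[of g] \<alpha> by simp
  have "q \<bullet> g' = 0"
    using ip_g'[of q] \<alpha> gq comm_scalar_prod[OF g_car q] by simp
  then have g'q: "g' \<bullet> q = 0"
    using comm_scalar_prod[OF g'_car q] by simp
  have "g' \<bullet> g' = - \<alpha> * (g' \<bullet> (B *\<^sub>v q))"
    using ip_g'[of g'] gg' comm_scalar_prod[OF g_car g'_car] by simp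
  then have g'Bq: "g' \<bullet> (B *\<^sub>v q) = - \<gamma> * (q \<bullet> (B *\<^sub>v q))"
    using \<alpha> gg by (simp add: \<gamma>_def field_simps)
  then have qBg': "q \<bullet> (B *\<^sub>v g') = - \<gamma> * (q \<bullet> (B *\<^sub>v q))"
    using form_sym[OF g'_car q] by simp
  have "g' = f - B *\<^sub>v (u + \<alpha> \<cdot>\<^sub>v q)"
    using f carrier_vecD[OF f] carrier_vecD[OF u] carrier_vecD[OF q]
    by (simp add: g'_def g form_expand) (intro eq_vecI, simp_all)
  moreover have "g' \<bullet> (g' + \<gamma> \<cdot>\<^sub>v q) = g' \<bullet> g'"
    using g'q by (simp add: form_expand)
  moreover have "(g' + \<gamma> \<cdot>\<^sub>v q) \<bullet> (B *\<^sub>v g') = g' \<bullet> (B *\<^sub>v g') - \<gamma>\<^sup>2 * (q \<bullet> (B *\<^sub>v q))"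
    using qBg' by (simp add: form_expand power2_eq_square)
  moreover have "(g' + \<gamma> \<cdot>\<^sub>v q) \<bullet> (B *\<^sub>v (g' + \<gamma> \<cdot>\<^sub>v q)) = g' \<bullet> (B *\<^sub>v g') - \<gamma>\<^sup>2 * (q \<bullet> (B *\<^sub>v q))"
    unfolding cg_step_form[OF g'_car q] qBg' by (simp add: power2_eq_square algebra_simps)
  moreover have "0 \<le> \<gamma>\<^sup>2 * (q \<bullet> (B *\<^sub>v q))"
    using qBq by simp
  ultimately show "cg_invariant f (u + \<alpha> \<cdot>\<^sub>v q, g', g' + \<gamma> \<cdot>\<^sub>v q)"
    unfolding cg_invariant_def prod.case using u q g'_car by simp
qed

lemma cg_invariant:
  assumes f: "f \<in> carrier_vec n" and x: "x \<in> carrier_vec n"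
  shows "cg_invariant f (cg B f x k)"
proof (induction k)
  case 0
  then show ?case using x f by (simp add: cg_invariant_def)
next
  case (Suc k)
  obtain u g q where s: "cg B f x k = (u, g, q)" by (cases "cg B f x k") auto
  from Suc s have "dim_vec g = n"
    using f by (auto simp: cg_invariant_def)
  then show ?case
    using Suc s cg_step(1)[OF f, of u g q] by (cases "g = 0\<^sub>v n") (auto simp: Let_def)
qed

text \<open>
  The step length \<open>\<alpha>\<close> lowers the energy \<open>e \<bullet> B e\<close> of the error by \<open>(g \<bullet> g)\<^sup>2 / (q \<bullet> B q)\<close>, which is
  at least \<open>(g \<bullet> g)\<^sup>2 / (g \<bullet> B g) \<ge> (g \<bullet> g) / hi\<close>; since \<open>g = - B e\<close>, this is at least the fraction
  \<open>lo / hi\<close> of the energy.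
\<close>

lemma cg_contraction:
  assumes f: "f \<in> carrier_vec n" and x: "x \<in> carrier_vec n"
    and z: "z \<in> carrier_vec n" "B *\<^sub>v z = f"
    and lo: "0 < lo" "\<And>y. y \<in> carrier_vec n \<Longrightarrow> lo * (y \<bullet> y) \<le> y \<bullet> (B *\<^sub>v y)"
    and hi: "\<And>y. y \<in> carrier_vec n \<Longrightarrow> y \<bullet> (B *\<^sub>v y) \<le> hi * (y \<bullet> y)" "lo \<le> hi"
  shows "(fst (cg B f x k) - z) \<bullet> (B *\<^sub>v (fst (cg B f x k) - z))
    \<le> (1 - lo / hi) ^ k * ((x - z) \<bullet> (B *\<^sub>v (x - z)))"
proof (induction k)
  case 0
  then show ?case by simp
next
  case (Suc k)
  let ?Q = "\<lambda>y. y \<bullet> (B *\<^sub>v y)"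
  have \<rho>: "0 \<le> 1 - lo / hi" using lo(1) hi(2) by simp
  obtain u g q where s: "cg B f x k = (u, g, q)" by (cases "cg B f x k") auto
  have inv: "cg_invariant f (u, g, q)"
    using cg_invariant[OF f x, of k] s by simp
  then have u [simp]: "u \<in> carrier_vec n" and q [simp]: "q \<in> carrier_vec n"
    and g: "g = f - B *\<^sub>v u" and gq: "g \<bullet> q = g \<bullet> g" and le: "?Q q \<le> ?Q g"
    by (auto simp: cg_invariant_def)
  note [simp] = carrier_vecD[OF u] carrier_vecD[OF q]
  have g_car [simp]: "g \<in> carrier_vec n" using f by (simp add: g)
  define e where "e = u - z"
  have e [simp]: "e \<in> carrier_vec n" using z by (simp add: e_def)
  have Be: "B *\<^sub>v e = - g"
  proof -
    have "B *\<^sub>v e = B *\<^sub>v u - f"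
      using z by (simp add: e_def mult_minus_distrib_mat_vec[OF carrier])
    also have "\<dots> = - g"
      using carrier_vecD[OF f] by (intro eq_vecI) (auto simp: g)
    finally show ?thesis .
  qed
  have "?Q (fst (cg B f x (Suc k)) - z) \<le> (1 - lo / hi) * ?Q e"
  proof (cases "g = 0\<^sub>v n")
    case True
    then have "B *\<^sub>v e = 0\<^sub>v n" by (simp add: Be)
    then have "?Q e = 0" by simp
    moreover have "fst (cg B f x (Suc k)) = u"
      using s True by simp
    ultimately show ?thesis by (simp add: e_def)
  next
    case False
    define \<alpha> where "\<alpha> = (g \<bullet> g) / ?Q q"
    have qBq: "0 < ?Q q" using cg_step(2)[OF f inv False] .
    have gg: "0 < g \<bullet> g" using g_car False by (rule scalar_prod_self_pos)
    have dim: "dim_vec g = n" using carrier_vecD[OF g_car] .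
    have "fst (cg B f x (Suc k)) = u + \<alpha> \<cdot>\<^sub>v q"
      using s False unfolding cg.simps s prod.case Let_def \<alpha>_def dim by simp
    moreover have "u + \<alpha> \<cdot>\<^sub>v q - z = e + \<alpha> \<cdot>\<^sub>v q"
      using carrier_vecD[OF z(1)] by (intro eq_vecI) (simp_all add: e_def)
    ultimately have fst: "fst (cg B f x (Suc k)) - z = e + \<alpha> \<cdot>\<^sub>v q"
      by simp
    have qBe: "q \<bullet> (B *\<^sub>v e) = - (g \<bullet> g)"
    proof -
      have "q \<bullet> - g = - (q \<bullet> g)"
        by (rule scalar_prod_uminus_right) (simp add: dim)
      then show ?thesis unfolding Be using gq comm_scalar_prod[OF q g_car] by simp
    qed
    have "?Q (e + \<alpha> \<cdot>\<^sub>v q) = ?Q e - (g \<bullet> g)\<^sup>2 / ?Q q"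
      unfolding cg_step_form[OF e q] qBe using qBq
      by (simp add: \<alpha>_def field_simps power2_eq_square)
    moreover have "lo / hi * ?Q e \<le> (g \<bullet> g)\<^sup>2 / ?Q q"
    proof -
      have "e \<noteq> 0\<^sub>v n"
        using gg Be g_car carrier by (metis mult_mat_vec_carrier e scalar_prod_right_zero
            scalar_prod_left_zero Be qBe q less_irrefl neg_equal_0_iff_equal form_sym)
      then have ee: "0 < e \<bullet> e" by (rule scalar_prod_self_pos[OF e])
      have "lo * ?Q e \<le> g \<bullet> g"
      proof -
        \<comment> \<open>The minimiser of the norm of \<open>g + t e\<close>; its nonnegativity is Cauchy--Schwarz for \<open>e\<close> and \<open>B e\<close>.\<close>
        define t where "t = ?Q e / (e \<bullet> e)"
        have eg: "e \<bullet> g = - ?Q e"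
        proof -
          have "e \<bullet> - g = - (e \<bullet> g)"
            by (rule scalar_prod_uminus_right) (simp only: carrier_vecD[OF e] dim)
          then show ?thesis unfolding Be by simp
        qed
        have "0 \<le> (g + t \<cdot>\<^sub>v e) \<bullet> (g + t \<cdot>\<^sub>v e)" by (rule scalar_prod_self_nonneg)
        also have "\<dots> = g \<bullet> g + 2 * t * (e \<bullet> g) + t\<^sup>2 * (e \<bullet> e)"
          using comm_scalar_prod[OF e g_car]
          by (simp add: form_expand power2_eq_square algebra_simps)
        finally have "t * ?Q e \<le> g \<bullet> g"
          unfolding eg using ee by (simp add: t_def power2_eq_square)
        moreover have "lo \<le> t"
          using lo(2)[OF e] ee by (simp add: t_def field_simps)
        moreover have "0 \<le> ?Q e"
          using lo(2)[OF e] lo(1) ee by (smt (verit) mult_pos_pos)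
        ultimately show ?thesis
          by (meson mult_right_mono order_trans)
      qed
      moreover have "?Q q \<le> hi * (g \<bullet> g)"
        using le hi(1)[OF g_car] by simp
      moreover have "0 < hi" using lo(1) hi(2) by simp
      ultimately have "lo * ?Q e * ?Q q \<le> (g \<bullet> g) * (hi * (g \<bullet> g))"
        using gg qBq by (intro mult_mono) auto
      then show ?thesis
        using \<open>0 < hi\<close> qBq by (simp add: field_simps power2_eq_square)
    qed
    ultimately show ?thesis
      unfolding fst by (simp add: left_diff_distrib)
  qed
  also have "\<dots> \<le> (1 - lo / hi) * ((1 - lo / hi) ^ k * ?Q (x - z))"
    using Suc \<rho> s by (intro mult_left_mono) (auto simp: e_def)
  finally show ?case by simp
qed

lemma cg_carrier:
  assumes "f \<in> carrier_vec n" "x \<in> carrier_vec n"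
  shows "fst (cg B f x k) \<in> carrier_vec n"
  using cg_invariant[OF assms, of k] by (auto simp: cg_invariant_def split: prod.splits)

end

section \<open>Inverses, square roots and preconditioning\<close>

definition inj_mat :: "rmat \<Rightarrow> bool" where
  "inj_mat A \<longleftrightarrow> (\<forall>x\<in>carrier_vec (dim_col A). A *\<^sub>v x = 0\<^sub>v (dim_row A) \<longrightarrow> x = 0\<^sub>v (dim_col A))"

lemma inj_matD:
  "inj_mat A \<Longrightarrow> A \<in> carrier_mat m n \<Longrightarrow> x \<in> carrier_vec n \<Longrightarrow> A *\<^sub>v x = 0\<^sub>v m \<Longrightarrow> x = 0\<^sub>v n"
  by (auto simp: inj_mat_def)

lemma minv_inverse:
  assumes A: "A \<in> carrier_mat n n" and inj: "inj_mat A"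
  shows "minv A \<in> carrier_mat n n" "A * minv A = 1\<^sub>m n" "minv A * A = 1\<^sub>m n"
proof -
  have "Determinant.det A \<noteq> 0"
    using det_0_iff_vec_prod_zero_field[OF A] inj_matD[OF inj A] by blast
  then have "A \<in> Units (ring_mat TYPE(real) n ())"
    by (rule det_non_zero_imp_unit[OF A])
  then obtain C where "mat_inverse A = Some C"
    using mat_inverse(1)[OF A, where b = "()"] by (cases "mat_inverse A") auto
  with mat_inverse(2)[OF A this]
  show "minv A \<in> carrier_mat n n" "A * minv A = 1\<^sub>m n" "minv A * A = 1\<^sub>m n"
    by (auto simp: minv_def)
qed

text \<open>
  The rank is the dimension of the span of the set of columns, so equal columns have to be excluded
  separately on both sides before linear independence of this set can be used.
\<close>

lemma full_column_rank_iff: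
  assumes A: "A \<in> carrier_mat m n"
  shows "full_column_rank A \<longleftrightarrow> inj_mat A"
proof -
  interpret vec_space "TYPE(real)" m .
  have dims: "dim_row A = m" "dim_col A = n" using A by auto
  have dist_of_rank: "distinct (cols A)" if "rank A = n"
  proof -
    obtain S where S: "maximal S (\<lambda>T. T \<subseteq> set (cols A) \<and> lin_indpt T)"
      using maximal_exists_superset[of "set (cols A)" "\<lambda>T. T \<subseteq> set (cols A) \<and> lin_indpt T" "{}"]
      by (metis List.finite_set empty_subsetI finite_lin_indpt2 finite.emptyI empty_iff)
    then have "n \<le> card (set (cols A))"
      using rank_card_indpt[OF A S] that by (auto simp: maximal_def intro: card_mono)
    then show ?thesis
      using A by (intro card_distinct) (use card_length[of "cols A"] in auto)
  qed
  have dist_of_inj: "distinct (cols A)" if "inj_mat A"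
  proof (rule ccontr)
    assume "\<not> distinct (cols A)"
    then obtain i j where ij: "i < n" "j < n" "i \<noteq> j" "col A i = col A j"
      using A by (auto simp: distinct_conv_nth)
    have ent: "A $$ (a, i) = A $$ (a, j)" if "a < m" for a
      using ij that dims by (metis index_col)
    let ?x = "unit_vec n i - unit_vec n j :: rvec"
    have "A *\<^sub>v ?x = A *\<^sub>v unit_vec n i - A *\<^sub>v unit_vec n j"
      using A by (intro mult_minus_distrib_mat_vec) auto
    also have "\<dots> = 0\<^sub>v m"
      using A ij ent by (auto intro!: eq_vecI)
    finally have "?x = 0\<^sub>v n"
      using inj_matD[OF that A] by simp
    then have "?x $ i = 0" using ij by simp
    then show False using ij by simp
  qed
  show ?thesis
  proof
    assume "full_column_rank A"
    then have r: "rank A = n" by (simp add: full_column_rank_def dims)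
    show "inj_mat A"
      unfolding inj_mat_def dims
      using full_rank_lin_indpt[OF A r dist_of_rank[OF r]] lin_depI[OF A _ _ _ dist_of_rank[OF r]]
      by blast
  next
    assume inj: "inj_mat A"
    have "lin_indpt (set (cols A))"
      using lin_depE[OF A _ dist_of_inj[OF inj]] inj_matD[OF inj A] by metis
    then show "full_column_rank A"
      using lin_indpt_full_rank[OF A dist_of_inj[OF inj]] by (simp add: full_column_rank_def dims)
  qed
qed

lemma scalar_prod_ip: "y \<in> carrier_vec n \<Longrightarrow> x \<bullet> y = ip n (($) x) (($) y)"
  by (auto simp: scalar_prod_def ip_def lessThan_atLeast0)

lemma mult_mat_vec_mulv:
  assumes "A \<in> carrier_mat m n" "x \<in> carrier_vec n" "i < m"
  shows "(A *\<^sub>v x) $ i = mulv n (\<lambda>i j. A $$ (i, j)) (($) x) i"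
  using assms by (auto simp: mulv_def scalar_prod_def lessThan_atLeast0)

lemma eigensystem_entries:
  assumes sym: "\<And>a b. a < n \<Longrightarrow> b < n \<Longrightarrow> A a b = A b a" and u: "orthonormal n n u"
    and eig: "\<And>i a. i < n \<Longrightarrow> a < n \<Longrightarrow> mulv n A (u i) a = lam i * u i a"
    and ab: "a < n" "b < n"
  shows "A a b = (\<Sum>l<n. lam l * u l a * u l b)"
proof -
  have "A a b = (\<Sum>l<n. ip n (u l) (\<lambda>c. A c b) * u l a)"
    using orthonormal_expand[OF u ab(1), of "\<lambda>c. A c b"] by simp
  also have "\<dots> = (\<Sum>l<n. lam l * u l a * u l b)"
  proof (intro sum.cong refl)
    fix l assume "l \<in> {..<n}"
    have "ip n (u l) (\<lambda>c. A c b) = mulv n A (u l) b"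
      unfolding ip_def mulv_def using sym ab by (intro sum.cong) (auto simp: mult.commute)
    then show "ip n (u l) (\<lambda>c. A c b) * u l a = lam l * u l a * u l b"
      using eig \<open>l \<in> {..<n}\<close> ab by simp
  qed
  finally show ?thesis .
qed

definition psd_root :: "nat \<Rightarrow> rmat \<Rightarrow> rmat \<Rightarrow> bool" where
  "psd_root n A R \<longleftrightarrow> R \<in> carrier_mat n n \<and> transpose_mat R = R \<and>
     (\<forall>v\<in>carrier_vec n. 0 \<le> v \<bullet> (R *\<^sub>v v)) \<and> R * R = A"

lemma symmetric_entries:
  "A \<in> carrier_mat n n \<Longrightarrow> transpose_mat A = A \<Longrightarrow> a < n \<Longrightarrow> b < n \<Longrightarrow> A $$ (a, b) = A $$ (b, a)"
  by (metis carrier_matD index_transpose_mat(1))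

lemma psd_root_exists:
  assumes A: "A \<in> carrier_mat n n" and sym: "transpose_mat A = A"
    and psd: "\<And>v. v \<in> carrier_vec n \<Longrightarrow> 0 \<le> v \<bullet> (A *\<^sub>v v)"
  shows "\<exists>R. psd_root n A R"
proof -
  let ?A = "\<lambda>i j. A $$ (i, j)"
  have symA: "?A a b = ?A b a" if "a < n" "b < n" for a b
    using symmetric_entries[OF A sym] that .
  obtain u lam where u: "orthonormal n n u"
    and eig: "\<And>i a. i < n \<Longrightarrow> a < n \<Longrightarrow> mulv n ?A (u i) a = lam i * u i a"
    using spectral_theorem[of n ?A] symA by blast
  have lam: "0 \<le> lam l" if "l < n" for l
  proof -
    let ?v = "Matrix.vec n (u l)"
    have "0 \<le> ?v \<bullet> (A *\<^sub>v ?v)" by (rule psd) simp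
    also have "\<dots> = ip n (u l) (\<lambda>a. lam l * u l a)"
    proof (subst scalar_prod_ip[of _ n])
      have "(A *\<^sub>v ?v) $ a = lam l * u l a" if "a < n" for a
      proof -
        have "(A *\<^sub>v ?v) $ a = mulv n ?A (($) ?v) a"
          using A that by (intro mult_mat_vec_mulv) auto
        also have "\<dots> = mulv n ?A (u l) a"
          by (simp add: mulv_def)
        finally show ?thesis using eig[OF \<open>l < n\<close> that] by simp
      qed
      then show "ip n (($) ?v) (($) (A *\<^sub>v ?v)) = ip n (u l) (\<lambda>a. lam l * u l a)"
        by (intro ip_cong) auto
    qed (use A in auto)
    also have "\<dots> = lam l"
      using u that by (simp add: ip_linear orthonormal_def)
    finally show ?thesis .
  qed
  define R where "R = Matrix.mat n n (\<lambda>(a, b). \<Sum>l<n. sqrt (lam l) * u l a * u l b)"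
  have R: "R \<in> carrier_mat n n" by (simp add: R_def)
  have "transpose_mat R = R"
    by (intro eq_matI) (auto simp: R_def mult_ac)
  moreover have "0 \<le> v \<bullet> (R *\<^sub>v v)" if v: "v \<in> carrier_vec n" for v
  proof -
    have "(R *\<^sub>v v) $ a = (\<Sum>l<n. sqrt (lam l) * ip n (u l) (($) v) * u l a)" if "a < n" for a
    proof -
      have "(R *\<^sub>v v) $ a = (\<Sum>b<n. \<Sum>l<n. sqrt (lam l) * u l a * u l b * v $ b)"
        using that v by (simp add: R_def scalar_prod_def lessThan_atLeast0 sum_distrib_right)
      also have "\<dots> = (\<Sum>l<n. sqrt (lam l) * ip n (u l) (($) v) * u l a)"
        by (subst sum.swap) (simp add: ip_def sum_distrib_left sum_distrib_right mult_ac)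
      finally show ?thesis .
    qed
    then have "v \<bullet> (R *\<^sub>v v) = ip n (($) v) (\<lambda>a. \<Sum>l<n. sqrt (lam l) * ip n (u l) (($) v) * u l a)"
      using R v by (subst scalar_prod_ip[of _ n]) (auto intro!: ip_cong)
    also have "\<dots> = (\<Sum>l<n. sqrt (lam l) * (ip n (u l) (($) v))\<^sup>2)"
      unfolding ip_linear by (simp add: power2_eq_square mult_ac ip_commute[of n _ "u _"])
    also have "\<dots> \<ge> 0"
      using lam by (intro sum_nonneg) auto
    finally show ?thesis .
  qed
  moreover have "R * R = A"
  proof (rule eq_matI)
    fix a b assume "a < dim_row A" "b < dim_col A"
    then have ab: "a < n" "b < n" using A by auto
    have "(R * R) $$ (a, b) = (\<Sum>c<n. (\<Sum>l<n. sqrt (lam l) * u l a * u l c) * (\<Sum>k<n. sqrt (lam k) * u k c * u k b))"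
      using ab by (simp add: R_def scalar_prod_def lessThan_atLeast0)
    also have "\<dots> = ip n (\<lambda>c. \<Sum>l<n. (sqrt (lam l) * u l a) * u l c) (\<lambda>c. \<Sum>k<n. (sqrt (lam k) * u k b) * u k c)"
      by (simp add: ip_def mult_ac)
    also have "\<dots> = (\<Sum>l<n. \<Sum>k<n. sqrt (lam l) * u l a * (sqrt (lam k) * u k b) * ip n (u l) (u k))"
      unfolding ip_linear by (simp add: sum_distrib_left mult_ac)
    also have "\<dots> = (\<Sum>l<n. \<Sum>k<n. if l = k then sqrt (lam l) * u l a * (sqrt (lam k) * u k b) else 0)"
      using u by (intro sum.cong) (auto simp: orthonormal_def)
    also have "\<dots> = (\<Sum>l<n. lam l * u l a * u l b)"
      using lam by (simp add: mult_ac flip: mult.assoc[of "sqrt _" "sqrt _"])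
    also have "\<dots> = A $$ (a, b)"
      using eigensystem_entries[OF symA u eig ab] by simp
    finally show "(R * R) $$ (a, b) = A $$ (a, b)" .
  qed (use A R in auto)
  ultimately show ?thesis
    using R by (auto simp: psd_root_def)
qed

text \<open>
  If \<open>v\<close> is an eigenvector of \<open>R\<^sub>1 - R\<^sub>2\<close> with eigenvalue \<open>l \<noteq> 0\<close>, then equality of the squares gives
  \<open>l (v \<bullet> R\<^sub>1 v + v \<bullet> R\<^sub>2 v) = 0\<close>. Both forms are nonnegative, so they vanish at \<open>v\<close>, and so does
  their difference \<open>l (v \<bullet> v)\<close>, which is absurd. Hence the difference has no nonzero eigenvalue.
\<close>

lemma psd_root_unique:
  assumes "psd_root n A R1" "psd_root n A R2"
  shows "R1 = R2"
proof -
  from assms have R: "R1 \<in> carrier_mat n n" "R2 \<in> carrier_mat n n"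
    and sym: "transpose_mat R1 = R1" "transpose_mat R2 = R2"
    and psd: "\<And>v. v \<in> carrier_vec n \<Longrightarrow> 0 \<le> v \<bullet> (R1 *\<^sub>v v)" "\<And>v. v \<in> carrier_vec n \<Longrightarrow> 0 \<le> v \<bullet> (R2 *\<^sub>v v)"
    and sq: "R1 * R1 = R2 * R2"
    by (auto simp: psd_root_def)
  let ?D = "\<lambda>i j. R1 $$ (i, j) - R2 $$ (i, j)"
  have symD: "?D a b = ?D b a" if "a < n" "b < n" for a b
    using symmetric_entries[OF R(1) sym(1) that] symmetric_entries[OF R(2) sym(2) that] by simp
  obtain u lam where u: "orthonormal n n u"
    and eig: "\<And>i a. i < n \<Longrightarrow> a < n \<Longrightarrow> mulv n ?D (u i) a = lam i * u i a"
    using spectral_theorem[of n ?D] symD by blast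
  have lam: "lam l = 0" if "l < n" for l
  proof (rule ccontr)
    assume "lam l \<noteq> 0"
    define v where "v = Matrix.vec n (u l)"
    have v [simp]: "v \<in> carrier_vec n" by (simp add: v_def)
    have Rv [simp]: "R1 *\<^sub>v v \<in> carrier_vec n" "R2 *\<^sub>v v \<in> carrier_vec n"
      using R by (auto intro: mult_mat_vec_carrier[OF _ v])
    have D: "R1 *\<^sub>v v - R2 *\<^sub>v v = lam l \<cdot>\<^sub>v v"
    proof (rule eq_vecI)
      fix a assume "a < dim_vec (lam l \<cdot>\<^sub>v v)"
      then have a: "a < n" by (simp add: v_def)
      have "(R1 *\<^sub>v v - R2 *\<^sub>v v) $ a = mulv n ?D (u l) a"
        using R a by (simp add: v_def scalar_prod_def mulv_def lessThan_atLeast0 left_diff_distrib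
            sum_subtractf)
      then show "(R1 *\<^sub>v v - R2 *\<^sub>v v) $ a = (lam l \<cdot>\<^sub>v v) $ a"
        using eig[OF that a] a by (simp add: v_def)
    qed (use R in \<open>simp add: v_def\<close>)
    have "v \<bullet> v = ip n (u l) (u l)"
      unfolding scalar_prod_ip[OF v] by (intro ip_cong) (auto simp: v_def)
    then have "v \<bullet> v = 1"
      using u that by (simp add: orthonormal_def)
    have "sqnorm (R1 *\<^sub>v v) = v \<bullet> ((R1 * R1) *\<^sub>v v)"
      using scalar_prod_transpose_mult[OF R(1) v Rv(1)] R sym by simp
    moreover have "sqnorm (R2 *\<^sub>v v) = v \<bullet> ((R2 * R2) *\<^sub>v v)"
      using scalar_prod_transpose_mult[OF R(2) v Rv(2)] R sym by simp
    ultimately have "sqnorm (R1 *\<^sub>v v) = sqnorm (R2 *\<^sub>v v)"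
      by (simp add: sq)
    moreover have "(R1 *\<^sub>v v - R2 *\<^sub>v v) \<bullet> (R1 *\<^sub>v v + R2 *\<^sub>v v)
        = sqnorm (R1 *\<^sub>v v) - sqnorm (R2 *\<^sub>v v)"
      using comm_scalar_prod[OF Rv]
      by (simp add: minus_scalar_prod_distrib[of _ n] scalar_prod_add_distrib[of _ n])
    ultimately have "lam l * (v \<bullet> (R1 *\<^sub>v v) + v \<bullet> (R2 *\<^sub>v v)) = 0"
      unfolding D distrib_left
      by (simp add: scalar_prod_add_distrib[of _ n] smult_scalar_prod_distrib[of _ n])
    then have "v \<bullet> (R1 *\<^sub>v v) = 0" "v \<bullet> (R2 *\<^sub>v v) = 0"
      using \<open>lam l \<noteq> 0\<close> psd[OF v] by auto
    then have "v \<bullet> (R1 *\<^sub>v v - R2 *\<^sub>v v) = 0"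
      by (simp add: scalar_prod_minus_distrib[of _ n])
    then show False
      unfolding D using \<open>lam l \<noteq> 0\<close> \<open>v \<bullet> v = 1\<close> by (simp add: scalar_prod_smult_distrib[of _ n])
  qed
  show ?thesis
  proof (rule eq_matI)
    fix a b assume "a < dim_row R2" "b < dim_col R2"
    then have "a < n" "b < n" using R by auto
    from eigensystem_entries[OF symD u eig this] lam show "R1 $$ (a, b) = R2 $$ (a, b)"
      by simp
  qed (use R in auto)
qed

lemma msqrt_psd_root:
  assumes A: "A \<in> carrier_mat n n" and "transpose_mat A = A"
    and "\<And>v. v \<in> carrier_vec n \<Longrightarrow> 0 \<le> v \<bullet> (A *\<^sub>v v)"
  shows "psd_root n A (msqrt A)"
proof -
  have "msqrt A = (THE R. psd_root n A R)"
    using A by (simp add: msqrt_def psd_root_def)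
  moreover obtain R where "psd_root n A R"
    using psd_root_exists[OF assms] by blast
  ultimately show ?thesis
    using psd_root_unique by (metis the_equality)
qed

lemma (in spd_mat) inj: "inj_mat B"
  using pos by (force simp: inj_mat_def)

lemma (in spd_mat) sqrt_inverse:
  defines "W \<equiv> minv (msqrt B)"
  shows "msqrt B \<in> carrier_mat n n" "W \<in> carrier_mat n n" "transpose_mat W = W"
    "W * msqrt B = 1\<^sub>m n" "msqrt B * W = 1\<^sub>m n" "W * B * W = 1\<^sub>m n"
proof -
  have "0 \<le> v \<bullet> (B *\<^sub>v v)" if "v \<in> carrier_vec n" for v
    using pos[OF that] that by (cases "v = 0\<^sub>v n") auto
  then have root: "psd_root n B (msqrt B)"
    by (rule msqrt_psd_root[OF carrier symmetric])
  then show R: "msqrt B \<in> carrier_mat n n" by (simp add: psd_root_def)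
  from root have sym: "transpose_mat (msqrt B) = msqrt B" and sq: "msqrt B * msqrt B = B"
    by (auto simp: psd_root_def)
  have "inj_mat (msqrt B)"
    unfolding inj_mat_def
  proof (intro ballI impI)
    fix x assume x: "x \<in> carrier_vec (dim_col (msqrt B))" "msqrt B *\<^sub>v x = 0\<^sub>v (dim_row (msqrt B))"
    then have "B *\<^sub>v x = msqrt B *\<^sub>v 0\<^sub>v n"
      using R by (subst sq[symmetric]) (simp add: assoc_mult_mat_vec[OF R R])
    also have "\<dots> = 0\<^sub>v n" using R by auto
    finally show "x = 0\<^sub>v (dim_col (msqrt B))"
      using x R inj_matD[OF inj carrier] by simp
  qed
  note W = minv_inverse[OF R this, folded W_def]
  then show Wc: "W \<in> carrier_mat n n" "W * msqrt B = 1\<^sub>m n" "msqrt B * W = 1\<^sub>m n" by auto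
  have "transpose_mat W = transpose_mat W * (msqrt B * W)"
    using W Wc by simp
  also have "\<dots> = transpose_mat W * transpose_mat (msqrt B) * W"
    using Wc R by (simp add: sym assoc_mult_mat[of _ n n _ n _ n])
  also have "transpose_mat W * transpose_mat (msqrt B) = 1\<^sub>m n"
    using transpose_mult[OF R Wc(1)] W by simp
  finally show "transpose_mat W = W" using Wc by simp
  have "W * B * W = (W * msqrt B) * (msqrt B * W)"
    using Wc R by (subst sq[symmetric]) (simp add: assoc_mult_mat[of _ n n _ n _ n])
  then show "W * B * W = 1\<^sub>m n"
    using Wc by simp
qed

lemma gram_form:
  fixes A :: rmat
  assumes "A \<in> carrier_mat m n" "x \<in> carrier_vec n"
  shows "x \<bullet> ((transpose_mat A * A) *\<^sub>v x) = sqnorm (A *\<^sub>v x)"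
  using assms scalar_prod_transpose_mult[of A m n x "A *\<^sub>v x"]
    assoc_mult_mat_vec[of "transpose_mat A" n m A n x] by simp

lemma gram_spd:
  assumes A: "A \<in> carrier_mat m n" and inj: "inj_mat A"
  shows "spd_mat n (transpose_mat A * A)"
proof
  show "transpose_mat A * A \<in> carrier_mat n n" using A by simp
  show "transpose_mat (transpose_mat A * A) = transpose_mat A * A"
    using A by (subst transpose_mult[of _ n m _ n]) auto
  fix x :: rvec assume x: "x \<in> carrier_vec n" "x \<noteq> 0\<^sub>v n"
  then have "A *\<^sub>v x \<noteq> 0\<^sub>v m" using inj_matD[OF inj A] by blast
  then show "0 < x \<bullet> ((transpose_mat A * A) *\<^sub>v x)"
    unfolding gram_form[OF A x(1)] using A x by (intro scalar_prod_self_pos[of _ m]) auto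
qed

text \<open>
  With \<open>W = M\<^bsup>-1/2\<^esup>\<close> the preconditioned matrix \<open>W A\<^sup>T A W\<close> has the Rayleigh quotient of \<open>A\<^sup>T A\<close>
  relative to \<open>M\<close>, so that norm comparisons between \<open>A\<close> and \<open>M\<close> are bounds for its spectrum.
\<close>

lemma pcg_contraction:
  assumes A: "A \<in> carrier_mat m n" and injA: "inj_mat A" and b: "b \<in> carrier_vec m"
    and M: "spd_mat n M" and x: "x \<in> carrier_vec n"
    and z: "z \<in> carrier_vec n" "(transpose_mat A * A) *\<^sub>v z = transpose_mat A *\<^sub>v b"
    and lo: "0 < lo" "\<And>y. y \<in> carrier_vec n \<Longrightarrow> lo * (y \<bullet> (M *\<^sub>v y)) \<le> sqnorm (A *\<^sub>v y)"
    and hi: "\<And>y. y \<in> carrier_vec n \<Longrightarrow> sqnorm (A *\<^sub>v y) \<le> hi * (y \<bullet> (M *\<^sub>v y))" "lo \<le> hi"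
  shows "pcg A b M x k \<in> carrier_vec n"
    and "sqnorm (A *\<^sub>v (pcg A b M x k - z))
      \<le> (1 - lo / hi) ^ k * (sqnorm (A *\<^sub>v (x - z)))"
proof -
  interpret M: spd_mat n M by fact
  define R W where "R = msqrt M" and "W = minv R"
  have R: "R \<in> carrier_mat n n" and W: "W \<in> carrier_mat n n" and symW: "transpose_mat W = W"
    and WR: "W * R = 1\<^sub>m n" and RW: "R * W = 1\<^sub>m n" and WMW: "W * M * W = 1\<^sub>m n"
    using M.sqrt_inverse by (auto simp: R_def W_def)
  have Wv: "W *\<^sub>v y \<in> carrier_vec n" and Rv: "R *\<^sub>v y \<in> carrier_vec n" if "y \<in> carrier_vec n" for y
    using W R that by auto
  have WRv: "W *\<^sub>v (R *\<^sub>v y) = y" if "y \<in> carrier_vec n" for y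
    using that W R WR by (metis assoc_mult_mat_vec one_mult_mat_vec)
  define AA where "AA = transpose_mat A * A"
  have AA: "AA \<in> carrier_mat n n" using A by (simp add: AA_def)
  define B where "B = W * AA * W"
  have B: "B \<in> carrier_mat n n" using W AA by (simp add: B_def)
  have Bv: "B *\<^sub>v y = W *\<^sub>v (AA *\<^sub>v (W *\<^sub>v y))" if "y \<in> carrier_vec n" for y
    using that W AA by (simp add: B_def assoc_mult_mat_vec[of _ n n _ n])
  have form: "y \<bullet> (B *\<^sub>v y) = sqnorm (A *\<^sub>v (W *\<^sub>v y))" if y: "y \<in> carrier_vec n" for y
  proof -
    have "AA *\<^sub>v (W *\<^sub>v y) \<in> carrier_vec n" using AA Wv[OF y] by simp
    then have "y \<bullet> (B *\<^sub>v y) = (W *\<^sub>v y) \<bullet> (AA *\<^sub>v (W *\<^sub>v y))"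
      using scalar_prod_transpose_mult[OF W y] symW Bv[OF y] by simp
    then show ?thesis
      unfolding AA_def using gram_form[OF A Wv[OF y]] by simp
  qed
  have normM: "(W *\<^sub>v y) \<bullet> (M *\<^sub>v (W *\<^sub>v y)) = y \<bullet> y" if y: "y \<in> carrier_vec n" for y
  proof -
    have "M *\<^sub>v (W *\<^sub>v y) \<in> carrier_vec n" using Wv[OF y] by simp
    then have "(W *\<^sub>v y) \<bullet> (M *\<^sub>v (W *\<^sub>v y)) = y \<bullet> (W *\<^sub>v (M *\<^sub>v (W *\<^sub>v y)))"
      using scalar_prod_transpose_mult[OF W y] symW by simp
    also have "W *\<^sub>v (M *\<^sub>v (W *\<^sub>v y)) = (W * M * W) *\<^sub>v y"
      using W y M.carrier by (simp add: assoc_mult_mat_vec[of _ n n _ n])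
    finally show ?thesis using y by (simp add: WMW)
  qed
  interpret B: spd_mat n B
  proof
    show "B \<in> carrier_mat n n" by fact
    have "transpose_mat AA = AA"
      unfolding AA_def using A by (subst transpose_mult[of _ n m _ n]) auto
    then show "transpose_mat B = B"
      unfolding B_def using W AA symW
      by (simp add: transpose_mult[of _ n n _ n] assoc_mult_mat[of _ n n _ n _ n])
    fix y :: rvec assume y: "y \<in> carrier_vec n" "y \<noteq> 0\<^sub>v n"
    then have "0 < lo * (y \<bullet> y)"
      using lo(1) scalar_prod_self_pos by simp
    also have "\<dots> \<le> y \<bullet> (B *\<^sub>v y)"
      using lo(2)[OF Wv[OF y(1)]] form normM y by simp
    finally show "0 < y \<bullet> (B *\<^sub>v y)" .
  qed
  define f where "f = W *\<^sub>v (transpose_mat A *\<^sub>v b)"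
  have f: "f \<in> carrier_vec n" using W A b by (simp add: f_def)
  have Bz: "B *\<^sub>v (R *\<^sub>v z) = f"
    using z Bv[OF Rv[OF z(1)]] WRv[OF z(1)] by (simp add: f_def AA_def)
  define u where "u = fst (cg B f (R *\<^sub>v x) k)"
  have u: "u \<in> carrier_vec n"
    unfolding u_def using f Rv[OF x] by (rule B.cg_carrier)
  have pcg: "pcg A b M x k = W *\<^sub>v u"
    by (simp add: pcg_def Let_def u_def B_def AA_def f_def W_def R_def)
  then show "pcg A b M x k \<in> carrier_vec n" using Wv[OF u] by simp
  have lo': "lo * (y \<bullet> y) \<le> y \<bullet> (B *\<^sub>v y)" and hi': "y \<bullet> (B *\<^sub>v y) \<le> hi * (y \<bullet> y)"
    if "y \<in> carrier_vec n" for y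
    using lo(2)[OF Wv[OF that]] hi(1)[OF Wv[OF that]] form[OF that] normM[OF that] by simp_all
  have "(u - R *\<^sub>v z) \<bullet> (B *\<^sub>v (u - R *\<^sub>v z))
      \<le> (1 - lo / hi) ^ k * ((R *\<^sub>v x - R *\<^sub>v z) \<bullet> (B *\<^sub>v (R *\<^sub>v x - R *\<^sub>v z)))"
    unfolding u_def using f Rv[OF x] Rv[OF z(1)] Bz lo(1) lo' hi' hi(2) by (rule B.cg_contraction)
  moreover have "W *\<^sub>v (y - R *\<^sub>v z) = W *\<^sub>v y - z" if "y \<in> carrier_vec n" for y
    using mult_minus_distrib_mat_vec[OF W that Rv[OF z(1)]] WRv[OF z(1)] by simp
  ultimately show "sqnorm (A *\<^sub>v (pcg A b M x k - z))
      \<le> (1 - lo / hi) ^ k * (sqnorm (A *\<^sub>v (x - z)))"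
    using form[of "u - R *\<^sub>v z"] form[of "R *\<^sub>v x - R *\<^sub>v z"] u Rv x z WRv[OF x] by (simp add: pcg)
qed

section \<open>Sampling from a tight frame without replacement\<close>

text \<open>
  Equivalent to \<open>(a\<^sup>i - b\<^sup>i) (a\<^sup>j - b\<^sup>j) \<ge> 0\<close>: for exponents of equal parity both factors have the same
  sign, by monotonicity in \<open>a\<close> for odd and in \<open>\<bar>a\<bar>\<close> for even exponents.
\<close>

lemma power_sum_exchange_le:
  fixes a b :: real
  assumes "even (i + j)"
  shows "a ^ i * b ^ j + a ^ j * b ^ i \<le> a ^ (i + j) + b ^ (i + j)"
proof -
  have "(a ^ i - b ^ i) * (a ^ j - b ^ j) \<ge> 0"
  proof (cases "even i")
    case True
    with assms have "even j" by simp
    then have eqs: "x ^ i = \<bar>x\<bar> ^ i" "x ^ j = \<bar>x\<bar> ^ j" for x :: real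
      using True by (simp_all add: power_even_abs)
    have *: "(\<bar>x\<bar> ^ i - \<bar>y\<bar> ^ i) * (\<bar>x\<bar> ^ j - \<bar>y\<bar> ^ j) \<ge> 0" if "\<bar>x\<bar> \<le> \<bar>y\<bar>" for x y :: real
      using power_mono[OF that, of i] power_mono[OF that, of j] by (simp add: mult_nonpos_nonpos)
    show ?thesis
      unfolding eqs[of a] eqs[of b] using *[of a b] *[of b a]
      by (cases "\<bar>a\<bar> \<le> \<bar>b\<bar>") (auto simp: algebra_simps)
  next
    case False
    with assms have "odd j" by simp
    have *: "(x ^ i - y ^ i) * (x ^ j - y ^ j) \<ge> 0" if "x \<le> y" for x y :: real
      using power_mono_odd[OF False that] power_mono_odd[OF \<open>odd j\<close> that]
      by (simp add: mult_nonpos_nonpos)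
    show ?thesis
      using *[of a b] *[of b a] by (cases "a \<le> b") (auto simp: algebra_simps)
  qed
  then show ?thesis by (simp add: algebra_simps power_add)
qed

text \<open>
  In the factorisation of \<open>a\<^sup>n - b\<^sup>n\<close>, pairing the term \<open>a\<^sup>i b\<^sup>j\<close> with \<open>a\<^sup>j b\<^sup>i\<close> bounds the cofactor by
  the average of the extreme terms.
\<close>

lemma mean_value_power_le:
  fixes a b :: real
  shows "(a - b) * (a ^ Suc (2 * p) - b ^ Suc (2 * p))
    \<le> real (2 * p + 1) / 2 * ((a - b)\<^sup>2 * (a ^ (2 * p) + b ^ (2 * p)))"
proof -
  let ?n = "2 * p"
  have "2 * (\<Sum>i<Suc ?n. a ^ i * b ^ (?n - i))
      = (\<Sum>i<Suc ?n. a ^ i * b ^ (?n - i)) + (\<Sum>i<Suc ?n. a ^ (?n - i) * b ^ (?n - (?n - i)))"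
    using sum.nat_diff_reindex[of "\<lambda>i. a ^ i * b ^ (?n - i)" "Suc ?n"] by simp
  also have "\<dots> = (\<Sum>i<Suc ?n. a ^ i * b ^ (?n - i) + a ^ (?n - i) * b ^ i)"
    by (simp add: sum.distrib)
  also have "\<dots> \<le> (\<Sum>i<Suc ?n. a ^ ?n + b ^ ?n)"
  proof (intro sum_mono)
    fix i assume "i \<in> {..<Suc ?n}"
    then show "a ^ i * b ^ (?n - i) + a ^ (?n - i) * b ^ i \<le> a ^ ?n + b ^ ?n"
      using power_sum_exchange_le[of i "?n - i" a b] by simp
  qed
  also have "\<dots> = real (2 * p + 1) * (a ^ ?n + b ^ ?n)"
    by simp
  finally have "(\<Sum>i<Suc ?n. a ^ i * b ^ (?n - i)) \<le> real (2 * p + 1) / 2 * (a ^ ?n + b ^ ?n)"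
    by linarith
  then have "(a - b)\<^sup>2 * (\<Sum>i<Suc ?n. a ^ i * b ^ (?n - i))
      \<le> (a - b)\<^sup>2 * (real (2 * p + 1) / 2 * (a ^ ?n + b ^ ?n))"
    by (rule mult_left_mono) simp
  moreover have "(a - b) * (a ^ Suc ?n - b ^ Suc ?n) = (a - b)\<^sup>2 * (\<Sum>i<Suc ?n. a ^ i * b ^ (?n - i))"
    by (subst diff_power_eq_sum) (simp only: power2_eq_square mult.assoc)
  ultimately show ?thesis
    by (simp only: mult_ac)
qed

definition eigensystem ::
    "nat \<Rightarrow> (nat \<Rightarrow> nat \<Rightarrow> real) \<Rightarrow> (nat \<Rightarrow> nat \<Rightarrow> real) \<Rightarrow> (nat \<Rightarrow> real) \<Rightarrow> bool" where
  "eigensystem n A u lam \<longleftrightarrow> (\<forall>a<n. \<forall>b<n. A a b = A b a) \<and> orthonormal n n u \<and>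
     (\<forall>i<n. \<forall>a<n. mulv n A (u i) a = lam i * u i a)"

lemma eigensystem_coeff:
  assumes "eigensystem n A u lam" "i < n"
  shows "ip n (u i) (mulv n A x) = lam i * ip n (u i) x"
proof -
  have "ip n (u i) (mulv n A x) = ip n (mulv n A (u i)) x"
    using assms by (intro ip_mulv_sym[symmetric]) (auto simp: eigensystem_def)
  also have "\<dots> = ip n (\<lambda>a. lam i * u i a) x"
    using assms by (intro ip_cong) (auto simp: eigensystem_def)
  finally show ?thesis by (simp add: ip_linear)
qed

lemma eigensystem_quadratic_form:
  assumes "eigensystem n A u lam"
  shows "ip n x (mulv n A x) = (\<Sum>i<n. lam i * (ip n (u i) x)\<^sup>2)"
proof -
  have "ip n x (mulv n A x) = (\<Sum>i<n. ip n (u i) x * ip n (u i) (mulv n A x))"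
    using assms by (intro parseval) (simp add: eigensystem_def)
  then show ?thesis
    by (simp add: eigensystem_coeff[OF assms] power2_eq_square mult_ac)
qed

text \<open>
  This is \<open>tr ((A - B) (A\<^sup>n - B\<^sup>n)) \<le> n/2 tr ((A - B)\<^sup>2 (A\<^bsup>n-1\<^esup> + B\<^bsup>n-1\<^esup>))\<close> for odd \<open>n\<close>, written in the
  two eigenbases. Both sides become sums over pairs of eigenvalues of \<open>A\<close> and \<open>B\<close> with the weights
  \<open>(u\<^sub>l \<bullet> w\<^sub>k)\<^sup>2\<close>, and the scalar inequality applies to each term. The two halves of each side are kept
  apart because they arise from the two orders of an exchangeable pair.
\<close>

lemma mean_value_trace_le:
  fixes p :: nat
  assumes A: "eigensystem n A u lam" and B: "eigensystem n B w mu"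
  defines "\<Phi> \<equiv> \<Sum>l<n. lam l ^ Suc (2 * p) * (lam l - ip n (u l) (mulv n B (u l)))"
    and "\<Phi>' \<equiv> \<Sum>k<n. mu k ^ Suc (2 * p) * (mu k - ip n (w k) (mulv n A (w k)))"
    and "\<Gamma> \<equiv> \<Sum>l<n. lam l ^ (2 * p) * ip n (\<lambda>a. mulv n A (u l) a - mulv n B (u l) a)
                                          (\<lambda>a. mulv n A (u l) a - mulv n B (u l) a)"
    and "\<Gamma>' \<equiv> \<Sum>k<n. mu k ^ (2 * p) * ip n (\<lambda>a. mulv n B (w k) a - mulv n A (w k) a)
                                          (\<lambda>a. mulv n B (w k) a - mulv n A (w k) a)"
  shows "\<Phi> + \<Phi>' \<le> real (2 * p + 1) / 2 * (\<Gamma> + \<Gamma>')"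
proof -
  define c where "c l k = (ip n (u l) (w k))\<^sup>2" for l k
  have half: "lam l - ip n (u l) (mulv n B (u l)) = (\<Sum>k<n. (lam l - mu k) * (ip n (u l) (w k))\<^sup>2)
     \<and> ip n (\<lambda>a. mulv n A (u l) a - mulv n B (u l) a) (\<lambda>a. mulv n A (u l) a - mulv n B (u l) a)
       = (\<Sum>k<n. (lam l - mu k)\<^sup>2 * (ip n (u l) (w k))\<^sup>2)"
    if A: "eigensystem n A u lam" and B: "eigensystem n B w mu" and l: "l < n" for A B u w lam mu l
  proof
    have ow: "orthonormal n n w" using B by (simp add: eigensystem_def)
    have "1 = ip n (u l) (u l)"
      using A l by (simp add: eigensystem_def orthonormal_def)
    also have "\<dots> = (\<Sum>k<n. (ip n (u l) (w k))\<^sup>2)"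
      unfolding parseval[OF ow, of "u l" "u l"] by (simp add: power2_eq_square ip_commute[of n "w _"])
    finally have one: "(\<Sum>k<n. (ip n (u l) (w k))\<^sup>2) = 1" ..
    show "lam l - ip n (u l) (mulv n B (u l)) = (\<Sum>k<n. (lam l - mu k) * (ip n (u l) (w k))\<^sup>2)"
      unfolding eigensystem_quadratic_form[OF B] left_diff_distrib sum_subtractf
        sum_distrib_left[symmetric] one
      by (simp add: ip_commute[of n _ "u l"])
    let ?r = "\<lambda>a. lam l * u l a - mulv n B (u l) a"
    have "ip n (\<lambda>a. mulv n A (u l) a - mulv n B (u l) a) (\<lambda>a. mulv n A (u l) a - mulv n B (u l) a)
        = ip n ?r ?r"
      using A l by (intro ip_cong) (auto simp: eigensystem_def)
    also have "\<dots> = (\<Sum>k<n. ip n (w k) ?r * ip n (w k) ?r)"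
      by (rule parseval[OF ow])
    also have "\<dots> = (\<Sum>k<n. (lam l - mu k)\<^sup>2 * (ip n (u l) (w k))\<^sup>2)"
    proof (intro sum.cong refl)
      fix k assume "k \<in> {..<n}"
      then have "ip n (w k) ?r = (lam l - mu k) * ip n (u l) (w k)"
        by (simp add: ip_linear eigensystem_coeff[OF B] left_diff_distrib ip_commute[of n "w k" "u l"])
      then show "ip n (w k) ?r * ip n (w k) ?r = (lam l - mu k)\<^sup>2 * (ip n (u l) (w k))\<^sup>2"
        by (simp add: power2_eq_square mult_ac)
    qed
    finally show "ip n (\<lambda>a. mulv n A (u l) a - mulv n B (u l) a) (\<lambda>a. mulv n A (u l) a - mulv n B (u l) a)
       = (\<Sum>k<n. (lam l - mu k)\<^sup>2 * (ip n (u l) (w k))\<^sup>2)" .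
  qed
  have 1: "\<Phi> = (\<Sum>l<n. \<Sum>k<n. lam l ^ Suc (2 * p) * ((lam l - mu k) * c l k))"
    unfolding \<Phi>_def using half[OF A B] by (simp add: sum_distrib_left c_def)
  have 2: "\<Phi>' = (\<Sum>l<n. \<Sum>k<n. mu k ^ Suc (2 * p) * ((mu k - lam l) * c l k))"
    unfolding \<Phi>'_def using half[OF B A]
    by (subst sum.swap) (simp add: sum_distrib_left c_def ip_commute[of n "w _"])
  have 3: "\<Gamma> = (\<Sum>l<n. \<Sum>k<n. lam l ^ (2 * p) * ((lam l - mu k)\<^sup>2 * c l k))"
    unfolding \<Gamma>_def using half[OF A B] by (simp add: sum_distrib_left c_def)
  have 4: "\<Gamma>' = (\<Sum>l<n. \<Sum>k<n. mu k ^ (2 * p) * ((lam l - mu k)\<^sup>2 * c l k))"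
    unfolding \<Gamma>'_def using half[OF B A]
    by (subst sum.swap) (simp add: sum_distrib_left c_def ip_commute[of n "w _"] power2_commute[of "mu _"])
  have "\<Phi> + \<Phi>' = (\<Sum>l<n. \<Sum>k<n. (lam l - mu k) * (lam l ^ Suc (2 * p) - mu k ^ Suc (2 * p)) * c l k)"
    unfolding 1 2 sum.distrib[symmetric] by (simp add: algebra_simps)
  also have "\<dots> \<le> (\<Sum>l<n. \<Sum>k<n. real (2 * p + 1) / 2 *
      ((lam l - mu k)\<^sup>2 * (lam l ^ (2 * p) + mu k ^ (2 * p))) * c l k)"
    by (intro sum_mono mult_right_mono mean_value_power_le) (simp add: c_def)
  also have "\<dots> = real (2 * p + 1) / 2 * (\<Gamma> + \<Gamma>')"
    unfolding 3 4 sum.distrib[symmetric] sum_distrib_left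
    by (intro sum.cong refl) (simp add: algebra_simps)
  finally show ?thesis .
qed

lemma sum_swap3:
  "(\<Sum>l\<in>L. \<Sum>i\<in>I. \<Sum>j\<in>J. f l i j) = (\<Sum>i\<in>I. \<Sum>j\<in>J. \<Sum>l\<in>L. f l i j)"
  by (subst sum.swap) (intro sum.cong refl sum.swap)

text \<open>
  The frame condition says that the matrices \<open>v\<^sub>i v\<^sub>i\<^sup>T\<close> sum to the identity; \<open>m\<close> is the size of the
  sample.
\<close>

locale tight_frame =
  fixes N d :: nat and v :: "nat \<Rightarrow> nat \<Rightarrow> real" and b :: real and m :: nat
  assumes frame: "\<And>x. (\<Sum>i<N. (ip d (v i) x)\<^sup>2) = ip d x x"
    and norm_le: "\<And>i. i < N \<Longrightarrow> ip d (v i) (v i) \<le> b"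
    and N_pos: "0 < N" and m_pos: "0 < m" and m_le: "m \<le> N"
begin

definition samples :: "nat set set" where
  "samples = {I. I \<subseteq> {..<N} \<and> card I = m}"

text \<open>
  The matrix \<open>Z\<^sub>I\<close>, the sum of \<open>v\<^sub>i v\<^sub>i\<^sup>T\<close> over \<open>i \<in> I\<close> minus its mean \<open>m/N\<close> times the identity.
\<close>

definition deviation :: "nat set \<Rightarrow> nat \<Rightarrow> nat \<Rightarrow> real" where
  "deviation I a c = (\<Sum>i\<in>I. v i a * v i c) - m / N * (if a = c then 1 else 0)"

lemma b_nonneg: "0 \<le> b"
  using norm_le[of 0] N_pos ip_self_nonneg[of d "v 0"] by linarith

lemma finite_samples: "finite samples"
  unfolding samples_def by (rule finite_subset[of _ "Pow {..<N}"]) auto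

lemma mulv_deviation:
  assumes "a < d"
  shows "mulv d (deviation I) x a = (\<Sum>i\<in>I. ip d (v i) x * v i a) - m / N * x a"
proof -
  have "mulv d (deviation I) x a
      = (\<Sum>c<d. (\<Sum>i\<in>I. v i a * v i c) * x c) - (\<Sum>c<d. m / N * (if a = c then 1 else 0) * x c)"
    by (simp add: mulv_def deviation_def left_diff_distrib sum_subtractf)
  also have "(\<Sum>c<d. m / N * (if a = c then 1 else 0) * x c) = (\<Sum>c<d. if a = c then m / N * x c else 0)"
    by (intro sum.cong) auto
  also have "\<dots> = m / N * x a"
    using assms by simp
  also have "(\<Sum>c<d. (\<Sum>i\<in>I. v i a * v i c) * x c) = (\<Sum>i\<in>I. ip d (v i) x * v i a)"
  proof -
    have "(\<Sum>c<d. (\<Sum>i\<in>I. v i a * v i c) * x c) = (\<Sum>c<d. \<Sum>i\<in>I. v i c * x c * v i a)"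
      by (simp add: sum_distrib_right sum_distrib_left mult_ac)
    also have "\<dots> = (\<Sum>i\<in>I. ip d (v i) x * v i a)"
      by (subst sum.swap) (simp add: ip_def sum_distrib_right)
    finally show ?thesis .
  qed
  finally show ?thesis .
qed

lemma deviation_form:
  "ip d x (mulv d (deviation I) x) = (\<Sum>i\<in>I. (ip d (v i) x)\<^sup>2) - m / N * ip d x x"
proof -
  have "ip d x (mulv d (deviation I) x)
      = ip d x (\<lambda>a. (\<Sum>i\<in>I. ip d (v i) x * v i a) - m / N * x a)"
    by (intro ip_cong) (auto simp: mulv_deviation)
  then show ?thesis
    unfolding ip_linear by (simp add: power2_eq_square ip_commute[of d x "v _"])
qed

definition swap :: "nat set \<Rightarrow> nat \<Rightarrow> nat \<Rightarrow> nat set" where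
  "swap I i j = insert j (I - {i})"

lemma swap_sum:
  fixes f :: "nat \<Rightarrow> real"
  assumes "I \<in> samples" "i \<in> I" "j \<in> {..<N} - I"
  shows "sum f (swap I i j) = sum f I - f i + f j"
proof -
  have "finite I"
    using assms(1) by (auto simp: samples_def intro: finite_subset)
  then show ?thesis
    using assms by (simp add: swap_def sum_diff1)
qed

lemma swap_in_samples:
  assumes "I \<in> samples" "i \<in> I" "j \<in> {..<N} - I"
  shows "swap I i j \<in> samples"
proof -
  have "finite I"
    using assms(1) by (auto simp: samples_def intro: finite_subset)
  then show ?thesis
    using assms card_Suc_Diff1[of I i] by (auto simp: swap_def samples_def)
qed

definition triples :: "(nat set \<times> nat \<times> nat) set" where
  "triples = (SIGMA I:samples. I \<times> ({..<N} - I))"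

lemma sum_triples:
  "(\<Sum>(I, i, j)\<in>triples. f I i j) = (\<Sum>I\<in>samples. \<Sum>i\<in>I. \<Sum>j\<in>{..<N} - I. f I i j)"
proof -
  have fin: "finite I" if "I \<in> samples" for I
    using that by (auto simp: samples_def intro: finite_subset)
  have "(\<Sum>I\<in>samples. \<Sum>i\<in>I. \<Sum>j\<in>{..<N} - I. f I i j)
      = (\<Sum>I\<in>samples. \<Sum>(i, j)\<in>I \<times> ({..<N} - I). f I i j)"
    by (simp add: sum.cartesian_product)
  also have "\<dots> = (\<Sum>(I, z)\<in>triples. case z of (i, j) \<Rightarrow> f I i j)"
    unfolding triples_def using fin by (intro sum.Sigma finite_samples) auto
  finally show ?thesis
    by (simp add: case_prod_unfold)
qed

text \<open>
  The exchange of \<open>i\<close> and \<open>j\<close> is undone by the exchange of \<open>j\<close> and \<open>i\<close>: sample and exchanged sample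
  are an exchangeable pair.
\<close>

lemma sum_triples_swap:
  "(\<Sum>(I, i, j)\<in>triples. f I (swap I i j)) = (\<Sum>(I, i, j)\<in>triples. f (swap I i j) I)"
proof -
  have inv: "(swap I i j, j, i) \<in> triples \<and> swap (swap I i j) j i = I" if "(I, i, j) \<in> triples" for I i j
    using that swap_in_samples[of I i j]
    by (auto simp: triples_def swap_def samples_def)
  show ?thesis
    by (rule sum.reindex_bij_witness[where i = "\<lambda>(I, i, j). (swap I i j, j, i)"
          and j = "\<lambda>(I, i, j). (swap I i j, j, i)"]) (use inv in auto)
qed

text \<open>
  The linear regression property of the exchangeable pair, \<open>E (Z\<^sub>I - Z\<^sub>I') = const * Z\<^sub>I\<close> for fixed
  \<open>I\<close>, in its unnormalised form and tested against \<open>x\<close>.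
\<close>

lemma deviation_swap_form:
  assumes "I \<in> samples"
  shows "(\<Sum>i\<in>I. \<Sum>j\<in>{..<N} - I.
      ip d x (mulv d (deviation I) x) - ip d x (mulv d (deviation (swap I i j)) x))
    = N * ip d x (mulv d (deviation I) x)"
proof -
  define g where "g i = (ip d (v i) x)\<^sup>2" for i
  have I: "finite I" "I \<subseteq> {..<N}" "card I = m"
    using assms by (auto simp: samples_def intro: finite_subset)
  have "(\<Sum>i\<in>I. \<Sum>j\<in>{..<N} - I.
      ip d x (mulv d (deviation I) x) - ip d x (mulv d (deviation (swap I i j)) x))
      = (\<Sum>i\<in>I. \<Sum>j\<in>{..<N} - I. g i - g j)"
    unfolding deviation_form using swap_sum[OF assms, of _ _ g]
    by (intro sum.cong) (auto simp: g_def)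
  also have "\<dots> = card ({..<N} - I) * sum g I - m * sum g ({..<N} - I)"
    by (simp add: sum_subtractf I sum_distrib_left)
  also have "\<dots> = (real N - m) * sum g I - m * (sum g {..<N} - sum g I)"
    using I m_le by (simp add: sum_diff card_Diff_subset of_nat_diff)
  also have "\<dots> = N * (sum g I - m / N * ip d x x)"
    using frame[of x] N_pos by (simp add: g_def field_simps)
  finally show ?thesis
    by (simp add: deviation_form g_def)
qed

text \<open>
  The conditional variance of the pair is bounded by the deviation itself: \<open>(v v\<^sup>T)\<^sup>2 \<le> b v v\<^sup>T\<close>, so
  the squares of the exchanged terms are controlled by \<open>b\<close> times the terms themselves, and these add
  up to \<open>Z\<^sub>I\<close> plus a multiple of the identity.
\<close>

lemma deviation_swap_norm:
  assumes "I \<in> samples" and x: "ip d x x = 1"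
  defines "D \<equiv> \<lambda>i j a. mulv d (deviation I) x a - mulv d (deviation (swap I i j)) x a"
  shows "(\<Sum>i\<in>I. \<Sum>j\<in>{..<N} - I. ip d (D i j) (D i j))
    \<le> 2 * b * (N * ip d x (mulv d (deviation I) x) + 2 * m)"
proof -
  define g where "g i = (ip d (v i) x)\<^sup>2" for i
  have I: "finite I" "I \<subseteq> {..<N}" "card I = m"
    using assms(1) by (auto simp: samples_def intro: finite_subset)
  have bound: "ip d (D i j) (D i j) \<le> 2 * b * g i + 2 * b * g j"
    if ij: "i \<in> I" "j \<in> {..<N} - I" for i j
  proof -
    let ?p = "\<lambda>a. ip d (v i) x * v i a" and ?q = "\<lambda>a. ip d (v j) x * v j a"
    have "ip d (D i j) (D i j) = ip d (\<lambda>a. ?p a - ?q a) (\<lambda>a. ?p a - ?q a)"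
    proof -
      have "D i j a = ?p a - ?q a" if "a < d" for a
        using that swap_sum[OF assms(1) ij, of "\<lambda>i. ip d (v i) x * v i a"]
        by (simp add: D_def mulv_deviation)
      then show ?thesis by (intro ip_cong) auto
    qed
    also have "\<dots> \<le> 2 * ip d ?p ?p + 2 * ip d ?q ?q"
      using ip_self_nonneg[of d "\<lambda>a. ?p a + ?q a"]
      unfolding ip_add_left ip_add_right ip_diff_left ip_diff_right ip_commute[of d ?q ?p]
      by linarith
    also have "\<dots> = 2 * g i * ip d (v i) (v i) + 2 * g j * ip d (v j) (v j)"
      unfolding ip_scale_left ip_scale_right g_def power2_eq_square by simp
    also have "\<dots> \<le> 2 * g i * b + 2 * g j * b"
      using ij I by (intro add_mono mult_left_mono norm_le) (auto simp: g_def)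
    finally show ?thesis by (simp add: mult_ac)
  qed
  have "(\<Sum>i\<in>I. \<Sum>j\<in>{..<N} - I. ip d (D i j) (D i j))
      \<le> (\<Sum>i\<in>I. \<Sum>j\<in>{..<N} - I. 2 * b * g i + 2 * b * g j)"
    by (intro sum_mono bound)
  also have "\<dots> = 2 * b * (card ({..<N} - I) * sum g I + m * sum g ({..<N} - I))"
    by (simp add: sum.distrib sum_distrib_left[symmetric] I distrib_left)
  also have "\<dots> = 2 * b * ((real N - m) * sum g I + m * (sum g {..<N} - sum g I))"
    using I m_le by (simp add: sum_diff card_Diff_subset of_nat_diff)
  also have "\<dots> = 2 * b * ((real N - m) * sum g I + m * (1 - sum g I))"
    using frame[of x] x by (simp add: g_def)
  also have "\<dots> \<le> 2 * b * (N * sum g I + m)"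
  proof (intro mult_left_mono)
    have "0 \<le> m * sum g I" by (simp add: g_def sum_nonneg)
    then show "(real N - m) * sum g I + m * (1 - sum g I) \<le> N * sum g I + m"
      by (simp add: algebra_simps)
  qed (use b_nonneg in simp)
  also have "\<dots> = 2 * b * (N * ip d x (mulv d (deviation I) x) + 2 * m)"
    using N_pos x by (simp add: deviation_form g_def field_simps)
  finally show ?thesis .
qed

definition eigvec :: "nat set \<Rightarrow> nat \<Rightarrow> nat \<Rightarrow> real" where
  "eigvec I = (SOME u. \<exists>lam. eigensystem d (deviation I) u lam)"

definition eigval :: "nat set \<Rightarrow> nat \<Rightarrow> real" where
  "eigval I = (SOME lam. eigensystem d (deviation I) (eigvec I) lam)"

lemma deviation_eigensystem: "eigensystem d (deviation I) (eigvec I) (eigval I)"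
proof -
  have sym: "deviation I a c = deviation I c a" for a c
    by (auto simp: deviation_def mult.commute)
  from spectral_theorem[of d "deviation I", OF sym] obtain u lam where
    "orthonormal d d u" "\<forall>i<d. \<forall>a<d. mulv d (deviation I) (u i) a = lam i * u i a"
    by blast
  with sym have "\<exists>u lam. eigensystem d (deviation I) u lam"
    unfolding eigensystem_def by blast
  then have "\<exists>lam. eigensystem d (deviation I) (eigvec I) lam"
    unfolding eigvec_def by (rule someI_ex)
  then show ?thesis
    unfolding eigval_def by (rule someI_ex)
qed

lemma eigvec_unit: "l < d \<Longrightarrow> ip d (eigvec I l) (eigvec I l) = 1"
  using deviation_eigensystem[of I] by (auto simp: eigensystem_def orthonormal_def)

lemma eigvec_form: 
  assumes "l < d"
  shows "ip d (eigvec I l) (mulv d (deviation I) (eigvec I l)) = eigval I l"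
  using eigensystem_coeff[OF deviation_eigensystem assms, of I "eigvec I l"] eigvec_unit[OF assms] by simp

text \<open>
  The sum over all samples of the trace of \<open>Z\<^sub>I\<^sup>k\<close>.
\<close>

definition moment :: "nat \<Rightarrow> real" where
  "moment k = (\<Sum>I\<in>samples. \<Sum>l<d. eigval I l ^ k)"

text \<open>
  Regression rewrites the moment of order \<open>2 p + 2\<close> as a sum of \<open>tr ((Z\<^sub>I - Z\<^sub>I') Z\<^sub>I\<^bsup>2p+1\<^esup>)\<close> over
  exchangeable pairs. Symmetrising in the pair produces the left side of the mean value inequality
  for traces, and the variance bound estimates its right side.
\<close>

lemma moment_recursion:
  "N * moment (2 * p + 2) \<le> real (2 * p + 1) * b * (N * moment (2 * p + 1) + 2 * m * moment (2 * p))"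
proof -
  define \<Phi> where "\<Phi> I J = (\<Sum>l<d. eigval I l ^ Suc (2 * p) *
      (eigval I l - ip d (eigvec I l) (mulv d (deviation J) (eigvec I l))))" for I J
  define D where "D I J l = (\<lambda>a. mulv d (deviation I) (eigvec I l) a - mulv d (deviation J) (eigvec I l) a)"
    for I J l
  define \<Gamma> where "\<Gamma> I J = (\<Sum>l<d. eigval I l ^ (2 * p) * ip d (D I J l) (D I J l))" for I J
  have \<Phi>\<Gamma>: "\<Phi> I J + \<Phi> J I \<le> real (2 * p + 1) / 2 * (\<Gamma> I J + \<Gamma> J I)" for I J
    unfolding \<Phi>_def \<Gamma>_def D_def
    by (rule mean_value_trace_le[OF deviation_eigensystem deviation_eigensystem])
  have "N * moment (2 * p + 2) = (\<Sum>I\<in>samples. \<Sum>l<d. eigval I l ^ Suc (2 * p) * (N * eigval I l))"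
    by (simp add: moment_def sum_distrib_left mult_ac)
  also have "\<dots> = (\<Sum>I\<in>samples. \<Sum>l<d. eigval I l ^ Suc (2 * p) * (\<Sum>i\<in>I. \<Sum>j\<in>{..<N} - I.
      eigval I l - ip d (eigvec I l) (mulv d (deviation (swap I i j)) (eigvec I l))))"
  proof (intro sum.cong refl)
    fix I l assume "I \<in> samples" "l \<in> {..<d}"
    then show "eigval I l ^ Suc (2 * p) * (N * eigval I l) = eigval I l ^ Suc (2 * p) *
      (\<Sum>i\<in>I. \<Sum>j\<in>{..<N} - I. eigval I l - ip d (eigvec I l) (mulv d (deviation (swap I i j)) (eigvec I l)))"
      using deviation_swap_form[of I "eigvec I l"] eigvec_form[of l I] by simp
  qed
  also have "\<dots> = (\<Sum>(I, i, j)\<in>triples. \<Phi> I (swap I i j))"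
    unfolding sum_triples \<Phi>_def sum_distrib_left
    by (rule sum.cong[OF refl], rule sum_swap3)
  \<comment> \<open>Reversing the exchange turns the same sum into one over the reversed pairs; the average of both is symmetric.\<close>
  finally have 1: "N * moment (2 * p + 2) = (\<Sum>(I, i, j)\<in>triples. \<Phi> I (swap I i j))" .
  then have "2 * (N * moment (2 * p + 2))
      = (\<Sum>(I, i, j)\<in>triples. \<Phi> I (swap I i j)) + (\<Sum>(I, i, j)\<in>triples. \<Phi> (swap I i j) I)"
    using sum_triples_swap[of \<Phi>] by simp
  also have "\<dots> = (\<Sum>(I, i, j)\<in>triples. \<Phi> I (swap I i j) + \<Phi> (swap I i j) I)"
    by (simp add: sum.distrib case_prod_unfold)
  also have "\<dots> \<le> (\<Sum>(I, i, j)\<in>triples. real (2 * p + 1) / 2 * (\<Gamma> I (swap I i j) + \<Gamma> (swap I i j) I))"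
    using \<Phi>\<Gamma> by (intro sum_mono) (simp add: case_prod_unfold)
  also have "\<dots> = real (2 * p + 1) / 2 *
      ((\<Sum>(I, i, j)\<in>triples. \<Gamma> I (swap I i j)) + (\<Sum>(I, i, j)\<in>triples. \<Gamma> (swap I i j) I))"
    unfolding sum.distrib[symmetric] sum_distrib_left case_prod_unfold ..
  also have "\<dots> = real (2 * p + 1) * (\<Sum>(I, i, j)\<in>triples. \<Gamma> I (swap I i j))"
    using sum_triples_swap[of \<Gamma>] by simp
  finally have 2: "2 * (N * moment (2 * p + 2))
      \<le> real (2 * p + 1) * (\<Sum>(I, i, j)\<in>triples. \<Gamma> I (swap I i j))" .
  have "(\<Sum>(I, i, j)\<in>triples. \<Gamma> I (swap I i j)) = (\<Sum>I\<in>samples. \<Sum>l<d. eigval I l ^ (2 * p) *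
      (\<Sum>i\<in>I. \<Sum>j\<in>{..<N} - I. ip d (D I (swap I i j) l) (D I (swap I i j) l)))"
    unfolding sum_triples \<Gamma>_def sum_distrib_left
    by (rule sum.cong[OF refl], rule sum_swap3[symmetric])
  also have "\<dots> \<le> (\<Sum>I\<in>samples. \<Sum>l<d. eigval I l ^ (2 * p) * (2 * b * (N * eigval I l + 2 * m)))"
  proof (intro sum_mono mult_left_mono)
    fix I l assume "I \<in> samples" "l \<in> {..<d}"
    then show "(\<Sum>i\<in>I. \<Sum>j\<in>{..<N} - I. ip d (D I (swap I i j) l) (D I (swap I i j) l))
        \<le> 2 * b * (N * eigval I l + 2 * m)"
      using deviation_swap_norm[of I "eigvec I l"] eigvec_form[of l I] eigvec_unit[of l I]
      by (simp add: D_def)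
  qed simp
  also have "\<dots> = 2 * (b * (N * moment (2 * p + 1) + 2 * m * moment (2 * p)))"
    by (simp add: moment_def sum_distrib_left sum.distrib algebra_simps)
  finally have "real (2 * p + 1) * (\<Sum>(I, i, j)\<in>triples. \<Gamma> I (swap I i j))
      \<le> real (2 * p + 1) * (2 * (b * (N * moment (2 * p + 1) + 2 * m * moment (2 * p))))"
    by (rule mult_left_mono) simp
  also have "\<dots> = 2 * (real (2 * p + 1) * b * (N * moment (2 * p + 1) + 2 * m * moment (2 * p)))"
    by (simp only: mult_ac)
  finally show ?thesis
    using 2 by linarith
qed

lemma moment_even_nonneg: "0 \<le> moment (2 * p)"
  unfolding moment_def by (intro sum_nonneg) simp

text \<open>
  The odd moment is eliminated by \<open>2 c x\<^bsup>2p+1\<^esup> \<le> x\<^bsup>2p+2\<^esup> + c\<^sup>2 x\<^bsup>2p\<^esup>\<close>, half of which is absorbed on the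
  left.
\<close>

lemma moment_step:
  "moment (2 * p + 2) \<le> ((real (2 * p + 1) * b)\<^sup>2 + 4 * (real (2 * p + 1) * b) * (m / N)) * moment (2 * p)"
proof -
  define c where "c = real (2 * p + 1) * b"
  have "2 * (c * moment (2 * p + 1)) \<le> moment (2 * p + 2) + c\<^sup>2 * moment (2 * p)"
  proof -
    have "2 * (c * x ^ (2 * p + 1)) \<le> x ^ (2 * p + 2) + c\<^sup>2 * x ^ (2 * p)" for x :: real
    proof -
      have "0 \<le> x ^ (2 * p) * (x - c)\<^sup>2" by simp
      then show ?thesis by (simp add: power2_eq_square algebra_simps)
    qed
    then show ?thesis
      unfolding moment_def sum_distrib_left sum.distrib[symmetric]
      by (intro sum_mono) 
  qed
  moreover have "moment (2 * p + 2) \<le> c * moment (2 * p + 1) + 2 * (c * (m / N)) * moment (2 * p)"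
    using moment_recursion[of p] N_pos by (simp add: c_def field_simps)
  ultimately have "moment (2 * p + 2) \<le> c\<^sup>2 * moment (2 * p) + 4 * (c * (m / N)) * moment (2 * p)"
    by linarith
  then show ?thesis
    by (simp add: c_def algebra_simps)
qed

lemma moment_bound:
  "moment (2 * q) \<le> card samples * d * ((2 * real q * b)\<^sup>2 + 8 * real q * b * (m / N)) ^ q"
proof -
  let ?c = "(2 * real q * b)\<^sup>2 + 8 * real q * b * (m / N)"
  have c: "0 \<le> ?c" using b_nonneg by simp
  have "moment (2 * p) \<le> card samples * d * ?c ^ p" if "p \<le> q" for p
    using that
  proof (induction p)
    case 0
    then show ?case by (simp add: moment_def)
  next
    case (Suc p)
    have le: "real (2 * p + 1) * b \<le> 2 * real q * b"
      by (rule mult_right_mono[OF _ b_nonneg]) (use Suc.prems in linarith)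
    have "moment (2 * Suc p)
        \<le> ((real (2 * p + 1) * b)\<^sup>2 + 4 * (real (2 * p + 1) * b) * (m / N)) * moment (2 * p)"
      using moment_step[of p] by simp
    also have "\<dots> \<le> ?c * moment (2 * p)"
    proof (rule mult_right_mono[OF add_mono moment_even_nonneg])
      show "(real (2 * p + 1) * b)\<^sup>2 \<le> (2 * real q * b)\<^sup>2"
        using le b_nonneg by (intro power_mono) auto
      have "4 * (real (2 * p + 1) * b) \<le> 8 * real q * b"
        using le by linarith
      then show "4 * (real (2 * p + 1) * b) * (m / N) \<le> 8 * real q * b * (m / N)"
        by (rule mult_right_mono) simp
    qed
    also have "\<dots> \<le> ?c * (card samples * d * ?c ^ p)"
      by (rule mult_left_mono[OF Suc.IH c]) (use Suc.prems in linarith)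
    finally show ?case by (simp only: power_Suc mult_ac)
  qed
  then show ?thesis by simp
qed

text \<open>
  Markov's inequality for the trace moment of order \<open>2 q\<close>: a sample with a direction \<open>x\<close> of
  relative deviation more than \<open>e\<close> has an eigenvalue of modulus at least \<open>e m / N\<close>, hence a trace
  moment of at least the power \<open>2 q\<close> of it.
\<close>

theorem sampling_without_replacement:
  fixes q :: nat and e :: real
  assumes "0 < e"
  defines "t \<equiv> real q * b * N / m"
  shows "card {I \<in> samples. \<exists>x. e * ip d x x < \<bar>N / m * (\<Sum>i\<in>I. (ip d (v i) x)\<^sup>2) - ip d x x\<bar>}
    \<le> card samples * d * ((4 * t\<^sup>2 + 8 * t) / e\<^sup>2) ^ q" (is "real (card ?bad) \<le> _")
proof -
  have large: "(e * m / N) ^ (2 * q) \<le> (\<Sum>l<d. eigval I l ^ (2 * q))" if "I \<in> ?bad" for I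
  proof -
    obtain x where x: "e * ip d x x < \<bar>N / m * (\<Sum>i\<in>I. (ip d (v i) x)\<^sup>2) - ip d x x\<bar>"
      using \<open>I \<in> ?bad\<close> by blast
    have "N / m * (\<Sum>i\<in>I. (ip d (v i) x)\<^sup>2) - ip d x x = N / m * ip d x (mulv d (deviation I) x)"
      unfolding deviation_form right_diff_distrib using N_pos m_pos by simp
    with x have "e * ip d x x < \<bar>N / m * ip d x (mulv d (deviation I) x)\<bar>"
      by (simp only:)
    moreover have "0 < real m / real N" using N_pos m_pos by simp
    ultimately have "m / N * (e * ip d x x) < m / N * \<bar>N / m * ip d x (mulv d (deviation I) x)\<bar>"
      by (rule mult_strict_left_mono)
    also have "\<dots> = \<bar>ip d x (mulv d (deviation I) x)\<bar>"
      unfolding abs_mult using N_pos m_pos by simp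
    also have "\<dots> = \<bar>\<Sum>l<d. eigval I l * (ip d (eigvec I l) x)\<^sup>2\<bar>"
      by (simp add: eigensystem_quadratic_form[OF deviation_eigensystem])
    also have "\<dots> \<le> (\<Sum>l<d. \<bar>eigval I l\<bar> * (ip d (eigvec I l) x)\<^sup>2)"
      by (rule order_trans[OF sum_abs]) (simp add: abs_mult)
    finally have lt: "e * m / N * ip d x x < (\<Sum>l<d. \<bar>eigval I l\<bar> * (ip d (eigvec I l) x)\<^sup>2)"
      by (simp add: mult_ac)
    have px: "ip d x x = (\<Sum>l<d. (ip d (eigvec I l) x)\<^sup>2)"
      using parseval[of d "eigvec I" x x] deviation_eigensystem[of I]
      by (simp add: eigensystem_def power2_eq_square)
    have "\<exists>l<d. e * m / N < \<bar>eigval I l\<bar>"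
    proof (rule ccontr)
      assume "\<not> ?thesis"
      then have "\<bar>eigval I l\<bar> \<le> e * m / N" if "l < d" for l
        using that by (meson not_less)
      then have "(\<Sum>l<d. \<bar>eigval I l\<bar> * (ip d (eigvec I l) x)\<^sup>2) \<le> (\<Sum>l<d. e * m / N * (ip d (eigvec I l) x)\<^sup>2)"
        by (intro sum_mono mult_right_mono) auto
      also have "\<dots> = e * m / N * ip d x x"
        by (simp only: px sum_distrib_left)
      finally show False using lt by simp
    qed
    then obtain l where l: "l < d" "e * m / N < \<bar>eigval I l\<bar>" by blast
    have "(e * m / N) ^ (2 * q) \<le> \<bar>eigval I l\<bar> ^ (2 * q)"
      using l(2) \<open>0 < e\<close> by (intro power_mono) auto
    also have "\<dots> = eigval I l ^ (2 * q)"
      by (simp add: power_even_abs)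
    also have "\<dots> \<le> (\<Sum>l<d. eigval I l ^ (2 * q))"
      using l(1) by (intro member_le_sum) auto
    finally show ?thesis .
  qed
  have pos: "0 < (e * m / N) ^ (2 * q)"
    using \<open>0 < e\<close> m_pos N_pos by simp
  have "card ?bad * (e * m / N) ^ (2 * q) = (\<Sum>I\<in>?bad. (e * m / N) ^ (2 * q))"
    by simp
  also have "\<dots> \<le> (\<Sum>I\<in>?bad. \<Sum>l<d. eigval I l ^ (2 * q))"
    using large by (intro sum_mono) auto
  also have "\<dots> \<le> moment (2 * q)"
    unfolding moment_def using finite_samples by (intro sum_mono2) (auto intro!: sum_nonneg)
  also have "\<dots> \<le> card samples * d * ((2 * real q * b)\<^sup>2 + 8 * real q * b * (m / N)) ^ q"
    by (rule moment_bound)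
  also have "(2 * real q * b)\<^sup>2 + 8 * real q * b * (m / N) = (4 * t\<^sup>2 + 8 * t) / e\<^sup>2 * (e * m / N)\<^sup>2"
    unfolding t_def using \<open>0 < e\<close> m_pos N_pos by (simp add: field_simps power2_eq_square)
  also have "(\<dots>) ^ q = ((4 * t\<^sup>2 + 8 * t) / e\<^sup>2) ^ q * (e * m / N) ^ (2 * q)"
    by (simp only: power_mult_distrib power_mult)
  finally have "card ?bad * (e * m / N) ^ (2 * q)
      \<le> (card samples * d * ((4 * t\<^sup>2 + 8 * t) / e\<^sup>2) ^ q) * (e * m / N) ^ (2 * q)"
    by (simp only: mult.assoc)
  then show ?thesis
    using pos by (rule mult_right_le_imp_le)
qed

end

section \<open>Hadamard rotation with random signs\<close>

text \<open>
  The case of a fair sign in Hoeffding's lemma.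
\<close>

lemma cosh_le_exp_half_square: "cosh x \<le> exp (x\<^sup>2 / 2)" for x :: real
proof -
  have *: "cosh x \<le> exp (x\<^sup>2 / 2)" if "0 \<le> x" for x :: real
  proof -
    have "- x + ln (cosh x * exp x) \<le> x\<^sup>2 / 2"
    proof -
      have "1 + 1 / 2 * (exp (2 * x) - 1) = cosh x * exp x"
        by (simp add: cosh_def field_simps flip: exp_add)
      then show ?thesis
        using Hoeffdings_lemma_aux[of "2 * x" "1 / 2"] that by (simp add: power2_eq_square)
    qed
    then have "ln (cosh x) \<le> x\<^sup>2 / 2"
      by (simp add: ln_mult cosh_real_pos)
    then show ?thesis
      by (metis cosh_real_pos exp_ln exp_le_cancel_iff)
  qed
  show ?thesis
    using *[of x] *[of "- x"] by (cases "0 \<le> x") auto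
qed

abbreviation gauss :: "real measure" where
  "gauss \<equiv> density lborel (\<lambda>x. ennreal (std_normal_density x))"

lemma nn_integral_normal_density:
  "0 < s \<Longrightarrow> (\<integral>\<^sup>+x. ennreal (normal_density m s x) \<partial>lborel) = 1"
  by (subst nn_integral_eq_integral) auto

lemma gauss_exp_linear: "(\<integral>\<^sup>+x. ennreal (exp (s * x)) \<partial>gauss) = ennreal (exp (s\<^sup>2 / 2))"
proof -
  have eq: "std_normal_density x * exp (s * x) = exp (s\<^sup>2 / 2) * normal_density s 1 x" for x
  proof -
    have "- x\<^sup>2 / 2 + s * x = s\<^sup>2 / 2 + (- (x - s)\<^sup>2 / 2)"
      by (simp add: power2_eq_square field_simps)
    then have "exp (- x\<^sup>2 / 2) * exp (s * x) = exp (s\<^sup>2 / 2) * exp (- (x - s)\<^sup>2 / 2)"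
      by (metis exp_add)
    then show ?thesis
      by (simp add: normal_density_def)
  qed
  have "(\<integral>\<^sup>+x. ennreal (exp (s * x)) \<partial>gauss)
      = (\<integral>\<^sup>+x. ennreal (exp (s\<^sup>2 / 2)) * ennreal (normal_density s 1 x) \<partial>lborel)"
    by (subst nn_integral_density) (auto simp: eq simp flip: ennreal_mult)
  then show ?thesis
    by (simp add: nn_integral_cmult nn_integral_normal_density)
qed

lemma gauss_exp_square: "(\<integral>\<^sup>+x. ennreal (exp (x\<^sup>2 / 4)) \<partial>gauss) = ennreal (sqrt 2)"
proof -
  have eq: "std_normal_density x * exp (x\<^sup>2 / 4) = sqrt 2 * normal_density 0 (sqrt 2) x" for x
  proof -
    have "exp (- x\<^sup>2 / 2) * exp (x\<^sup>2 / 4) = exp (- x\<^sup>2 / 4)"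
      by (simp flip: exp_add)
    moreover have "sqrt (4 * pi) = sqrt 2 * sqrt (2 * pi)"
      by (simp flip: real_sqrt_mult)
    ultimately show ?thesis
      by (simp add: normal_density_def)
  qed
  have "(\<integral>\<^sup>+x. ennreal (exp (x\<^sup>2 / 4)) \<partial>gauss)
      = (\<integral>\<^sup>+x. ennreal (sqrt 2) * ennreal (normal_density 0 (sqrt 2) x) \<partial>lborel)"
    by (subst nn_integral_density) (auto simp: eq simp flip: ennreal_mult)
  then show ?thesis
    by (simp add: nn_integral_cmult nn_integral_normal_density)
qed

lemma gauss_prod:
  fixes f :: "nat \<Rightarrow> real \<Rightarrow> ennreal"
  assumes "\<And>a. f a \<in> borel_measurable borel"
  shows "(\<integral>\<^sup>+g. (\<Prod>a<d. f a (g a)) \<partial>Pi\<^sub>M {..<d} (\<lambda>_. gauss)) = (\<Prod>a<d. \<integral>\<^sup>+x. f a x \<partial>gauss)"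
proof -
  interpret prob_space gauss
    using prob_space_normal_density[of 1 0] by simp
  interpret product_sigma_finite "\<lambda>_::nat. gauss"
    by standard
  show ?thesis
    using product_nn_integral_prod[of "{..<d}" f] assms by simp
qed

lemma ennreal_exp_sum:
  "ennreal (exp (\<Sum>a\<in>A. f a)) = (\<Prod>a\<in>A. ennreal (exp (f a)))" if "finite A" for f :: "'x \<Rightarrow> real"
  using that by (simp add: exp_sum prod_ennreal)

text \<open>
  Gaussian linearisation: the exponential of a squared norm is a Gaussian average of exponentials
  of linear forms, whose expectation over independent signs factorises.
\<close>

lemma gauss_exp_ip:
  "(\<integral>\<^sup>+g. ennreal (exp (ip d g x / sqrt 2)) \<partial>Pi\<^sub>M {..<d} (\<lambda>_. gauss)) = ennreal (exp (ip d x x / 4))"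
proof -
  have "(\<integral>\<^sup>+g. ennreal (exp (ip d g x / sqrt 2)) \<partial>Pi\<^sub>M {..<d} (\<lambda>_. gauss))
      = (\<integral>\<^sup>+g. (\<Prod>a<d. ennreal (exp (x a / sqrt 2 * g a))) \<partial>Pi\<^sub>M {..<d} (\<lambda>_. gauss))"
    by (simp add: ip_def sum_divide_distrib ennreal_exp_sum mult.commute)
  also have "\<dots> = (\<Prod>a<d. \<integral>\<^sup>+t. ennreal (exp (x a / sqrt 2 * t)) \<partial>gauss)"
    by (rule gauss_prod) simp
  also have "\<dots> = ennreal (exp (ip d x x / 4))"
    unfolding gauss_exp_linear
    by (simp add: ip_def sum_divide_distrib ennreal_exp_sum power_divide power2_eq_square)
  finally show ?thesis .
qed

lemma gauss_exp_norm:
  "(\<integral>\<^sup>+g. ennreal (exp (ip d g g / 4)) \<partial>Pi\<^sub>M {..<d} (\<lambda>_. gauss)) = ennreal (sqrt 2 ^ d)"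
proof -
  have "(\<integral>\<^sup>+g. ennreal (exp (ip d g g / 4)) \<partial>Pi\<^sub>M {..<d} (\<lambda>_. gauss))
      = (\<integral>\<^sup>+g. (\<Prod>a<d. ennreal (exp ((g a)\<^sup>2 / 4))) \<partial>Pi\<^sub>M {..<d} (\<lambda>_. gauss))"
    by (simp add: ip_def sum_divide_distrib ennreal_exp_sum power2_eq_square)
  also have "\<dots> = (\<Prod>a<d. \<integral>\<^sup>+t. ennreal (exp (t\<^sup>2 / 4)) \<partial>gauss)"
    by (rule gauss_prod) simp
  also have "\<dots> = ennreal (sqrt 2 ^ d)"
    by (simp add: gauss_exp_square ennreal_power)
  finally show ?thesis .
qed

lemma finite_set_rademacher: "finite (set_pmf (rademacher_pmf n))"
  unfolding rademacher_pmf_def by (subst set_Pi_pmf) (auto intro!: finite_PiE_dflt)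

lemma set_rademacher: "\<xi> \<in> set_pmf (rademacher_pmf n) \<Longrightarrow> k < n \<Longrightarrow> \<xi> k \<in> {-1, 1}"
  unfolding rademacher_pmf_def by (subst (asm) set_Pi_pmf) (auto simp: PiE_dflt_def)

lemma rademacher_exp_linear:
  "(\<integral>\<^sup>+\<xi>. ennreal (exp (\<Sum>k<n. \<xi> k * y k)) \<partial>rademacher_pmf n) \<le> ennreal (exp ((\<Sum>k<n. (y k)\<^sup>2) / 2))"
proof -
  have one: "(\<integral>\<^sup>+t. ennreal (exp (t * y)) \<partial>measure_pmf (pmf_of_set {-1, 1})) = ennreal (cosh y)" for y :: real
    by (subst nn_integral_pmf_of_set)
      (auto simp: cosh_def field_simps divide_ennreal[symmetric] simp flip: ennreal_plus)
  have "(\<integral>\<^sup>+\<xi>. ennreal (exp (\<Sum>k<n. \<xi> k * y k)) \<partial>rademacher_pmf n)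
      = (\<integral>\<^sup>+\<xi>. (\<Prod>k<n. ennreal (exp (\<xi> k * y k))) \<partial>rademacher_pmf n)"
    by (simp add: ennreal_exp_sum)
  also have "\<dots> = (\<Prod>k<n. ennreal (cosh (y k)))"
    unfolding rademacher_pmf_def by (subst nn_integral_prod_Pi_pmf) (auto simp: one)
  also have "\<dots> \<le> (\<Prod>k<n. ennreal (exp ((y k)\<^sup>2 / 2)))"
    by (auto simp: prod_ennreal intro!: ennreal_leI prod_mono cosh_le_exp_half_square)
  also have "\<dots> = ennreal (exp ((\<Sum>k<n. (y k)\<^sup>2) / 2))"
    by (simp add: ennreal_exp_sum sum_divide_distrib)
  finally show ?thesis .
qed

text \<open>
  After linearisation the signs are averaged first, for fixed Gaussian \<open>g\<close>. The bound \<open>cosh t \<le> exp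
  (t\<^sup>2/2)\<close> for each factor and the frame identity turn the product into \<open>exp (ip d g g / 4)\<close>, so the
  Rademacher sum is dominated by a standard Gaussian vector. The scale \<open>1/4\<close> keeps the last Gaussian
  integral finite, with value \<open>\<surd>2\<close> in each coordinate.
\<close>

lemma rademacher_exp_norm:
  fixes w :: "nat \<Rightarrow> nat \<Rightarrow> real"
  assumes frame: "\<And>x. (\<Sum>k<n. (ip d (w k) x)\<^sup>2) = ip d x x"
  defines "X \<equiv> \<lambda>\<xi> a. \<Sum>k<n. \<xi> k * w k a"
  shows "(\<integral>\<^sup>+\<xi>. ennreal (exp (ip d (X \<xi>) (X \<xi>) / 4)) \<partial>rademacher_pmf n) \<le> ennreal (sqrt 2 ^ d)"
proof -
  let ?R = "rademacher_pmf n" and ?G = "Pi\<^sub>M {..<d} (\<lambda>_. gauss)"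
  have meas: "(\<lambda>g. ennreal (exp (ip d g x / sqrt 2))) \<in> borel_measurable ?G" for x
    unfolding ip_def by measurable
  have "(\<integral>\<^sup>+\<xi>. ennreal (exp (ip d (X \<xi>) (X \<xi>) / 4)) \<partial>?R)
      = (\<integral>\<^sup>+\<xi>. (\<integral>\<^sup>+g. ennreal (exp (ip d g (X \<xi>) / sqrt 2)) \<partial>?G) \<partial>?R)"
    by (simp add: gauss_exp_ip)
  also have "\<dots> = (\<Sum>\<xi>\<in>set_pmf ?R. (\<integral>\<^sup>+g. ennreal (exp (ip d g (X \<xi>) / sqrt 2)) \<partial>?G) * pmf ?R \<xi>)"
    by (rule nn_integral_measure_pmf_finite[OF finite_set_rademacher]) simp
  also have "\<dots> = (\<integral>\<^sup>+g. (\<Sum>\<xi>\<in>set_pmf ?R. ennreal (exp (ip d g (X \<xi>) / sqrt 2)) * pmf ?R \<xi>) \<partial>?G)"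
    using meas by (simp add: nn_integral_sum nn_integral_multc)
  also have "\<dots> = (\<integral>\<^sup>+g. (\<integral>\<^sup>+\<xi>. ennreal (exp (ip d g (X \<xi>) / sqrt 2)) \<partial>?R) \<partial>?G)"
    by (simp add: nn_integral_measure_pmf_finite[OF finite_set_rademacher])
  also have "\<dots> \<le> (\<integral>\<^sup>+g. ennreal (exp (ip d g g / 4)) \<partial>?G)"
  proof (intro nn_integral_mono)
    fix g
    have "ip d g (X \<xi>) / sqrt 2 = (\<Sum>k<n. \<xi> k * (ip d (w k) g / sqrt 2))" for \<xi>
      unfolding X_def ip_linear by (simp add: sum_divide_distrib ip_commute[of d g])
    moreover have "(\<Sum>k<n. (ip d (w k) g / sqrt 2)\<^sup>2) / 2 = ip d g g / 4"
      by (simp add: power_divide frame flip: sum_divide_distrib)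
    ultimately show "(\<integral>\<^sup>+\<xi>. ennreal (exp (ip d g (X \<xi>) / sqrt 2)) \<partial>?R) \<le> ennreal (exp (ip d g g / 4))"
      using rademacher_exp_linear[of n "\<lambda>k. ip d (w k) g / sqrt 2"] by (simp only:)
  qed
  also have "\<dots> = ennreal (sqrt 2 ^ d)"
    by (rule gauss_exp_norm)
  finally show ?thesis .
qed

lemma rademacher_norm_tail:
  fixes w :: "nat \<Rightarrow> nat \<Rightarrow> real"
  assumes frame: "\<And>x. (\<Sum>k<n. (ip d (w k) x)\<^sup>2) = ip d x x"
  defines "X \<equiv> \<lambda>\<xi> a. \<Sum>k<n. \<xi> k * w k a"
  shows "measure_pmf.prob (rademacher_pmf n) {\<xi>. M < ip d (X \<xi>) (X \<xi>)} \<le> sqrt 2 ^ d * exp (- M / 4)"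
proof -
  let ?R = "measure_pmf (rademacher_pmf n)" and ?A = "{\<xi>. M < ip d (X \<xi>) (X \<xi>)}"
  have "emeasure ?R ?A = (\<integral>\<^sup>+\<xi>. indicator ?A \<xi> \<partial>?R)"
    by simp
  also have "\<dots> \<le> (\<integral>\<^sup>+\<xi>. ennreal (exp (- M / 4)) * ennreal (exp (ip d (X \<xi>) (X \<xi>) / 4)) \<partial>?R)"
  proof (intro nn_integral_mono)
    fix \<xi>
    show "indicator ?A \<xi> \<le> ennreal (exp (- M / 4)) * ennreal (exp (ip d (X \<xi>) (X \<xi>) / 4))"
    proof (cases "\<xi> \<in> ?A")
      case True
      then have "1 \<le> exp (- M / 4) * exp (ip d (X \<xi>) (X \<xi>) / 4)"
        by (simp flip: exp_add)
      then show ?thesis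
        using True by (simp flip: ennreal_mult)
    qed simp
  qed
  also have "\<dots> = ennreal (exp (- M / 4)) * (\<integral>\<^sup>+\<xi>. ennreal (exp (ip d (X \<xi>) (X \<xi>) / 4)) \<partial>?R)"
    by (rule nn_integral_cmult) simp
  also have "\<dots> \<le> ennreal (exp (- M / 4)) * ennreal (sqrt 2 ^ d)"
    unfolding X_def by (intro mult_left_mono rademacher_exp_norm frame) simp
  also have "\<dots> = ennreal (sqrt 2 ^ d * exp (- M / 4))"
    by (simp add: mult.commute flip: ennreal_mult)
  finally show ?thesis
    by (simp add: measure_pmf.emeasure_eq_measure)
qed

lemma walsh_hadamard_carrier [simp]: "walsh_hadamard p \<in> carrier_mat (2 ^ p) (2 ^ p)"
  by (induction p) (auto simp: Let_def)

lemma walsh_hadamard_dim [simp]: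
  "dim_row (walsh_hadamard p) = 2 ^ p" "dim_col (walsh_hadamard p) = 2 ^ p"
  using walsh_hadamard_carrier[of p] by (auto simp del: walsh_hadamard_carrier)

lemma walsh_hadamard_Suc_index:
  assumes "i < 2 ^ p" "j < 2 ^ p"
  shows "walsh_hadamard (Suc p) $$ (i, j) = walsh_hadamard p $$ (i, j) / sqrt 2"
    and "walsh_hadamard (Suc p) $$ (i, 2 ^ p + j) = walsh_hadamard p $$ (i, j) / sqrt 2"
    and "walsh_hadamard (Suc p) $$ (2 ^ p + i, j) = walsh_hadamard p $$ (i, j) / sqrt 2"
    and "walsh_hadamard (Suc p) $$ (2 ^ p + i, 2 ^ p + j) = - walsh_hadamard p $$ (i, j) / sqrt 2"
  using assms by (auto simp: Let_def)

lemma sum_lessThan_double: "(\<Sum>i<2 * n. f i) = (\<Sum>i<n. f i) + (\<Sum>i<n. f (n + i))" for n :: nat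
  using sum.nat_group[of f n 2] sum.atLeastLessThan_concat[of 0 n "2 * n" f]
  by (simp add: lessThan_atLeast0 sum.shift_bounds_nat_ivl[of f 0 n n, simplified] mult_2 add.commute)

lemma double_cases:
  fixes i n :: nat
  assumes "i < 2 * n"
  obtains i' where "i' < n" "i = i'" | i' where "i' < n" "i = n + i'"
proof (cases "i < n")
  case False
  then have "i - n < n" "i = n + (i - n)" using assms by auto
  then show ?thesis using that(2) by blast
qed (use that(1) in blast)

lemma walsh_hadamard_entry_square:
  "i < 2 ^ p \<Longrightarrow> j < 2 ^ p \<Longrightarrow> (walsh_hadamard p $$ (i, j))\<^sup>2 = 1 / 2 ^ p"
proof (induction p arbitrary: i j)
  case (Suc p)
  from Suc.prems have "i < 2 * 2 ^ p" "j < 2 * 2 ^ p" by auto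
  then show ?case
    by (elim double_cases)
      (simp_all add: walsh_hadamard_Suc_index Suc.IH power_divide del: walsh_hadamard.simps)
qed simp

text \<open>
  For the halves \<open>y\<close>, \<open>y'\<close> of a vector, the blocks give \<open>(H y + H y')/\<surd>2\<close> and \<open>(H y - H y')/\<surd>2\<close>;
  the parallelogram law adds their squared norms to those of \<open>H y\<close> and \<open>H y'\<close>.
\<close>

lemma walsh_hadamard_isometry:
  "(\<Sum>i<2 ^ p. (\<Sum>k<2 ^ p. walsh_hadamard p $$ (i, k) * y k)\<^sup>2) = (\<Sum>k<2 ^ p. (y k)\<^sup>2)"
proof (induction p arbitrary: y)
  case (Suc p)
  define t where "t z i = (\<Sum>k<2 ^ p. walsh_hadamard p $$ (i, k) * z k)" for z :: "nat \<Rightarrow> real" and i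
  let ?y' = "\<lambda>k. y (2 ^ p + k)"
  have top: "(\<Sum>k<2 * 2 ^ p. walsh_hadamard (Suc p) $$ (i, k) * y k) = (t y i + t ?y' i) / sqrt 2"
    and bot: "(\<Sum>k<2 * 2 ^ p. walsh_hadamard (Suc p) $$ (2 ^ p + i, k) * y k) = (t y i - t ?y' i) / sqrt 2"
    if "i < 2 ^ p" for i
    unfolding sum_lessThan_double t_def
    using that by (simp_all add: walsh_hadamard_Suc_index sum_divide_distrib add_divide_distrib
        diff_divide_distrib sum_negf del: walsh_hadamard.simps)
  have "(\<Sum>i<2 ^ Suc p. (\<Sum>k<2 ^ Suc p. walsh_hadamard (Suc p) $$ (i, k) * y k)\<^sup>2)
      = (\<Sum>i<2 ^ p. ((t y i + t ?y' i) / sqrt 2)\<^sup>2) + (\<Sum>i<2 ^ p. ((t y i - t ?y' i) / sqrt 2)\<^sup>2)"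
    unfolding power_Suc sum_lessThan_double[of _ "2 ^ p"]
    using top bot by (simp add: sum_lessThan_double del: walsh_hadamard.simps)
  also have "\<dots> = (\<Sum>i<2 ^ p. (t y i)\<^sup>2) + (\<Sum>i<2 ^ p. (t ?y' i)\<^sup>2)"
    unfolding sum.distrib[symmetric]
    by (intro sum.cong) (auto simp: power_divide power2_eq_square field_simps)
  also have "\<dots> = (\<Sum>k<2 ^ Suc p. (y k)\<^sup>2)"
    unfolding t_def Suc.IH power_Suc sum_lessThan_double ..
  finally show ?case .
qed simp

section \<open>Norm preservation by the subsampled randomized Hadamard transform\<close>

definition embeds :: "real \<Rightarrow> rmat \<Rightarrow> rmat \<Rightarrow> bool" where
  "embeds e S X \<longleftrightarrow> (\<forall>y\<in>carrier_vec (dim_col X).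
     \<bar>sqnorm ((S * X) *\<^sub>v y) - sqnorm (X *\<^sub>v y)\<bar> \<le> e * (sqnorm (X *\<^sub>v y)))"

lemma bij_betw_pick:
  assumes "finite I"
  shows "bij_betw (pick I) {..<card I} I"
proof -
  have "inj_on (pick I) {..<card I}"
    by (rule inj_onI) (metis lessThan_iff nat_neq_iff pick_mono_le)
  moreover have "pick I ` {..<card I} \<subseteq> I"
    by (auto intro: pick_in_set_le)
  ultimately show ?thesis
    unfolding bij_betw_def using assms by (simp add: card_image card_subset_eq)
qed

lemma srht_carrier:
  assumes "I \<subseteq> {..<2 ^ p}" "card I = m"
  shows "srht p m \<xi> f I \<in> carrier_mat m (2 ^ p)"
proof -
  have "{i. i < 2 ^ p \<and> i \<in> I} = I" using assms(1) by auto
  then show ?thesis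
    using assms by (auto simp: srht_def dim_submatrix perm_mat_def)
qed

lemma srht_norm:
  assumes I: "I \<subseteq> {..<2 ^ p}" "card I = m" and m: "0 < m" and f: "f permutes {..<2 ^ p}"
    and y: "y \<in> carrier_vec (2 ^ p)"
  shows "sqnorm (srht p m \<xi> f I *\<^sub>v y)
    = 2 ^ p / m * (\<Sum>i\<in>I. (\<Sum>k<2 ^ p. walsh_hadamard p $$ (i, k) * (\<xi> k * y $ f k))\<^sup>2)"
proof -
  define N where "N = (2 ^ p :: nat)"
  define H where "H = walsh_hadamard p"
  define G where "G = H * mat_diag N \<xi> * perm_mat N f"
  define g where "g i = (\<Sum>k<N. H $$ (i, k) * (\<xi> k * y $ f k))" for i
  have H: "H \<in> carrier_mat N N" by (simp add: H_def N_def)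
  have P: "perm_mat N f \<in> carrier_mat N N" by (simp add: perm_mat_def)
  have HD: "H * mat_diag N \<xi> \<in> carrier_mat N N" using H by (rule mult_carrier_mat) simp
  have G: "G \<in> carrier_mat N N" unfolding G_def using HD P by (rule mult_carrier_mat)
  have yN: "y \<in> carrier_vec N" using y by (simp add: N_def)
  have fk: "f k < N" if "k < N" for k
    using permutes_in_image[OF f, of k] that by (simp add: N_def)
  have Py: "(perm_mat N f *\<^sub>v y) $ k = y $ f k" if "k < N" for k
  proof -
    have "(perm_mat N f *\<^sub>v y) $ k = (\<Sum>j<N. (if j = f k then 1 else 0) * y $ j)"
      using that yN by (simp add: perm_mat_def scalar_prod_def lessThan_atLeast0)
    also have "\<dots> = (\<Sum>j<N. if j = f k then y $ j else 0)"
      by (intro sum.cong) auto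
    finally show ?thesis using fk[OF that] by simp
  qed
  have Gy: "(G *\<^sub>v y) $ i = g i" if "i < N" for i
  proof -
    have "G *\<^sub>v y = (H * mat_diag N \<xi>) *\<^sub>v (perm_mat N f *\<^sub>v y)"
      unfolding G_def using H P yN by (intro assoc_mult_mat_vec[of _ N N _ N]) auto
    then have "(G *\<^sub>v y) $ i = (\<Sum>k<N. H $$ (i, k) * \<xi> k * (perm_mat N f *\<^sub>v y) $ k)"
      using that H P yN by (simp add: mat_diag_mult_right[OF H] scalar_prod_def lessThan_atLeast0)
    then show ?thesis
      by (simp add: Py g_def mult_ac)
  qed
  have finI: "finite I" using I(1) by (rule finite_subset) simp
  have setI: "{i. i < N \<and> i \<in> I} = I" using I(1) by (auto simp: N_def)
  define Q where "Q = submatrix G I UNIV"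
  have Q: "Q \<in> carrier_mat m N"
    unfolding Q_def by (rule carrier_matI) (simp_all only: dim_submatrix carrier_matD[OF G] setI I(2), simp)
  have Qy: "(Q *\<^sub>v y) $ a = g (pick I a)" if "a < m" for a
  proof -
    have pk: "pick I a < N" using pick_in_set_le[of a I] that I by (auto simp: N_def)
    have "(Q *\<^sub>v y) $ a = (\<Sum>j<N. Q $$ (a, j) * y $ j)"
      using that Q yN by (simp add: scalar_prod_def lessThan_atLeast0)
    also have "\<dots> = (\<Sum>j<N. G $$ (pick I a, j) * y $ j)"
    proof (intro sum.cong refl arg_cong2[where f = "(*)"])
      fix j assume "j \<in> {..<N}"
      then show "Q $$ (a, j) = G $$ (pick I a, j)"
        unfolding Q_def using submatrix_index[of a G I j UNIV] that setI I(2) carrier_matD[OF G]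
        by (simp add: pick_UNIV)
    qed
    also have "\<dots> = (G *\<^sub>v y) $ pick I a"
      using pk G yN by (simp add: scalar_prod_def lessThan_atLeast0)
    finally show ?thesis using Gy[OF pk] by simp
  qed
  have S: "srht p m \<xi> f I = sqrt (2 ^ p / m) \<cdot>\<^sub>m Q"
    by (simp add: srht_def Q_def G_def H_def N_def)
  have "srht p m \<xi> f I *\<^sub>v y = sqrt (2 ^ p / m) \<cdot>\<^sub>v (Q *\<^sub>v y)"
    unfolding S using Q yN by (intro eq_vecI) (auto simp: scalar_prod_smult_left)
  then have "sqnorm (srht p m \<xi> f I *\<^sub>v y) = 2 ^ p / m * (sqnorm (Q *\<^sub>v y))"
    by (simp flip: mult.assoc)
  also have "sqnorm (Q *\<^sub>v y) = (\<Sum>a<m. (g (pick I a))\<^sup>2)"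
    using Q by (simp add: scalar_prod_def Qy[symmetric] lessThan_atLeast0 power2_eq_square)
  also have "\<dots> = (\<Sum>i\<in>I. (g i)\<^sup>2)"
    using bij_betw_pick[OF finI] I(2) by (intro sum.reindex_bij_betw) simp
  finally show ?thesis by (simp add: g_def H_def N_def)
qed

lemma prob_pair_pmf_le:
  assumes "\<And>x. x \<in> set_pmf A \<Longrightarrow> measure_pmf.prob B {y. (x, y) \<in> E} \<le> c" and "0 \<le> c"
  shows "measure_pmf.prob (pair_pmf A B) E \<le> c"
proof -
  have "emeasure (pair_pmf A B) E = (\<integral>\<^sup>+z. indicator E z \<partial>pair_pmf A B)"
    by simp
  also have "\<dots> = (\<integral>\<^sup>+x. \<integral>\<^sup>+y. indicator E (x, y) \<partial>B \<partial>A)"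
    by (rule nn_integral_pair_pmf')
  also have "\<dots> = (\<integral>\<^sup>+x. emeasure B {y. (x, y) \<in> E} \<partial>A)"
  proof -
    have "(\<integral>\<^sup>+y. indicator E (x, y) \<partial>B) = (\<integral>\<^sup>+y. indicator {y. (x, y) \<in> E} y \<partial>B)" for x
      by (intro nn_integral_cong) (simp add: indicator_def)
    then show ?thesis by simp
  qed
  also have "\<dots> \<le> (\<integral>\<^sup>+x. ennreal c \<partial>A)"
    using assms(1) by (intro nn_integral_mono_AE)
      (auto simp: AE_measure_pmf_iff measure_pmf.emeasure_eq_measure intro!: ennreal_leI)
  also have "\<dots> = ennreal c" by simp
  finally show ?thesis
    using assms(2) by (simp add: measure_pmf.emeasure_eq_measure)
qed

lemma prob_pair_pmf_le':
  assumes "\<And>y. y \<in> set_pmf B \<Longrightarrow> measure_pmf.prob A {x. (x, y) \<in> E} \<le> c" and "0 \<le> c"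
  shows "measure_pmf.prob (pair_pmf A B) E \<le> c"
proof -
  have "measure_pmf.prob (pair_pmf A B) E = measure_pmf.prob (pair_pmf B A) {(y, x). (x, y) \<in> E}"
    by (subst pair_commute_pmf) (auto intro!: arg_cong[where f = "measure_pmf.prob _"])
  also have "\<dots> \<le> c"
    using assms by (intro prob_pair_pmf_le) auto
  finally show ?thesis .
qed

text \<open>
  Row \<open>i\<close> of \<open>H D P U\<close>, where \<open>u k\<close> is row \<open>k\<close> of \<open>U\<close>, \<open>D\<close> has diagonal \<open>\<xi>\<close> and \<open>P\<close> belongs to \<open>f\<close>.
\<close>

definition rotated :: "nat \<Rightarrow> (nat \<Rightarrow> nat \<Rightarrow> real) \<Rightarrow> (nat \<Rightarrow> real) \<Rightarrow> (nat \<Rightarrow> nat) \<Rightarrow> nat \<Rightarrow> nat \<Rightarrow> real" where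
  "rotated p u \<xi> f i a = (\<Sum>k<2 ^ p. walsh_hadamard p $$ (i, k) * \<xi> k * u (f k) a)"

lemma ip_rotated:
  "ip d (rotated p u \<xi> f i) x = (\<Sum>k<2 ^ p. walsh_hadamard p $$ (i, k) * (\<xi> k * ip d (u (f k)) x))"
proof -
  have "rotated p u \<xi> f i = (\<lambda>a. \<Sum>k<2 ^ p. (walsh_hadamard p $$ (i, k) * \<xi> k) * u (f k) a)"
    by (rule ext) (simp add: rotated_def)
  then show ?thesis
    unfolding ip_linear by (simp only: ip_linear mult.assoc)
qed

lemma rotated_frame:
  assumes frame: "\<And>x. (\<Sum>k<2 ^ p. (ip d (u k) x)\<^sup>2) = ip d x x"
    and \<xi>: "\<And>k. k < 2 ^ p \<Longrightarrow> \<xi> k \<in> {-1, 1}" and f: "f permutes {..<2 ^ p}"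
  shows "(\<Sum>i<2 ^ p. (ip d (rotated p u \<xi> f i) x)\<^sup>2) = ip d x x"
proof -
  have "(\<Sum>i<2 ^ p. (ip d (rotated p u \<xi> f i) x)\<^sup>2) = (\<Sum>k<2 ^ p. (\<xi> k * ip d (u (f k)) x)\<^sup>2)"
    unfolding ip_rotated by (rule walsh_hadamard_isometry)
  also have "\<dots> = (\<Sum>k<2 ^ p. (ip d (u (f k)) x)\<^sup>2)"
  proof (intro sum.cong refl)
    fix k assume "k \<in> {..<(2::nat) ^ p}"
    then have "(\<xi> k)\<^sup>2 = 1" using \<xi>[of k] by auto
    then show "(\<xi> k * ip d (u (f k)) x)\<^sup>2 = (ip d (u (f k)) x)\<^sup>2"
      by (simp add: power_mult_distrib)
  qed
  also have "\<dots> = (\<Sum>k<2 ^ p. (ip d (u k) x)\<^sup>2)"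
    using f by (intro sum.reindex_bij_betw) (simp add: permutes_imp_bij)
  finally show ?thesis by (simp add: frame)
qed

text \<open>
  All entries of \<open>H\<close> have modulus \<open>1/\<surd>N\<close>, so \<open>\<surd>N\<close> times row \<open>i\<close> is a Rademacher sum over a tight
  frame, up to fixed signs; a union bound over the \<open>N\<close> rows follows.
\<close>

lemma rotated_row_tail:
  assumes frame: "\<And>x. (\<Sum>k<2 ^ p. (ip d (u k) x)\<^sup>2) = ip d x x" and f: "f permutes {..<2 ^ p}"
  shows "measure_pmf.prob (rademacher_pmf (2 ^ p))
      {\<xi>. \<exists>i<2 ^ p. M / 2 ^ p < ip d (rotated p u \<xi> f i) (rotated p u \<xi> f i)}
    \<le> 2 ^ p * (sqrt 2 ^ d * exp (- M / 4))"
proof -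
  let ?R = "rademacher_pmf (2 ^ p)"
  have row: "measure_pmf.prob ?R {\<xi>. M / 2 ^ p < ip d (rotated p u \<xi> f i) (rotated p u \<xi> f i)}
      \<le> sqrt 2 ^ d * exp (- M / 4)" if i: "i < 2 ^ p" for i
  proof -
    define w where "w k a = sqrt (2 ^ p) * walsh_hadamard p $$ (i, k) * u (f k) a" for k a
    have "(ip d (w k) x)\<^sup>2 = (ip d (u (f k)) x)\<^sup>2" if "k < 2 ^ p" for k x
      unfolding w_def ip_linear using walsh_hadamard_entry_square[OF i that]
      by (simp add: power_mult_distrib)
    then have "(\<Sum>k<2 ^ p. (ip d (w k) x)\<^sup>2) = (\<Sum>k<2 ^ p. (ip d (u (f k)) x)\<^sup>2)" for x
      by simp
    also have "(\<Sum>k<2 ^ p. (ip d (u (f k)) x)\<^sup>2) = (\<Sum>k<2 ^ p. (ip d (u k) x)\<^sup>2)" for x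
      using f by (intro sum.reindex_bij_betw) (simp add: permutes_imp_bij)
    finally have fr: "(\<Sum>k<2 ^ p. (ip d (w k) x)\<^sup>2) = ip d x x" for x
      by (simp add: frame)
    have X: "(\<lambda>a. \<Sum>k<2 ^ p. \<xi> k * w k a) = (\<lambda>a. sqrt (2 ^ p) * rotated p u \<xi> f i a)" for \<xi>
      by (rule ext) (simp add: w_def rotated_def sum_distrib_left mult_ac)
    have "M < ip d (\<lambda>a. sqrt (2 ^ p) * rotated p u \<xi> f i a) (\<lambda>a. sqrt (2 ^ p) * rotated p u \<xi> f i a)
        \<longleftrightarrow> M / 2 ^ p < ip d (rotated p u \<xi> f i) (rotated p u \<xi> f i)" for \<xi>
      unfolding ip_linear by (simp add: field_simps flip: mult.assoc)
    with rademacher_norm_tail[OF fr, of M] show ?thesis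
      by (simp add: X)
  qed
  have "measure_pmf.prob ?R {\<xi>. \<exists>i<2 ^ p. M / 2 ^ p < ip d (rotated p u \<xi> f i) (rotated p u \<xi> f i)}
      = measure_pmf.prob ?R (\<Union>i<2 ^ p. {\<xi>. M / 2 ^ p < ip d (rotated p u \<xi> f i) (rotated p u \<xi> f i)})"
    by (intro arg_cong[where f = "measure_pmf.prob _"]) auto
  also have "\<dots> \<le> (\<Sum>i<2 ^ p. measure_pmf.prob ?R
      {\<xi>. M / 2 ^ p < ip d (rotated p u \<xi> f i) (rotated p u \<xi> f i)})"
    by (intro measure_pmf.finite_measure_subadditive_finite) auto
  also have "\<dots> \<le> (\<Sum>i<(2::nat) ^ p. sqrt 2 ^ d * exp (- M / 4))"
    using row by (intro sum_mono) auto
  finally show ?thesis by simp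
qed

text \<open>
  With \<open>R\<close> the square root of \<open>X\<^sup>T X\<close>, the columns of \<open>X R\<^bsup>-1\<^esup>\<close> are orthonormal.
\<close>

lemma orthonormalize:
  assumes X: "X \<in> carrier_mat N d" and inj: "inj_mat X"
  obtains u R where "R \<in> carrier_mat d d" "\<And>x. (\<Sum>k<N. (ip d (u k) x)\<^sup>2) = ip d x x"
    "\<And>y k. y \<in> carrier_vec d \<Longrightarrow> k < N \<Longrightarrow> (X *\<^sub>v y) $ k = ip d (u k) (($) (R *\<^sub>v y))"
proof -
  define M where "M = transpose_mat X * X"
  interpret spd_mat d M
    unfolding M_def using X inj by (rule gram_spd)
  define R W where "R = msqrt M" and "W = minv R"
  have R: "R \<in> carrier_mat d d" and W: "W \<in> carrier_mat d d" and symW: "transpose_mat W = W"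
    and WR: "W * R = 1\<^sub>m d" and WMW: "W * M * W = 1\<^sub>m d"
    using sqrt_inverse by (auto simp: R_def W_def)
  define U where "U = X * W"
  have U: "U \<in> carrier_mat N d" using X W by (simp add: U_def)
  define u where "u k a = U $$ (k, a)" for k a
  have Uv: "(U *\<^sub>v y) $ k = ip d (u k) (($) y)" if "y \<in> carrier_vec d" "k < N" for y k
    using that U by (auto simp: ip_def u_def scalar_prod_def lessThan_atLeast0)
  show thesis
  proof
    show "R \<in> carrier_mat d d" by fact
    fix x :: "nat \<Rightarrow> real"
    define y where "y = Matrix.vec d x"
    have y: "y \<in> carrier_vec d" by (simp add: y_def)
    have ipy: "ip d z (($) y) = ip d z x" for z by (intro ip_cong) (auto simp: y_def)
    have Wy: "W *\<^sub>v y \<in> carrier_vec d" using W y by simp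
    have "(\<Sum>k<N. (ip d (u k) x)\<^sup>2) = sqnorm (U *\<^sub>v y)"
    proof -
      have Uy: "U *\<^sub>v y \<in> carrier_vec N" using U y by (rule mult_mat_vec_carrier)
      show ?thesis
        unfolding scalar_prod_ip[OF Uy] ip_def[of N] power2_eq_square ipy[symmetric]
        using Uv[OF y] by (intro sum.cong refl) (simp del: index_mult_mat_vec)
    qed
    also have "\<dots> = sqnorm (X *\<^sub>v (W *\<^sub>v y))"
      using X W y by (simp add: U_def assoc_mult_mat_vec[of _ N d _ d])
    also have "\<dots> = (W *\<^sub>v y) \<bullet> (M *\<^sub>v (W *\<^sub>v y))"
      unfolding M_def by (rule gram_form[OF X Wy, symmetric])
    also have "\<dots> = y \<bullet> (W *\<^sub>v (M *\<^sub>v (W *\<^sub>v y)))"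
      using scalar_prod_transpose_mult[OF W y mult_carrier[OF Wy]] symW by simp
    also have "W *\<^sub>v (M *\<^sub>v (W *\<^sub>v y)) = (W * M * W) *\<^sub>v y"
      using W y carrier by (simp add: assoc_mult_mat_vec[of _ d d _ d])
    also have "\<dots> = y" using y by (simp add: WMW)
    also have "y \<bullet> y = ip d x x"
      unfolding scalar_prod_ip[OF y] by (intro ip_cong) (auto simp: y_def)
    finally show "(\<Sum>k<N. (ip d (u k) x)\<^sup>2) = ip d x x" .
  next
    fix y :: rvec and k assume y: "y \<in> carrier_vec d" and k: "k < N"
    have "X *\<^sub>v y = X *\<^sub>v ((W * R) *\<^sub>v y)" using y by (simp add: WR)
    also have "\<dots> = U *\<^sub>v (R *\<^sub>v y)"
      unfolding U_def using X W R y by (simp add: assoc_mult_mat_vec[of _ N d _ d] assoc_mult_mat_vec[of _ d d _ d])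
    finally have "X *\<^sub>v y = U *\<^sub>v (R *\<^sub>v y)" .
    then show "(X *\<^sub>v y) $ k = ip d (u k) (($) (R *\<^sub>v y))"
      using Uv[of "R *\<^sub>v y" k] R y k by simp
  qed
qed

text \<open>
  Failure probability of the row bound at the level \<open>8 (D + ln (N/\<delta>))\<close>: the exponent leaves
  \<open>(\<delta>/N)\<^sup>2\<close>, one factor of which pays for the \<open>N\<close> rows, and \<open>e\<^bsup>-2D\<^esup>\<close>, which pays for \<open>2\<^bsup>D/2\<^esup>\<close>.
\<close>

lemma sum_rotated_rows_bound:
  fixes N d \<delta> :: real
  assumes "1 \<le> N" "0 < \<delta>" "\<delta> < 1" "1 \<le> D"
  shows "N * (sqrt 2 ^ D * exp (- (8 * (D + ln (N / \<delta>))) / 4)) \<le> \<delta> / 2"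
proof -
  have e2: "2 \<le> exp (1::real)" using exp_ge_add_one_self[of 1] by simp
  have "sqrt 2 * exp (- 2) \<le> 1 / (2::real)"
  proof -
    have "sqrt 2 \<le> (2::real)" using real_sqrt_le_mono[of 2 4] by simp
    moreover have "exp (- 2) \<le> 1 / (4::real)"
    proof -
      have "exp (2::real) = exp 1 * exp 1" by (simp flip: exp_add)
      then have "4 \<le> exp (2::real)" using mult_mono[OF e2 e2] by simp
      then show ?thesis by (simp add: exp_minus field_simps)
    qed
    ultimately show ?thesis
      using mult_mono[of "sqrt 2" 2 "exp (- 2)" "1 / (4::real)"] by simp
  qed
  then have "(sqrt 2 * exp (- 2)) ^ D \<le> (1 / 2) ^ D"
    by (intro power_mono) auto
  also have "\<dots> \<le> 1 / (2::real)"
    using assms(4) power_decreasing[of 1 D "1 / 2 :: real"] by simp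
  finally have half: "(sqrt 2 * exp (- 2)) ^ D \<le> 1 / (2::real)" .
  have "exp (- (8 * (D + ln (N / \<delta>))) / 4) = exp (- 2) ^ D * exp (- ln (N / \<delta>)) ^ 2"
    by (simp add: exp_of_nat_mult[symmetric] flip: exp_add)
  also have "exp (- ln (N / \<delta>)) = \<delta> / N"
    using assms by (simp add: exp_minus)
  finally have "N * (sqrt 2 ^ D * exp (- (8 * (D + ln (N / \<delta>))) / 4))
      = (sqrt 2 * exp (- 2)) ^ D * (\<delta> * (\<delta> / N))"
    using assms by (simp add: power_mult_distrib power2_eq_square field_simps)
  also have "\<dots> \<le> 1 / 2 * (\<delta> * 1)"
    using half assms by (intro mult_mono) auto
  finally show ?thesis by simp
qed

text \<open>
  Failure probability of the sampling step at accuracy \<open>1/100\<close>: for \<open>t \<le> 8 / 10\<^sup>7\<close> the base of the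
  power is at most \<open>1/9 \<le> e\<^bsup>-2\<^esup>\<close>, and \<open>q \<ge> ln (e D / \<delta>)\<close> makes the power small enough to beat the
  factor \<open>D\<close>.
\<close>

lemma sampling_error_bound:
  fixes t \<delta> :: real and q :: nat
  assumes t: "0 \<le> t" "t \<le> 8 / 10 ^ 7" and \<delta>: "0 < \<delta>" "\<delta> < 1" "1 \<le> D"
    and q: "ln (exp 1 * real D / \<delta>) \<le> q"
  shows "D * ((4 * t\<^sup>2 + 8 * t) / (1 / 100)\<^sup>2) ^ q \<le> \<delta> / 2"
proof -
  have "t\<^sup>2 \<le> t"
    using t by (simp add: power2_eq_square mult_left_le)
  then have "4 * t\<^sup>2 + 8 * t \<le> 12 * (8 / 10 ^ 7)"
    using t(2) by linarith
  then have "(4 * t\<^sup>2 + 8 * t) / (1 / 100)\<^sup>2 \<le> 1 / 9"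
    by (simp add: power2_eq_square)
  also have "\<dots> \<le> exp (- 2)"
  proof -
    have "exp (2::real) = exp 1 * exp 1" by (simp flip: exp_add)
    also have "\<dots> \<le> 3 * 3" using exp_le by (intro mult_mono) auto
    finally show ?thesis by (simp add: exp_minus field_simps)
  qed
  finally have "((4 * t\<^sup>2 + 8 * t) / (1 / 100)\<^sup>2) ^ q \<le> exp (- 2) ^ q"
    using t by (intro power_mono) auto
  also have "\<dots> = exp (- q) ^ 2"
    by (simp flip: exp_of_nat_mult)
  also have "\<dots> \<le> exp (- ln (exp 1 * real D / \<delta>)) ^ 2"
    using q by (intro power_mono) auto
  also have "exp (- ln (exp 1 * real D / \<delta>)) = \<delta> / (exp 1 * D)"
    using \<delta> by (simp add: exp_minus)
  finally have "D * ((4 * t\<^sup>2 + 8 * t) / (1 / 100)\<^sup>2) ^ q \<le> D * (\<delta> / (exp 1 * D)) ^ 2"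
    by (rule mult_left_mono) simp
  also have "\<dots> = \<delta> * (\<delta> / D) / (exp 1 * exp 1)"
    using \<delta> by (simp add: power2_eq_square field_simps)
  also have "\<dots> \<le> (\<delta> * 1) / (2 * 1)"
  proof (intro frac_le mult_mono mult_left_mono)
    show "2 \<le> exp (1::real)" using exp_ge_add_one_self[of 1] by simp
    show "\<delta> / D \<le> 1" using \<delta> by (simp add: field_simps)
  qed (use \<delta> in auto)
  finally show ?thesis by simp
qed

text \<open>
  Conditionally on signs and permutation with flat rows, the index set is a uniform sample from a
  tight frame with \<open>b = \<mu> / N\<close>; the two sources of failure receive \<open>\<delta>/2\<close> each. The factor \<open>2 * 10\<^sup>7\<close>
  comes from the accuracy \<open>1/100\<close>: with \<open>q \<le> 2 L\<close> it makes \<open>q \<mu> / m \<le> 8 / 10\<^sup>7\<close>.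
\<close>

theorem srht_embedding:
  assumes X: "X \<in> carrier_mat (2 ^ p) d" and inj: "inj_mat X" and d: "1 \<le> d"
    and m: "m \<le> 2 ^ p" and \<delta>: "0 < \<delta>" "\<delta> < 1"
    and large: "2 * 10 ^ 7 * (real d + ln (2 ^ p / \<delta>)) * ln (exp 1 * real d / \<delta>) \<le> real m"
  shows "measure_pmf.prob (srht_pmf p m) {S. \<not> embeds (1 / 100) S X} \<le> \<delta>"
proof -
  define N where "N = (2 ^ p :: nat)"
  define \<mu> where "\<mu> = 8 * (real d + ln (2 ^ p / \<delta>))"
  define L where "L = ln (exp 1 * real d / \<delta>)"
  define q where "q = nat \<lceil>L\<rceil>"
  have L1: "1 \<le> L"
  proof -
    have "1 \<le> real d / \<delta>" using d \<delta> by (simp add: field_simps)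
    then have "exp 1 * 1 \<le> exp 1 * (real d / \<delta>)" by (rule mult_left_mono) simp
    then have "ln (exp 1) \<le> L"
      unfolding L_def using d \<delta> by (subst ln_le_cancel_iff) auto
    then show ?thesis by simp
  qed
  have q: "L \<le> q" "q \<le> 2 * L"
    using L1 unfolding q_def by linarith+
  have ln0: "0 \<le> ln (2 ^ p / \<delta>)"
  proof -
    have "1 * \<delta> \<le> 2 ^ p * 1" using \<delta> by (intro mult_mono) auto
    then show ?thesis using \<delta> by (intro ln_ge_zero) (simp add: field_simps)
  qed
  have \<mu>: "0 < \<mu>" using d ln0 by (simp add: \<mu>_def)
  have large': "2 * 10 ^ 7 * (\<mu> / 8) * L \<le> m"
  proof -
    have "\<mu> / 8 = real d + ln (2 ^ p / \<delta>)" by (simp add: \<mu>_def)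
    then show ?thesis using large by (simp only: L_def)
  qed
  have m_pos: "0 < m"
  proof -
    have "0 < 2 * 10 ^ 7 * (\<mu> / 8) * L" using \<mu> L1 by simp
    then have "0 < real m" using large' by linarith
    then show ?thesis by simp
  qed
  obtain u R where R: "R \<in> carrier_mat d d"
    and frame: "\<And>x. (\<Sum>k<2 ^ p. (ip d (u k) x)\<^sup>2) = ip d x x"
    and XR: "\<And>y k. y \<in> carrier_vec d \<Longrightarrow> k < 2 ^ p \<Longrightarrow> (X *\<^sub>v y) $ k = ip d (u k) (($) (R *\<^sub>v y))"
    using orthonormalize[OF X inj] by metis
  \<comment> \<open>The two events on which the embedding rests: short rows, and a small deviation of the sample in every direction.\<close>
  define flat where "flat \<xi> f \<longleftrightarrow>
      (\<forall>i<2 ^ p. ip d (rotated p u \<xi> f i) (rotated p u \<xi> f i) \<le> \<mu> / 2 ^ p)" for \<xi> f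
  define bad where "bad \<xi> f I \<longleftrightarrow> (\<exists>x. 1 / 100 * ip d x x
      < \<bar>2 ^ p / m * (\<Sum>i\<in>I. (ip d (rotated p u \<xi> f i) x)\<^sup>2) - ip d x x\<bar>)" for \<xi> f I
  let ?sets = "{I. I \<subseteq> {..<(2::nat) ^ p} \<and> card I = m}"
  have fin_sets: "finite ?sets"
    by (rule finite_subset[of _ "Pow {..<2 ^ p}"]) auto
  have ne_sets: "?sets \<noteq> {}"
  proof -
    have "{..<m} \<in> ?sets" using m by auto
    then show ?thesis by blast
  qed
  have fin_perm: "finite {f. f permutes {..<(2::nat) ^ p}}" by (rule finite_permutations) simp
  have ne_perm: "{f. f permutes {..<(2::nat) ^ p}} \<noteq> {}" using permutes_id by blast
  have set_perm: "set_pmf (perm_pmf (2 ^ p)) = {f. f permutes {..<2 ^ p}}"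
    unfolding perm_pmf_def using ne_perm fin_perm by simp
  have set_index: "set_pmf (index_pmf (2 ^ p) m) = ?sets"
    unfolding index_pmf_def using ne_sets fin_sets by simp
  let ?R = "rademacher_pmf (2 ^ p)" and ?F = "perm_pmf (2 ^ p)" and ?I = "index_pmf (2 ^ p) m"
  let ?\<Omega> = "pair_pmf ?R (pair_pmf ?F ?I)"

  have emb: "embeds (1 / 100) (srht p m \<xi> f I) X"
    if f: "f permutes {..<2 ^ p}" and I: "I \<in> ?sets" and nb: "\<not> bad \<xi> f I" for \<xi> f I
    unfolding embeds_def
  proof
    fix y :: rvec assume "y \<in> carrier_vec (dim_col X)"
    then have y: "y \<in> carrier_vec d" using X by simp
    define x where "x = ($) (R *\<^sub>v y)"
    have Xy: "X *\<^sub>v y \<in> carrier_vec (2 ^ p)" using X y by (rule mult_mat_vec_carrier)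
    have S: "srht p m \<xi> f I \<in> carrier_mat m (2 ^ p)"
      using I by (intro srht_carrier) auto
    have fk: "f k < 2 ^ p" if "k < 2 ^ p" for k
      using permutes_in_image[OF f, of k] that by simp
    have "sqnorm ((srht p m \<xi> f I * X) *\<^sub>v y)
        = sqnorm (srht p m \<xi> f I *\<^sub>v (X *\<^sub>v y))"
      unfolding assoc_mult_mat_vec[OF S X y] ..
    also have "\<dots> = 2 ^ p / m * (\<Sum>i\<in>I. (\<Sum>k<2 ^ p. walsh_hadamard p $$ (i, k) * (\<xi> k * (X *\<^sub>v y) $ f k))\<^sup>2)"
      using I m_pos f Xy by (intro srht_norm) auto
    also have "\<dots> = 2 ^ p / m * (\<Sum>i\<in>I. (ip d (rotated p u \<xi> f i) x)\<^sup>2)"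
      unfolding ip_rotated using XR[OF y fk] by (simp add: x_def del: index_mult_mat_vec)
    finally have 1: "sqnorm ((srht p m \<xi> f I * X) *\<^sub>v y)
        = 2 ^ p / m * (\<Sum>i\<in>I. (ip d (rotated p u \<xi> f i) x)\<^sup>2)" .
    have "sqnorm (X *\<^sub>v y) = (\<Sum>k<2 ^ p. (ip d (u k) x)\<^sup>2)"
      unfolding scalar_prod_ip[OF Xy] ip_def[of "2 ^ p"] power2_eq_square x_def
      using XR[OF y] by (intro sum.cong refl) (simp del: index_mult_mat_vec)
    then have 2: "sqnorm (X *\<^sub>v y) = ip d x x"
      by (simp add: frame)
    show "\<bar>sqnorm ((srht p m \<xi> f I * X) *\<^sub>v y) - sqnorm (X *\<^sub>v y)\<bar>
        \<le> 1 / 100 * (sqnorm (X *\<^sub>v y))"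
      unfolding 1 2 using nb by (auto simp: bad_def not_less)
  qed

  have rows: "measure_pmf.prob ?\<Omega> {(\<xi>, f, I). \<not> flat \<xi> f} \<le> \<delta> / 2"
  proof (rule prob_pair_pmf_le')
    fix z assume "z \<in> set_pmf (pair_pmf ?F ?I)"
    then have "fst z permutes {..<2 ^ p}" by (auto simp: set_perm)
    then have "measure_pmf.prob ?R {\<xi>. \<exists>i<2 ^ p. \<mu> / 2 ^ p
          < ip d (rotated p u \<xi> (fst z) i) (rotated p u \<xi> (fst z) i)}
        \<le> 2 ^ p * (sqrt 2 ^ d * exp (- \<mu> / 4))"
      by (rule rotated_row_tail[OF frame])
    also have "\<dots> \<le> \<delta> / 2"
      unfolding \<mu>_def using sum_rotated_rows_bound[of "2 ^ p" \<delta> d] \<delta> d by simp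
    finally show "measure_pmf.prob ?R {\<xi>. (\<xi>, z) \<in> {(\<xi>, f, I). \<not> flat \<xi> f}} \<le> \<delta> / 2"
      by (simp add: flat_def case_prod_unfold not_le)
  qed (use \<delta> in simp)

  have sampling: "measure_pmf.prob ?\<Omega> {(\<xi>, f, I). flat \<xi> f \<and> bad \<xi> f I} \<le> \<delta> / 2"
  proof (intro prob_pair_pmf_le)
    fix \<xi> f assume \<xi>: "\<xi> \<in> set_pmf ?R" and f: "f \<in> set_pmf ?F"
    show "measure_pmf.prob ?I {I. (f, I) \<in> {z. (\<xi>, z) \<in> {(\<xi>, f, I). flat \<xi> f \<and> bad \<xi> f I}}} \<le> \<delta> / 2"
    proof (cases "flat \<xi> f")
      case False
      then show ?thesis using \<delta> by simp
    next
      case True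
      interpret tight_frame "2 ^ p" d "rotated p u \<xi> f" "\<mu> / 2 ^ p" m
      proof
        show "(\<Sum>i<2 ^ p. (ip d (rotated p u \<xi> f i) x)\<^sup>2) = ip d x x" for x
          using \<xi> f set_rademacher[OF \<xi>] by (intro rotated_frame frame) (auto simp: set_perm)
      qed (use True m m_pos in \<open>auto simp: flat_def\<close>)
      define t where "t = real q * (\<mu> / 2 ^ p) * 2 ^ p / m"
      have "t = q * \<mu> / m" by (simp add: t_def)
      also have "\<dots> \<le> 2 * L * \<mu> / m"
        using q \<mu> by (intro divide_right_mono mult_right_mono) auto
      also have "\<dots> \<le> 8 / 10 ^ 7"
        using large' m_pos by (simp add: field_simps)
      finally have t: "t \<le> 8 / 10 ^ 7" .
      have t0: "0 \<le> t" using \<mu> by (simp add: t_def)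
      have "measure_pmf.prob ?I {I. bad \<xi> f I} = card {I \<in> samples. bad \<xi> f I} / card samples"
        unfolding index_pmf_def using fin_sets ne_sets
        by (simp add: measure_pmf_of_set samples_def Int_def conj_ac)
      also have "\<dots> \<le> (card samples * d * ((4 * t\<^sup>2 + 8 * t) / (1 / 100)\<^sup>2) ^ q) / card samples"
        using sampling_without_replacement[of "1 / 100" q]
        by (intro divide_right_mono) (simp_all add: bad_def t_def)
      also have "\<dots> = d * ((4 * t\<^sup>2 + 8 * t) / (1 / 100)\<^sup>2) ^ q"
      proof -
        have "samples = ?sets" by (simp add: samples_def)
        then have "card samples \<noteq> 0" using fin_sets ne_sets by (metis card_0_eq)
        then show ?thesis by simp
      qed
      also have "\<dots> \<le> \<delta> / 2"
        using t0 t \<delta> d q(1) unfolding L_def by (intro sampling_error_bound) auto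
      finally show ?thesis using True by simp
    qed
  qed (use \<delta> in auto)

  have "measure_pmf.prob (srht_pmf p m) {S. \<not> embeds (1 / 100) S X}
      = measure_pmf.prob ?\<Omega> {(\<xi>, f, I). \<not> embeds (1 / 100) (srht p m \<xi> f I) X}"
    unfolding srht_pmf_def by (simp add: vimage_def case_prod_unfold)
  also have "\<dots> \<le> measure_pmf.prob ?\<Omega>
      ({(\<xi>, f, I). \<not> flat \<xi> f} \<union> {(\<xi>, f, I). flat \<xi> f \<and> bad \<xi> f I})"
    using emb by (intro measure_pmf.finite_measure_mono_AE)
      (auto simp: AE_measure_pmf_iff set_perm set_index)
  also have "\<dots> \<le> measure_pmf.prob ?\<Omega> {(\<xi>, f, I). \<not> flat \<xi> f}
      + measure_pmf.prob ?\<Omega> {(\<xi>, f, I). flat \<xi> f \<and> bad \<xi> f I}"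
    by (intro measure_Un_le) auto
  finally show ?thesis using rows sampling by simp
qed

section \<open>Least squares and the stages of the iteration\<close>

lemma vnorm_L2_set: "v \<in> carrier_vec n \<Longrightarrow> vnorm v = L2_set (($) v) {..<n}"
  by (auto simp: vnorm_def L2_set_def scalar_prod_def lessThan_atLeast0 power2_eq_square)

lemma vnorm_nonneg: "0 \<le> vnorm v"
  by (simp add: vnorm_def scalar_prod_self_nonneg)

lemma vnorm_triangle:
  assumes "x \<in> carrier_vec n" "y \<in> carrier_vec n"
  shows "vnorm (x + y) \<le> vnorm x + vnorm y"
proof -
  have "vnorm (x + y) = L2_set (\<lambda>i. x $ i + y $ i) {..<n}"
    using assms by (subst vnorm_L2_set[of _ n]) (auto intro!: L2_set_cong)
  also have "\<dots> \<le> L2_set (($) x) {..<n} + L2_set (($) y) {..<n}"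
    by (rule L2_set_triangle_ineq)
  finally show ?thesis
    using assms by (simp add: vnorm_L2_set[of _ n])
qed

lemma vnorm_minus_commute:
  assumes "x \<in> carrier_vec n" "y \<in> carrier_vec n"
  shows "vnorm (x - y) = vnorm (y - x)"
  using assms by (subst (1 2) vnorm_L2_set[of _ n])
    (auto simp: L2_set_def power2_commute)

lemma pred_triangle:
  assumes X: "X \<in> carrier_mat N d" and "x \<in> carrier_vec d" "y \<in> carrier_vec d" "z \<in> carrier_vec d"
  shows "vnorm (X *\<^sub>v (x - z)) \<le> vnorm (X *\<^sub>v (x - y)) + vnorm (X *\<^sub>v (y - z))"
proof -
  have "x - z = (x - y) + (y - z)"
    using assms by (intro eq_vecI) auto
  then have "X *\<^sub>v (x - z) = X *\<^sub>v (x - y) + X *\<^sub>v (y - z)"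
    using assms by (simp add: mult_add_distrib_mat_vec[of _ N d])
  then show ?thesis
    using assms by (simp add: vnorm_triangle[of _ N])
qed

text \<open>
  By the normal equations the residual is orthogonal to the range of \<open>A\<close>, so Pythagoras makes the
  solution the only minimiser. The solution is stated as a fixed matrix applied to the data because
  integrability rests on linearity in the data.
\<close>

lemma normal_equation_solution:
  assumes A: "A \<in> carrier_mat m n" and inj: "inj_mat A"
  defines "P \<equiv> minv (transpose_mat A * A) * transpose_mat A"
  assumes b: "b \<in> carrier_vec m"
  shows "P \<in> carrier_mat n m"
    and "minv (transpose_mat A * A) *\<^sub>v (transpose_mat A *\<^sub>v b) = P *\<^sub>v b"
    and "(transpose_mat A * A) *\<^sub>v (P *\<^sub>v b) = transpose_mat A *\<^sub>v b"
    and "least_squares A b = P *\<^sub>v b"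
proof -
  let ?G = "transpose_mat A * A"
  note spd = gram_spd[OF A inj]
  note carrier = spd_mat.carrier[OF spd]
  note minv = minv_inverse[OF carrier spd_mat.inj[OF spd]]
  have At: "transpose_mat A \<in> carrier_mat n m" using A by simp
  show P: "P \<in> carrier_mat n m" unfolding P_def using minv(1) At by (rule mult_carrier_mat)
  have Atb: "transpose_mat A *\<^sub>v b \<in> carrier_vec n" using At b by simp
  show eq: "minv ?G *\<^sub>v (transpose_mat A *\<^sub>v b) = P *\<^sub>v b"
    unfolding P_def by (rule assoc_mult_mat_vec[OF minv(1) At b, symmetric])
  have "?G *\<^sub>v (P *\<^sub>v b) = (?G * minv ?G) *\<^sub>v (transpose_mat A *\<^sub>v b)"
    unfolding eq[symmetric] by (rule assoc_mult_mat_vec[OF carrier minv(1) Atb, symmetric])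
  then show normal: "?G *\<^sub>v (P *\<^sub>v b) = transpose_mat A *\<^sub>v b"
    using Atb by (simp add: minv(2))
  define z where "z = P *\<^sub>v b"
  have z: "z \<in> carrier_vec n" using P b by (simp add: z_def)
  have Az: "A *\<^sub>v z - b \<in> carrier_vec m" using A z b by simp
  have orth: "transpose_mat A *\<^sub>v (A *\<^sub>v z - b) = 0\<^sub>v n"
  proof -
    have "transpose_mat A *\<^sub>v (A *\<^sub>v z - b) = transpose_mat A *\<^sub>v (A *\<^sub>v z) - transpose_mat A *\<^sub>v b"
      using At A z b by (intro mult_minus_distrib_mat_vec) auto
    also have "transpose_mat A *\<^sub>v (A *\<^sub>v z) = ?G *\<^sub>v z"
      by (rule assoc_mult_mat_vec[OF At A z, symmetric])
    also have "\<dots> = transpose_mat A *\<^sub>v b"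
      unfolding z_def by (rule normal)
    finally show ?thesis using Atb by simp
  qed
  have pyth: "(vnorm (A *\<^sub>v u - b))\<^sup>2 = (vnorm (A *\<^sub>v z - b))\<^sup>2 + sqnorm (A *\<^sub>v (u - z))"
    if u: "u \<in> carrier_vec n" for u
  proof -
    have uz: "u - z \<in> carrier_vec n" using u z by simp
    have Auz: "A *\<^sub>v (u - z) \<in> carrier_vec m" using A uz by simp
    have "A *\<^sub>v u - b = A *\<^sub>v (u - z) + (A *\<^sub>v z - b)"
      using A u z b by (intro eq_vecI) (auto simp: mult_minus_distrib_mat_vec[of _ m n])
    moreover have "(A *\<^sub>v (u - z)) \<bullet> (A *\<^sub>v z - b) = 0"
      using scalar_prod_transpose_mult[OF A uz Az] orth uz by simp
    ultimately show ?thesis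
      using Auz Az comm_scalar_prod[OF Auz Az]
      by (simp add: vnorm_def scalar_prod_self_nonneg scalar_prod_add_distrib[of _ m]
          add_scalar_prod_distrib[of _ m])
  qed
  define F where "F u = 1 / 2 * (vnorm (A *\<^sub>v u - b))\<^sup>2" for u
  have unique: "u = z" if "is_arg_min F (\<lambda>u. u \<in> carrier_vec n) u" for u
  proof -
    from that have u: "u \<in> carrier_vec n" and "\<not> F z < F u"
      using z by (auto simp: is_arg_min_def)
    then have "sqnorm (A *\<^sub>v (u - z)) \<le> 0"
      using pyth[OF u] by (simp add: F_def not_less)
    then have "sqnorm (A *\<^sub>v (u - z)) = 0"
      using scalar_prod_self_nonneg by (metis order_antisym)
    then have "A *\<^sub>v (u - z) = 0\<^sub>v m"
      using scalar_prod_self_eq_0[of "A *\<^sub>v (u - z)" m] A u z by simp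
    then have 0: "u - z = 0\<^sub>v n"
      using inj_matD[OF inj A, of "u - z"] u z by simp
    show "u = z"
    proof (rule eq_vecI)
      fix i assume "i < dim_vec z"
      then have "(u - z) $ i = 0" using 0 z by simp
      then show "u $ i = z $ i" using \<open>i < dim_vec z\<close> by simp
    qed (use u z in simp)
  qed
  have "is_arg_min F (\<lambda>u. u \<in> carrier_vec n) z"
    unfolding is_arg_min_def F_def
  proof (intro conjI notI z)
    assume "\<exists>y. y \<in> carrier_vec n \<and> 1 / 2 * (vnorm (A *\<^sub>v y - b))\<^sup>2 < 1 / 2 * (vnorm (A *\<^sub>v z - b))\<^sup>2"
    then obtain y where y: "y \<in> carrier_vec n" "1 / 2 * (vnorm (A *\<^sub>v y - b))\<^sup>2 < 1 / 2 * (vnorm (A *\<^sub>v z - b))\<^sup>2"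
      by blast
    show False
      using y(2) pyth[OF y(1)] scalar_prod_self_nonneg[of "A *\<^sub>v (y - z)"] by simp
  qed
  then have "arg_min F (\<lambda>u. u \<in> carrier_vec n) = z"
    unfolding arg_min_def using unique by (rule some_equality)
  moreover have "dim_col A = n" using A by simp
  ultimately show "least_squares A b = P *\<^sub>v b"
    by (simp add: least_squares_def F_def[abs_def] z_def)
qed

text \<open>
  The two-sided comparison of squared norms at accuracy \<open>1/100\<close>; the accuracy is chosen so that a
  conjugate gradient step leaves at most the fraction \<open>1 - (99/101)\<^sup>2 \<le> 1/25\<close> of the energy of the
  error.
\<close>

definition norm_close :: "rmat \<Rightarrow> rmat \<Rightarrow> bool" where
  "norm_close A X \<longleftrightarrow> (\<forall>y\<in>carrier_vec (dim_col X).
     99 / 100 * (sqnorm (X *\<^sub>v y)) \<le> sqnorm (A *\<^sub>v y) \<and>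
     sqnorm (A *\<^sub>v y) \<le> 101 / 100 * (sqnorm (X *\<^sub>v y)))"

lemma embeds_norm_close: "embeds (1 / 100) S X \<Longrightarrow> norm_close (S * X) X"
  unfolding embeds_def norm_close_def abs_le_iff by (intro ballI conjI; drule (1) bspec; linarith)

lemma norm_close_refl: "norm_close X X"
  by (simp add: norm_close_def scalar_prod_self_nonneg)

lemma norm_close_inj:
  assumes X: "X \<in> carrier_mat N d" "inj_mat X" and A: "A \<in> carrier_mat m d" "norm_close A X"
  shows "inj_mat A"
  unfolding inj_mat_def
proof (intro ballI impI)
  fix x assume x: "x \<in> carrier_vec (dim_col A)" "A *\<^sub>v x = 0\<^sub>v (dim_row A)"
  then have xd: "x \<in> carrier_vec d" using A by simp
  have "sqnorm (A *\<^sub>v x) = 0" using x by simp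
  then have "99 / 100 * (sqnorm (X *\<^sub>v x)) \<le> 0"
    using A(2) X(1) xd by (auto simp: norm_close_def)
  then have "sqnorm (X *\<^sub>v x) = 0"
    using scalar_prod_self_nonneg[of "X *\<^sub>v x"] by simp
  then have "X *\<^sub>v x = 0\<^sub>v N"
    using scalar_prod_self_eq_0[of "X *\<^sub>v x" N] X(1) xd by simp
  then show "x = 0\<^sub>v (dim_col A)"
    using inj_matD[OF X(2,1) xd] A by simp
qed

text \<open>
  In the norm of \<open>A\<close> the squared error contracts by \<open>1/25\<close> per step. Changing to the norm of \<open>X\<close>
  costs one factor \<open>101/99\<close>, which a single step pays for, since \<open>101/99 * 1/25 \<le> 1/16\<close>; for \<open>A = X\<close>
  there is no such cost and the stage may be empty.
\<close>

lemma pcg_stage: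
  assumes X: "X \<in> carrier_mat N d" "inj_mat X"
    and A: "A \<in> carrier_mat m d" "norm_close A X" and G: "G \<in> carrier_mat r d" "norm_close G X"
    and b: "b \<in> carrier_vec m" and x: "x \<in> carrier_vec d" and k: "A = X \<or> 1 \<le> k"
  defines "M \<equiv> transpose_mat G * G"
  shows "pcg A b M x k \<in> carrier_vec d"
    and "vnorm (X *\<^sub>v (pcg A b M x k - least_squares A b))
      \<le> (1 / 4) ^ k * vnorm (X *\<^sub>v (x - least_squares A b))"
proof -
  define nX where "nX y = sqnorm (X *\<^sub>v y)" for y
  define nA where "nA y = sqnorm (A *\<^sub>v y)" for y
  define z where "z = least_squares A b"
  have injA: "inj_mat A" and injG: "inj_mat G"
    using norm_close_inj[OF X A] norm_close_inj[OF X G] by auto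
  note sol = normal_equation_solution[OF A(1) injA b]
  have z: "z \<in> carrier_vec d" "(transpose_mat A * A) *\<^sub>v z = transpose_mat A *\<^sub>v b"
    using sol A b by (auto simp: z_def)
  have bnd: "99 / 100 * nX y \<le> nA y" "nA y \<le> 101 / 100 * nX y"
    "99 / 100 * nX y \<le> y \<bullet> (M *\<^sub>v y)" "y \<bullet> (M *\<^sub>v y) \<le> 101 / 100 * nX y"
    if "y \<in> carrier_vec d" for y
    using that A(2) G(2) X(1) gram_form[OF G(1) that] by (auto simp: norm_close_def nX_def nA_def M_def)
  have M: "spd_mat d M" unfolding M_def by (rule gram_spd[OF G(1) injG])
  have lo: "99 / 101 * (y \<bullet> (M *\<^sub>v y)) \<le> sqnorm (A *\<^sub>v y)" if "y \<in> carrier_vec d" for y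
    using bnd[OF that] by (simp add: nA_def)
  have hi: "sqnorm (A *\<^sub>v y) \<le> 101 / 99 * (y \<bullet> (M *\<^sub>v y))" if "y \<in> carrier_vec d" for y
    using bnd[OF that] by (simp add: nA_def)
  define u where "u = pcg A b M x k"
  show pcg: "pcg A b M x k \<in> carrier_vec d"
    by (rule pcg_contraction(1)[OF A(1) injA b M x z _ lo hi]) simp_all
  then have u: "u \<in> carrier_vec d" by (simp add: u_def)
  have "nA (u - z) \<le> (1 - 99 / 101 / (101 / 99)) ^ k * nA (x - z)"
    using pcg_contraction(2)[OF A(1) injA b M x z _ lo hi, of k] by (simp add: nA_def u_def)
  also have "\<dots> \<le> (1 / 25) ^ k * nA (x - z)"
    by (intro mult_right_mono power_mono) (auto simp: nA_def scalar_prod_self_nonneg)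
  finally have contr: "nA (u - z) \<le> (1 / 25) ^ k * nA (x - z)" .
  have nX0: "0 \<le> nX y" for y by (simp add: nX_def scalar_prod_self_nonneg)
  have pow: "(1 / 25) ^ k \<le> (1 / 16 :: real) ^ k"
    by (intro power_mono) auto
  have "nX (u - z) \<le> (1 / 16) ^ k * nX (x - z)"
    using k
  proof
    assume "A = X"
    then have "nX (u - z) \<le> (1 / 25) ^ k * nX (x - z)" using contr by (simp add: nA_def nX_def)
    also have "\<dots> \<le> (1 / 16) ^ k * nX (x - z)" using pow nX0 by (rule mult_right_mono)
    finally show ?thesis .
  next
    assume "1 \<le> k"
    then obtain j where j: "k = Suc j" by (cases k) auto
    have "99 / 100 * nX (u - z) \<le> (1 / 25) ^ k * nA (x - z)"
      using bnd(1)[of "u - z"] contr u z by simp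
    also have "\<dots> \<le> (1 / 25) ^ k * (101 / 100 * nX (x - z))"
      using bnd(2)[of "x - z"] x z by (intro mult_left_mono) auto
    finally have "nX (u - z) \<le> (101 / 99 * (1 / 25) ^ k) * nX (x - z)" by simp
    also have "\<dots> \<le> (1 / 16) ^ k * nX (x - z)"
    proof (rule mult_right_mono[OF _ nX0])
      have "(1 / 25) ^ j \<le> (1 / 16 :: real) ^ j" by (intro power_mono) auto
      moreover have "0 < (1 / 25 :: real) ^ j" by simp
      ultimately show "101 / 99 * (1 / 25) ^ k \<le> (1 / 16 :: real) ^ k"
        unfolding j power_Suc by linarith
    qed
    finally show ?thesis .
  qed
  then have "sqrt (nX (u - z)) \<le> sqrt ((1 / 16) ^ k * nX (x - z))"
    by (rule real_sqrt_le_mono)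
  also have "\<dots> = (1 / 4) ^ k * sqrt (nX (x - z))"
  proof -
    have "(1 / 16 :: real) = (1 / 4)\<^sup>2" by (simp add: power2_eq_square)
    then have "(1 / 16 :: real) ^ k = ((1 / 4) ^ k)\<^sup>2" by (simp only: power_mult[symmetric] mult.commute)
    then show ?thesis by (simp add: real_sqrt_mult)
  qed
  finally show "vnorm (X *\<^sub>v (pcg A b M x k - least_squares A b))
      \<le> (1 / 4) ^ k * vnorm (X *\<^sub>v (x - least_squares A b))"
    by (simp add: vnorm_def nX_def u_def z_def)
qed

lemma stage_end_mono: "i \<le> j \<Longrightarrow> stage_end a i \<le> stage_end a j"
  unfolding stage_end_def by (intro sum_mono2) auto

lemma stage_end_Suc: "stage_end a (Suc i) = stage_end a i + a (Suc i)"
  by (simp add: stage_end_def)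

lemma unroll_stages:
  fixes e D :: "nat \<Rightarrow> real" and \<theta> :: real
  assumes "0 \<le> \<theta>"
    and step: "\<And>i. i < K \<Longrightarrow> e (Suc i) \<le> \<theta> ^ a (Suc i) * e i + (1 + \<theta> ^ a (Suc i)) * D (Suc i)"
  shows "j \<le> K \<Longrightarrow> e j \<le> \<theta> ^ stage_end a j * e 0
    + (\<Sum>i = 1..j. (1 + \<theta> ^ a i) * \<theta> ^ (stage_end a j - stage_end a i) * D i)"
proof (induction j)
  case 0
  then show ?case by (simp add: stage_end_def)
next
  case (Suc j)
  let ?b = "a (Suc j)"
  have shift: "\<theta> ^ ?b * \<theta> ^ (stage_end a j - stage_end a i) = \<theta> ^ (stage_end a (Suc j) - stage_end a i)"
    if "i \<le> j" for i
    using stage_end_mono[OF that, of a] by (simp add: stage_end_Suc add.commute flip: power_add)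
  have "e (Suc j) \<le> \<theta> ^ ?b * e j + (1 + \<theta> ^ ?b) * D (Suc j)"
    using Suc.prems by (intro step) simp
  also have "\<dots> \<le> \<theta> ^ ?b * (\<theta> ^ stage_end a j * e 0
      + (\<Sum>i = 1..j. (1 + \<theta> ^ a i) * \<theta> ^ (stage_end a j - stage_end a i) * D i)) + (1 + \<theta> ^ ?b) * D (Suc j)"
    using Suc assms(1) by (intro add_right_mono mult_left_mono) auto
  also have "\<dots> = \<theta> ^ stage_end a (Suc j) * e 0
      + (\<Sum>i = 1..j. (1 + \<theta> ^ a i) * (\<theta> ^ ?b * \<theta> ^ (stage_end a j - stage_end a i)) * D i)
      + (1 + \<theta> ^ ?b) * D (Suc j)"
    by (simp add: stage_end_Suc power_add distrib_left sum_distrib_left mult_ac)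
  also have "(\<Sum>i = 1..j. (1 + \<theta> ^ a i) * (\<theta> ^ ?b * \<theta> ^ (stage_end a j - stage_end a i)) * D i)
      = (\<Sum>i = 1..j. (1 + \<theta> ^ a i) * \<theta> ^ (stage_end a (Suc j) - stage_end a i) * D i)"
    by (intro sum.cong refl) (simp only: shift atLeastAtMost_iff)
  finally show ?case by simp
qed

text \<open>
  Appending a stage of length \<open>b \<ge> 1\<close> multiplies the earlier weights by \<open>4\<^bsup>-b\<^esup>\<close> and adds the weight
  \<open>1 + 4\<^bsup>-b\<^esup>\<close>. The bound \<open>5/3\<close> is the fixed point of \<open>w \<mapsto> (w + 1)/4 + 1\<close>.
\<close>

lemma stage_weights_sum:
  assumes "\<And>i. i \<in> {1..K} \<Longrightarrow> 1 \<le> a i"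
  shows "(\<Sum>i = 1..K. (1 + (1 / 4 :: real) ^ a i) * (1 / 4) ^ (stage_end a K - stage_end a i)) \<le> 5 / 3"
  using assms
proof (induction K)
  case (Suc K)
  let ?b = "a (Suc K)"
  have b: "(1 / 4 :: real) ^ ?b \<le> 1 / 4"
    using Suc.prems[of "Suc K"] power_decreasing[of 1 ?b "1 / 4 :: real"] by simp
  have "(\<Sum>i = 1..K. (1 + (1 / 4 :: real) ^ a i) * (1 / 4) ^ (stage_end a (Suc K) - stage_end a i))
      = (1 / 4) ^ ?b * (\<Sum>i = 1..K. (1 + (1 / 4) ^ a i) * (1 / 4) ^ (stage_end a K - stage_end a i))"
    unfolding sum_distrib_left
  proof (intro sum.cong refl)
    fix i assume "i \<in> {1..K}"
    then have "stage_end a (Suc K) - stage_end a i = ?b + (stage_end a K - stage_end a i)"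
      using stage_end_mono[of i K a] by (simp add: stage_end_Suc)
    then show "(1 + (1 / 4 :: real) ^ a i) * (1 / 4) ^ (stage_end a (Suc K) - stage_end a i)
        = (1 / 4) ^ ?b * ((1 + (1 / 4) ^ a i) * (1 / 4) ^ (stage_end a K - stage_end a i))"
      by (simp only: power_add mult_ac)
  qed
  also have "\<dots> \<le> (1 / 4) ^ ?b * (5 / 3)"
    using Suc by (intro mult_left_mono) auto
  finally show ?case using b by simp
qed simp

text \<open>
  For each fixed response. If an iterate contracts the distance to \<open>w\<close> by \<open>c\<close>, its distance to \<open>\<beta>\<close>
  is at most \<open>c\<close> times the previous distance to \<open>\<beta>\<close> plus \<open>1 + c\<close> times the distance from \<open>w\<close> to \<open>\<beta>\<close>;
  this is applied with the minimiser of each stage as \<open>w\<close>, and finally with ordinary least squares.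
\<close>

lemma spcg_pointwise:
  assumes X: "X \<in> carrier_mat N d" "inj_mat X"
    and S: "\<And>i. i \<in> {1..K} \<Longrightarrow> S i \<in> carrier_mat (m i) N \<and> norm_close (S i * X) X"
    and R: "R \<in> carrier_mat r N" "norm_close (R * X) X"
    and a: "\<And>i. i \<in> {1..K} \<Longrightarrow> 1 \<le> a i" and T: "stage_end a K \<le> T"
    and Y: "Y \<in> carrier_vec N" and \<beta>: "\<beta> \<in> carrier_vec d" "\<beta>0 \<in> carrier_vec d"
  defines "s \<equiv> T - stage_end a K" and "\<theta> \<equiv> 1 / 4 :: real"
  shows "vnorm (X *\<^sub>v (spcg K X Y S R a \<beta>0 T - \<beta>))
    \<le> \<theta> ^ T * vnorm (X *\<^sub>v (\<beta>0 - \<beta>))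
      + (\<Sum>i = 1..K. (1 + \<theta> ^ a i) * \<theta> ^ (T - stage_end a i)
          * vnorm (X *\<^sub>v (least_squares (S i * X) (S i *\<^sub>v Y) - \<beta>)))
      + (1 + \<theta> ^ s) * vnorm (X *\<^sub>v (ols X Y - \<beta>))"
proof -
  define M where "M = transpose_mat (R * X) * (R * X)"
  define x where "x = spcg_stage1 X Y S M a \<beta>0"
  define z where "z i = least_squares (S i * X) (S i *\<^sub>v Y)" for i
  define e where "e i = vnorm (X *\<^sub>v (x i - \<beta>))" for i
  define D where "D i = vnorm (X *\<^sub>v (z i - \<beta>))" for i
  have RX: "R * X \<in> carrier_mat r d" using R(1) X(1) by (rule mult_carrier_mat)
  have combine: "vnorm (X *\<^sub>v (u - \<beta>)) \<le> c * vnorm (X *\<^sub>v (v - \<beta>)) + (1 + c) * vnorm (X *\<^sub>v (w - \<beta>))"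
    if u: "u \<in> carrier_vec d" and v: "v \<in> carrier_vec d" and w: "w \<in> carrier_vec d" and c: "0 \<le> c"
      and le: "vnorm (X *\<^sub>v (u - w)) \<le> c * vnorm (X *\<^sub>v (v - w))" for u v w c
  proof -
    have Xw: "X *\<^sub>v (\<beta> - w) = X *\<^sub>v \<beta> - X *\<^sub>v w" "X *\<^sub>v (w - \<beta>) = X *\<^sub>v w - X *\<^sub>v \<beta>"
      using X(1) \<beta> w by (auto intro!: mult_minus_distrib_mat_vec)
    have "vnorm (X *\<^sub>v (v - w)) \<le> vnorm (X *\<^sub>v (v - \<beta>)) + vnorm (X *\<^sub>v (\<beta> - w))"
      using X(1) v \<beta>(1) w by (rule pred_triangle)
    also have "vnorm (X *\<^sub>v (\<beta> - w)) = vnorm (X *\<^sub>v (w - \<beta>))"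
      unfolding Xw using X(1) \<beta> w by (intro vnorm_minus_commute[of _ N]) auto
    finally have "c * vnorm (X *\<^sub>v (v - w)) \<le> c * (vnorm (X *\<^sub>v (v - \<beta>)) + vnorm (X *\<^sub>v (w - \<beta>)))"
      using c by (rule mult_left_mono)
    then show ?thesis
      using pred_triangle[OF X(1) u w \<beta>(1)] le by (simp add: algebra_simps)
  qed
  have zc: "z i \<in> carrier_vec d \<and> S i * X \<in> carrier_mat (m i) d \<and> S i *\<^sub>v Y \<in> carrier_vec (m i)"
    if "i \<in> {1..K}" for i
  proof -
    have Si: "S i \<in> carrier_mat (m i) N" "norm_close (S i * X) X" using S[OF that] by auto
    have SX: "S i * X \<in> carrier_mat (m i) d" using Si(1) X(1) by (rule mult_carrier_mat)
    have SY: "S i *\<^sub>v Y \<in> carrier_vec (m i)" using Si(1) Y by simp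
    note sol = normal_equation_solution[OF SX norm_close_inj[OF X SX Si(2)] SY]
    have "z i \<in> carrier_vec d"
      unfolding z_def sol(4) using sol(1) SY by (rule mult_mat_vec_carrier)
    with SX SY show ?thesis by blast
  qed
  have stage: "x (Suc i) \<in> carrier_vec d \<and> e (Suc i) \<le> \<theta> ^ a (Suc i) * e i + (1 + \<theta> ^ a (Suc i)) * D (Suc i)"
    if i: "i < K" and xi: "x i \<in> carrier_vec d" for i
  proof -
    have I: "Suc i \<in> {1..K}" using i by simp
    have k: "S (Suc i) * X = X \<or> 1 \<le> a (Suc i)" using a[OF I] by simp
    have xS: "x (Suc i) = pcg (S (Suc i) * X) (S (Suc i) *\<^sub>v Y) M (x i) (a (Suc i))"
      by (simp add: x_def)
    from zc[OF I] have zi: "z (Suc i) \<in> carrier_vec d"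
      and SX: "S (Suc i) * X \<in> carrier_mat (m (Suc i)) d" and SY: "S (Suc i) *\<^sub>v Y \<in> carrier_vec (m (Suc i))"
      by simp_all
    from S[OF I] have nr: "norm_close (S (Suc i) * X) X" by simp
    note st = pcg_stage[OF X SX nr RX R(2) SY xi k, folded M_def, folded xS z_def]
    note xc = st(1)
    have le: "vnorm (X *\<^sub>v (x (Suc i) - z (Suc i))) \<le> \<theta> ^ a (Suc i) * vnorm (X *\<^sub>v (x i - z (Suc i)))"
      unfolding \<theta>_def by (rule st(2))
    have "0 \<le> \<theta> ^ a (Suc i)" by (simp add: \<theta>_def)
    from combine[OF xc xi zi this le] show ?thesis
      unfolding e_def D_def using xc by blast
  qed
  have xc: "x i \<in> carrier_vec d" if "i \<le> K" for i
    using that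
  proof (induction i)
    case 0
    then show ?case using \<beta> by (simp add: x_def)
  next
    case (Suc i)
    then show ?case using stage[of i] by simp
  qed
  have eK: "e K \<le> \<theta> ^ stage_end a K * e 0
      + (\<Sum>i = 1..K. (1 + \<theta> ^ a i) * \<theta> ^ (stage_end a K - stage_end a i) * D i)"
    using stage xc by (intro unroll_stages[of \<theta> K e a D K]) (auto simp: \<theta>_def)
  note ols_sol = normal_equation_solution[OF X Y]
  have ols: "ols X Y = least_squares X Y"
    unfolding ols_def ols_sol(2,4) ..
  have ols_c: "ols X Y \<in> carrier_vec d"
    unfolding ols ols_sol(4) using ols_sol(1) Y by (rule mult_mat_vec_carrier)
  have fin: "spcg K X Y S R a \<beta>0 T = pcg X Y M (x K) s"
    by (simp add: spcg_def Let_def M_def x_def s_def)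
  have "vnorm (X *\<^sub>v (spcg K X Y S R a \<beta>0 T - \<beta>))
      \<le> \<theta> ^ s * e K + (1 + \<theta> ^ s) * vnorm (X *\<^sub>v (ols X Y - \<beta>))"
    unfolding e_def fin
  proof (rule combine)
    note st = pcg_stage[OF X X(1) norm_close_refl RX R(2) Y xc[OF order_refl], of s, folded M_def ols]
    show "pcg X Y M (x K) s \<in> carrier_vec d" by (rule st(1)) simp
    show "vnorm (X *\<^sub>v (pcg X Y M (x K) s - ols X Y)) \<le> \<theta> ^ s * vnorm (X *\<^sub>v (x K - ols X Y))"
      unfolding \<theta>_def by (rule st(2)) simp
  qed (use xc ols_c in \<open>auto simp: \<theta>_def\<close>)
  also have "\<theta> ^ s * e K \<le> \<theta> ^ s * (\<theta> ^ stage_end a K * e 0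
      + (\<Sum>i = 1..K. (1 + \<theta> ^ a i) * \<theta> ^ (stage_end a K - stage_end a i) * D i))"
    using eK by (intro mult_left_mono) (auto simp: \<theta>_def)
  also have "\<dots> = \<theta> ^ T * e 0 + (\<Sum>i = 1..K. (1 + \<theta> ^ a i) * \<theta> ^ (T - stage_end a i) * D i)"
  proof -
    have pw: "\<theta> ^ s * \<theta> ^ (stage_end a K - stage_end a i) = \<theta> ^ (T - stage_end a i)" if "i \<in> {1..K}" for i
      using T stage_end_mono[of i K a] that by (simp add: s_def flip: power_add)
    have "\<theta> ^ s * (\<Sum>i = 1..K. (1 + \<theta> ^ a i) * \<theta> ^ (stage_end a K - stage_end a i) * D i)
        = (\<Sum>i = 1..K. (1 + \<theta> ^ a i) * (\<theta> ^ s * \<theta> ^ (stage_end a K - stage_end a i)) * D i)"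
      by (simp add: sum_distrib_left mult_ac)
    also have "\<dots> = (\<Sum>i = 1..K. (1 + \<theta> ^ a i) * \<theta> ^ (T - stage_end a i) * D i)"
      by (intro sum.cong refl) (simp only: pw)
    finally have "\<theta> ^ s * (\<Sum>i = 1..K. (1 + \<theta> ^ a i) * \<theta> ^ (stage_end a K - stage_end a i) * D i)
        = (\<Sum>i = 1..K. (1 + \<theta> ^ a i) * \<theta> ^ (T - stage_end a i) * D i)" .
    moreover have "\<theta> ^ s * \<theta> ^ stage_end a K = \<theta> ^ T"
      using T by (simp add: s_def flip: power_add)
    ultimately show ?thesis by (simp add: distrib_left flip: mult.assoc)
  qed
  finally show ?thesis
    by (simp add: e_def D_def z_def x_def)
qed

section \<open>Averaging over the noise and over the sketches\<close>

lemma integrable_vnorm: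
  assumes v: "\<And>\<zeta>. v \<zeta> \<in> carrier_vec n" and int: "\<And>j. j < n \<Longrightarrow> integrable \<mu> (\<lambda>\<zeta>. v \<zeta> $ j)"
  shows "integrable \<mu> (\<lambda>\<zeta>. vnorm (v \<zeta>))"
proof (rule Bochner_Integration.integrable_bound)
  show "integrable \<mu> (\<lambda>\<zeta>. \<Sum>j<n. \<bar>v \<zeta> $ j\<bar>)"
    using int by (intro Bochner_Integration.integrable_sum integrable_abs) auto
  have "(\<lambda>\<zeta>. v \<zeta> $ j) \<in> borel_measurable \<mu>" if "j < n" for j
    using int[OF that] by (rule borel_measurable_integrable)
  then have "(\<lambda>\<zeta>. sqrt (\<Sum>j<n. (v \<zeta> $ j)\<^sup>2)) \<in> borel_measurable \<mu>"
    by (intro measurable_compose[OF _ borel_measurable_sqrt] borel_measurable_sum borel_measurable_power) auto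
  then show "(\<lambda>\<zeta>. vnorm (v \<zeta>)) \<in> borel_measurable \<mu>"
    by (simp add: vnorm_L2_set[OF v] L2_set_def)
  show "AE \<zeta> in \<mu>. norm (vnorm (v \<zeta>)) \<le> norm (\<Sum>j<n. \<bar>v \<zeta> $ j\<bar>)"
  proof (rule AE_I2)
    fix \<zeta>
    have "vnorm (v \<zeta>) \<le> (\<Sum>j<n. \<bar>v \<zeta> $ j\<bar>)"
      unfolding vnorm_L2_set[OF v] by (rule L2_set_le_sum_abs)
    then show "norm (vnorm (v \<zeta>)) \<le> norm (\<Sum>j<n. \<bar>v \<zeta> $ j\<bar>)"
      using vnorm_nonneg[of "v \<zeta>"] by simp
  qed
qed

lemma integrable_linear_estimator:
  assumes X: "X \<in> carrier_mat N d" and P: "P \<in> carrier_mat d N" and \<beta>: "\<beta> \<in> carrier_vec d"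
    and noise: "noise_law N \<sigma> \<mu>"
  shows "integrable \<mu> (\<lambda>\<zeta>. vnorm (X *\<^sub>v (P *\<^sub>v response X \<beta> \<zeta> - \<beta>)))"
proof (rule integrable_vnorm[of _ N])
  interpret prob_space \<mu> using noise by (simp add: noise_law_def)
  have Y: "response X \<beta> \<zeta> \<in> carrier_vec N" for \<zeta>
    using X \<beta> by (auto simp: response_def)
  have PY: "P *\<^sub>v response X \<beta> \<zeta> \<in> carrier_vec d" for \<zeta>
    using P Y by (rule mult_mat_vec_carrier)
  show "X *\<^sub>v (P *\<^sub>v response X \<beta> \<zeta> - \<beta>) \<in> carrier_vec N" for \<zeta>
    using X PY \<beta> by (intro mult_mat_vec_carrier[of _ _ d]) auto
  fix j assume j: "j < N"
  define Z where "Z = X * P"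
  have Z: "Z \<in> carrier_mat N N" unfolding Z_def using X P by (rule mult_carrier_mat)
  have Xb: "X *\<^sub>v \<beta> \<in> carrier_vec N" using X \<beta> by (rule mult_mat_vec_carrier)
  have "(X *\<^sub>v (P *\<^sub>v response X \<beta> \<zeta> - \<beta>)) $ j
      = (\<Sum>k<N. Z $$ (j, k) * ((X *\<^sub>v \<beta>) $ k + \<zeta> k)) - (X *\<^sub>v \<beta>) $ j" for \<zeta>
  proof -
    have "X *\<^sub>v (P *\<^sub>v response X \<beta> \<zeta> - \<beta>) = X *\<^sub>v (P *\<^sub>v response X \<beta> \<zeta>) - X *\<^sub>v \<beta>"
      using X PY \<beta> by (rule mult_minus_distrib_mat_vec)
    also have "X *\<^sub>v (P *\<^sub>v response X \<beta> \<zeta>) = Z *\<^sub>v response X \<beta> \<zeta>"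
      unfolding Z_def by (rule assoc_mult_mat_vec[OF X P Y, symmetric])
    finally have "(X *\<^sub>v (P *\<^sub>v response X \<beta> \<zeta> - \<beta>)) $ j = (Z *\<^sub>v response X \<beta> \<zeta>) $ j - (X *\<^sub>v \<beta>) $ j"
      using carrier_matD(1)[OF X] j by (simp del: index_mult_mat_vec)
    also have "(Z *\<^sub>v response X \<beta> \<zeta>) $ j = mulv N (\<lambda>i k. Z $$ (i, k)) (($) (response X \<beta> \<zeta>)) j"
      using Z Y j by (rule mult_mat_vec_mulv)
    also have "\<dots> = (\<Sum>k<N. Z $$ (j, k) * ((X *\<^sub>v \<beta>) $ k + \<zeta> k))"
      unfolding mulv_def
    proof (intro sum.cong refl)
      fix k assume "k \<in> {..<N}"
      moreover have "dim_row X = N" using X by simp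
      ultimately show "Z $$ (j, k) * response X \<beta> \<zeta> $ k = Z $$ (j, k) * ((X *\<^sub>v \<beta>) $ k + \<zeta> k)"
        by (simp add: response_def)
    qed
    finally show ?thesis .
  qed
  then show "integrable \<mu> (\<lambda>\<zeta>. (X *\<^sub>v (P *\<^sub>v response X \<beta> \<zeta> - \<beta>)) $ j)"
  proof (simp only:, intro Bochner_Integration.integrable_diff Bochner_Integration.integrable_sum
      integrable_mult_right Bochner_Integration.integrable_add integrable_const)
    fix k assume "k \<in> {..<N}"
    then show "integrable \<mu> (\<lambda>\<zeta>. \<zeta> k)"
      using noise by (simp add: noise_law_def)
  qed
qed

text \<open>
  The integral of the left side is estimated by monotonicity from an integrable right side. Only
  the right side has to be integrable, since a nonintegrable left side has integral \<open>0\<close>; the iterate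
  depends on the response in a nonlinear way, whereas the minimisers on the right are linear in it.
\<close>

lemma pred_error_spcg:
  assumes X: "X \<in> carrier_mat N d" "inj_mat X"
    and S: "\<And>i. i \<in> {1..K} \<Longrightarrow> S i \<in> carrier_mat (m i) N \<and> norm_close (S i * X) X"
    and R: "R \<in> carrier_mat r N" "norm_close (R * X) X"
    and a: "\<And>i. i \<in> {1..K} \<Longrightarrow> 1 \<le> a i" and T: "stage_end a K \<le> T"
    and \<beta>: "\<beta> \<in> carrier_vec d" "\<beta>0 \<in> carrier_vec d" and noise: "noise_law N \<sigma> \<mu>"
  defines "s \<equiv> T - stage_end a K" and "\<theta> \<equiv> 1 / 4 :: real"
  shows "pred_error \<mu> X \<beta> (\<lambda>Y. spcg K X Y S R a \<beta>0 T)
    \<le> \<theta> ^ T * pred_error \<mu> X \<beta> (\<lambda>Y. \<beta>0)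
      + (\<Sum>i = 1..K. (1 + \<theta> ^ a i) * \<theta> ^ (T - stage_end a i)
          * pred_error \<mu> X \<beta> (\<lambda>Y. least_squares (S i * X) (S i *\<^sub>v Y)))
      + (1 + \<theta> ^ s) * pred_error \<mu> X \<beta> (ols X)"
proof -
  interpret prob_space \<mu> using noise by (simp add: noise_law_def)
  have Y: "response X \<beta> \<zeta> \<in> carrier_vec N" for \<zeta>
    using X \<beta> by (auto simp: response_def)
  let ?n = "\<lambda>b \<zeta>. vnorm (X *\<^sub>v (b (response X \<beta> \<zeta>) - \<beta>))"
  let ?ls = "\<lambda>i Y. least_squares (S i * X) (S i *\<^sub>v Y)"
  have int0: "integrable \<mu> (?n (\<lambda>Y. \<beta>0))"
    by simp
  have int_ls: "integrable \<mu> (?n (?ls i))" if "i \<in> {1..K}" for i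
  proof -
    have Si: "S i \<in> carrier_mat (m i) N" "norm_close (S i * X) X" using S[OF that] by auto
    have SX: "S i * X \<in> carrier_mat (m i) d" using Si(1) X(1) by (rule mult_carrier_mat)
    have inj: "inj_mat (S i * X)" using X SX Si(2) by (rule norm_close_inj)
    define P where "P = minv (transpose_mat (S i * X) * (S i * X)) * transpose_mat (S i * X)"
    have P: "P \<in> carrier_mat d (m i)"
      unfolding P_def using normal_equation_solution(1)[OF SX inj, of "0\<^sub>v (m i)"] by simp
    have "?ls i (response X \<beta> \<zeta>) = (P * S i) *\<^sub>v response X \<beta> \<zeta>" for \<zeta>
      using normal_equation_solution(4)[OF SX inj, of "S i *\<^sub>v response X \<beta> \<zeta>"] Si(1) Y
        assoc_mult_mat_vec[OF P Si(1) Y] by (simp add: P_def)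
    then show ?thesis
      using integrable_linear_estimator[OF X(1) mult_carrier_mat[OF P Si(1)] \<beta>(1) noise] by simp
  qed
  have int_ols: "integrable \<mu> (?n (ols X))"
  proof -
    define P where "P = minv (transpose_mat X * X) * transpose_mat X"
    have P: "P \<in> carrier_mat d N"
      unfolding P_def using normal_equation_solution(1)[OF X, of "0\<^sub>v N"] by simp
    have "ols X (response X \<beta> \<zeta>) = P *\<^sub>v response X \<beta> \<zeta>" for \<zeta>
      unfolding ols_def P_def by (rule normal_equation_solution(2)[OF X Y])
    then show ?thesis
      using integrable_linear_estimator[OF X(1) P \<beta>(1) noise] by simp
  qed
  have int_sum: "integrable \<mu> (\<lambda>\<zeta>. \<Sum>i = 1..K. (1 + \<theta> ^ a i) * \<theta> ^ (T - stage_end a i) * ?n (?ls i) \<zeta>)"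
    using int_ls by (intro Bochner_Integration.integrable_sum integrable_mult_right) auto
  let ?b = "\<lambda>\<zeta>. \<theta> ^ T * ?n (\<lambda>Y. \<beta>0) \<zeta>
      + (\<Sum>i = 1..K. (1 + \<theta> ^ a i) * \<theta> ^ (T - stage_end a i) * ?n (?ls i) \<zeta>)
      + (1 + \<theta> ^ s) * ?n (ols X) \<zeta>"
  have "pred_error \<mu> X \<beta> (\<lambda>Y. spcg K X Y S R a \<beta>0 T)
    \<le> (\<integral>\<zeta>. ?b \<zeta> \<partial>\<mu>)"
    unfolding pred_error_def
  proof (rule integral_mono')
    show "integrable \<mu> ?b"
      by (intro Bochner_Integration.integrable_add integrable_mult_right int0 int_sum int_ols)
    fix \<zeta>
    show "vnorm (X *\<^sub>v (spcg K X (response X \<beta> \<zeta>) S R a \<beta>0 T - \<beta>)) \<le> ?b \<zeta>"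
      unfolding \<theta>_def s_def using X S R a T Y \<beta> by (rule spcg_pointwise)
    show "0 \<le> ?b \<zeta>"
      unfolding \<theta>_def by (intro add_nonneg_nonneg sum_nonneg mult_nonneg_nonneg vnorm_nonneg) auto
  qed
  also have "\<dots> = \<theta> ^ T * pred_error \<mu> X \<beta> (\<lambda>Y. \<beta>0)
      + (\<Sum>i = 1..K. (1 + \<theta> ^ a i) * \<theta> ^ (T - stage_end a i) * pred_error \<mu> X \<beta> (?ls i))
      + (1 + \<theta> ^ s) * pred_error \<mu> X \<beta> (ols X)"
  proof -
    have "(\<integral>\<zeta>. (\<Sum>i = 1..K. (1 + \<theta> ^ a i) * \<theta> ^ (T - stage_end a i) * ?n (?ls i) \<zeta>) \<partial>\<mu>)
        = (\<Sum>i = 1..K. (1 + \<theta> ^ a i) * \<theta> ^ (T - stage_end a i) * pred_error \<mu> X \<beta> (?ls i))"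
      unfolding pred_error_def
      by (subst Bochner_Integration.integral_sum) (auto intro!: int_ls integrable_mult_right)
    then show ?thesis
      unfolding pred_error_def
      by (subst Bochner_Integration.integral_add Bochner_Integration.integral_add,
          (intro Bochner_Integration.integrable_add integrable_mult_right int0 int_sum int_ols)+)+ simp
  qed
  finally show ?thesis .
qed

lemma pred_error_nonneg: "0 \<le> pred_error \<mu> X \<beta> b"
  unfolding pred_error_def by (intro Bochner_Integration.integral_nonneg) (simp add: vnorm_nonneg)

lemma stage_sum_bound:
  fixes \<delta> :: "nat \<Rightarrow> real"
  assumes a: "\<And>i. i \<in> {1..K} \<Longrightarrow> 1 \<le> a i" and T: "stage_end a K \<le> T"
    and \<delta>: "\<And>i. i \<in> {1..K} \<Longrightarrow> \<delta> i \<le> C" and C: "0 \<le> C"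
  shows "(\<Sum>i = 1..K. (1 + (1 / 4) ^ a i) * (1 / 4) ^ (T - stage_end a i) * \<delta> i)
    \<le> (1 / 4) ^ (T - stage_end a K) * (5 / 3 * C)"
proof -
  let ?w = "\<lambda>i. (1 + (1 / 4 :: real) ^ a i) * (1 / 4) ^ (stage_end a K - stage_end a i)"
  have "(\<Sum>i = 1..K. (1 + (1 / 4) ^ a i) * (1 / 4) ^ (T - stage_end a i) * \<delta> i)
      \<le> (\<Sum>i = 1..K. (1 + (1 / 4) ^ a i) * (1 / 4) ^ (T - stage_end a i) * C)"
    by (intro sum_mono mult_left_mono \<delta>) auto
  also have "\<dots> = (1 / 4) ^ (T - stage_end a K) * (sum ?w {1..K} * C)"
    unfolding sum_distrib_left sum_distrib_right
  proof (intro sum.cong refl)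
    fix i assume "i \<in> {1..K}"
    then have "T - stage_end a i = (T - stage_end a K) + (stage_end a K - stage_end a i)"
      using stage_end_mono[of i K a] T by simp
    then show "(1 + (1 / 4) ^ a i) * (1 / 4) ^ (T - stage_end a i) * C = (1 / 4) ^ (T - stage_end a K) * (?w i * C)"
      by (simp only: power_add mult_ac)
  qed
  also have "\<dots> \<le> (1 / 4) ^ (T - stage_end a K) * (5 / 3 * C)"
    using stage_weights_sum[OF a] C by (intro mult_left_mono mult_right_mono) auto
  finally show ?thesis .
qed

lemma nested_srht_marginal:
  assumes "nested_index_law (2 ^ p) K m Q" "i \<in> {1..K}"
  shows "map_pmf (\<lambda>S. S i) (nested_srht_pmf p m Q) = srht_pmf p (m i)"
proof -
  have "index_pmf (2 ^ p) (m i) = map_pmf (\<lambda>I. I i) Q"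
    using assms by (simp add: nested_index_law_def)
  then show ?thesis
    unfolding nested_srht_pmf_def srht_pmf_def
    by (simp add: pair_map_pmf2 pmf.map_comp o_def case_prod_unfold apsnd_def map_prod_def)
qed

lemma srht_pmf_carrier:
  assumes "S \<in> set_pmf (srht_pmf p m)" "m \<le> 2 ^ p"
  shows "S \<in> carrier_mat m (2 ^ p)"
proof -
  let ?sets = "{I. I \<subseteq> {..<(2::nat) ^ p} \<and> card I = m}"
  have "finite ?sets" by (rule finite_subset[of _ "Pow {..<2 ^ p}"]) auto
  moreover have "{..<m} \<in> ?sets" using assms(2) by auto
  then have "?sets \<noteq> {}" by blast
  ultimately have "set_pmf (index_pmf (2 ^ p) m) = ?sets"
    unfolding index_pmf_def by simp
  then show ?thesis
    using assms(1) srht_carrier by (auto simp: srht_pmf_def)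
qed

text \<open>
  Distributing the failure probability over \<open>K\<close> sketches enlarges each logarithm by \<open>ln K\<close>, hence,
  as both factors are at least \<open>1\<close>, by a factor of at most \<open>1 + ln K\<close>.
\<close>

lemma sketch_size_split:
  fixes d N \<delta> :: real and K :: nat
  assumes "1 \<le> K" "1 \<le> d" "1 \<le> N" "0 < \<delta>" "\<delta> < 1"
  shows "(d + ln (N / (\<delta> / K))) * ln (exp 1 * d / (\<delta> / K))
    \<le> (1 + ln K)\<^sup>2 * ((d + ln (N / \<delta>)) * ln (exp 1 * d / \<delta>))"
proof -
  have K: "0 \<le> ln (real K)" using assms(1) by simp
  have 0: "0 \<le> ln (N / \<delta>)" "0 \<le> ln (d / \<delta>)"
    using assms by (auto intro!: ln_ge_zero simp: field_simps)
  have eq: "ln (N / (\<delta> / K)) = ln (N / \<delta>) + ln K" "ln (exp 1 * d / (\<delta> / K)) = ln (exp 1 * d / \<delta>) + ln K"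
    "ln (exp 1 * d / \<delta>) = 1 + ln (d / \<delta>)"
    using assms by (simp_all add: ln_div ln_mult)
  have le: "x + ln K \<le> (1 + ln K) * x" if "1 \<le> x" for x
    using mult_left_mono[OF that K] by (simp add: algebra_simps)
  have "(d + ln (N / (\<delta> / K))) * ln (exp 1 * d / (\<delta> / K))
      \<le> ((1 + ln K) * (d + ln (N / \<delta>))) * ((1 + ln K) * ln (exp 1 * d / \<delta>))"
    using le[of "d + ln (N / \<delta>)"] le[of "ln (exp 1 * d / \<delta>)"] 0 K assms
    unfolding eq by (intro mult_mono) auto
  then show ?thesis by (simp only: power2_eq_square mult_ac)
qed

text \<open>
  The constant combines the embedding constant with the loss from sharing the failure probability
  among the \<open>K\<close> nested sketches. Each of these has at least \<open>m 1 > r\<close> rows, so that the lower bound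
  on \<open>r\<close> serves all of them.
\<close>

theorem theorem3p2:
  fixes K :: nat
  assumes "K \<ge> 1"
  shows "\<exists>c::real. c > 0 \<and>
    (\<forall>(p::nat) (N::nat) (d::nat) (r::nat) (m::nat \<Rightarrow> nat) (Q::(nat \<Rightarrow> nat set) pmf)
       (\<epsilon>::real) (\<delta>::real) (a::nat \<Rightarrow> nat) (X::rmat) (\<beta>::rvec) (\<sigma>::real)
       (\<mu>::(nat \<Rightarrow> real) measure) (T::nat) (\<beta>\<^sub>0::rvec).
       N = 2 ^ p \<and> (\<exists>q. m 1 = 2 ^ q) \<and>
       1 \<le> d \<and> d < m 1 \<and> (\<forall>i\<in>{1..<K}. m (Suc i) = 2 * m i) \<and> m K < N \<and>
       nested_index_law N K m Q \<and>
       X \<in> carrier_mat N d \<and> full_column_rank X \<and> \<beta> \<in> carrier_vec d \<and> noise_law N \<sigma> \<mu> \<and>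
       0 < \<epsilon> \<and> \<epsilon> < 1 / 9 \<and> 0 < \<delta> \<and> \<delta> < 1 \<and> (\<forall>i\<in>{1..K}. a i \<ge> 1) \<and>
       real r \<ge> c * (1 / \<epsilon>\<^sup>2) * (real d + ln (real N / \<delta>)) * ln (exp 1 * real d / \<delta>) \<and>
       m 1 > r \<and> T \<ge> stage_end a K \<and> \<beta>\<^sub>0 \<in> carrier_vec d
       \<longrightarrow>
       (let \<theta> = 1 / 4 :: real;
            s = T - stage_end a K;
            \<delta>\<^sub>O\<^sub>L\<^sub>S = pred_error \<mu> X \<beta> (ols X);
            \<delta>\<^sub>S = (\<lambda>S i. pred_error \<mu> X \<beta> (\<lambda>Y. least_squares (S i * X) (S i *\<^sub>v Y)));
            err\<^sub>0 = pred_error \<mu> X \<beta> (\<lambda>Y. \<beta>\<^sub>0);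
            err\<^sub>T = (\<lambda>S R. pred_error \<mu> X \<beta> (\<lambda>Y. spcg K X Y S R a \<beta>\<^sub>0 T))
        in measure_pmf.prob (pair_pmf (nested_srht_pmf p m Q) (srht_pmf p r))
             {(S, R). well_posed K X S R \<and>
                err\<^sub>T S R \<le> \<theta> ^ T * err\<^sub>0
                  + (\<Sum>i = 1..K. (1 + \<theta> ^ a i) * \<theta> ^ (T - stage_end a i) * \<delta>\<^sub>S S i)
                  + (1 + \<theta> ^ s) * \<delta>\<^sub>O\<^sub>L\<^sub>S \<and>
                (\<forall>C>0. (\<forall>i\<in>{1..K}. \<delta>\<^sub>S S i \<le> C * \<delta>\<^sub>O\<^sub>L\<^sub>S) \<longrightarrow>
                   err\<^sub>T S R \<le> \<theta> ^ T * err\<^sub>0 + (1 + \<theta> ^ s * (1 + 5 / 3 * C)) * \<delta>\<^sub>O\<^sub>L\<^sub>S)}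
           \<ge> 1 - 2 * \<delta>))"
proof (unfold Let_def, intro exI conjI allI impI)
  let ?c = "2 * 10 ^ 7 * (1 + ln (real K))\<^sup>2"
  have lnK: "0 \<le> ln (real K)" using assms by simp
  then show "0 < ?c" by (simp add: add_pos_nonneg)
  fix p N d r :: nat and m :: "nat \<Rightarrow> nat" and Q :: "(nat \<Rightarrow> nat set) pmf" and \<epsilon> \<delta> :: real
    and a :: "nat \<Rightarrow> nat" and X :: rmat and \<beta> :: rvec and \<sigma> :: real
    and \<mu> :: "(nat \<Rightarrow> real) measure" and T :: nat and \<beta>\<^sub>0 :: rvec
  assume H: "N = 2 ^ p \<and> (\<exists>q. m 1 = 2 ^ q) \<and>
       1 \<le> d \<and> d < m 1 \<and> (\<forall>i\<in>{1..<K}. m (Suc i) = 2 * m i) \<and> m K < N \<and>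
       nested_index_law N K m Q \<and>
       X \<in> carrier_mat N d \<and> full_column_rank X \<and> \<beta> \<in> carrier_vec d \<and> noise_law N \<sigma> \<mu> \<and>
       0 < \<epsilon> \<and> \<epsilon> < 1 / 9 \<and> 0 < \<delta> \<and> \<delta> < 1 \<and> (\<forall>i\<in>{1..K}. a i \<ge> 1) \<and>
       real r \<ge> ?c * (1 / \<epsilon>\<^sup>2) * (real d + ln (real N / \<delta>)) * ln (exp 1 * real d / \<delta>) \<and>
       m 1 > r \<and> T \<ge> stage_end a K \<and> \<beta>\<^sub>0 \<in> carrier_vec d"
  then have N: "N = 2 ^ p" and d: "1 \<le> d" and mK: "m K < N" and law: "nested_index_law N K m Q"
    and X: "X \<in> carrier_mat N d" and rank: "full_column_rank X" and \<beta>: "\<beta> \<in> carrier_vec d" "\<beta>\<^sub>0 \<in> carrier_vec d"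
    and noise: "noise_law N \<sigma> \<mu>" and \<epsilon>: "0 < \<epsilon>" "\<epsilon> < 1 / 9" and \<delta>: "0 < \<delta>" "\<delta> < 1"
    and a: "\<And>i. i \<in> {1..K} \<Longrightarrow> 1 \<le> a i"
    and r: "?c * (1 / \<epsilon>\<^sup>2) * (real d + ln (real N / \<delta>)) * ln (exp 1 * real d / \<delta>) \<le> real r"
    and rm: "r < m 1" and T: "stage_end a K \<le> T"
    by auto
  from H have double: "m (Suc i) = 2 * m i" if "i \<in> {1..<K}" for i
    using that by blast
  have inj: "inj_mat X" using rank full_column_rank_iff[OF X] by simp

  have m_mono: "m i \<le> m j" if "1 \<le> i" "i \<le> j" "j \<le> K" for i j
    using that(2,3)
  proof (induction j rule: dec_induct)
    case (step n)
    then show ?case using double[of n] that(1) by auto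
  qed simp
  have m_range: "r < m i" "m i \<le> 2 ^ p" if "i \<in> {1..K}" for i
    using m_mono[of 1 i] m_mono[of i K] that rm mK N by auto
  have r_le: "r \<le> 2 ^ p" using m_range[of 1] assms by auto

  let ?g = "(real d + ln (real N / \<delta>)) * ln (exp 1 * real d / \<delta>)"
  have lnN: "0 \<le> ln (real N / \<delta>)" and lnd: "0 \<le> ln (exp 1 * real d / \<delta>)"
  proof -
    have "1 \<le> real N" using N by simp
    then have "1 \<le> real N / \<delta>" using \<delta> by (simp add: field_simps)
    then show "0 \<le> ln (real N / \<delta>)" by simp
    have "1 * \<delta> \<le> exp 1 * real d" using \<delta> d by (intro mult_mono) auto
    then show "0 \<le> ln (exp 1 * real d / \<delta>)" using \<delta> by (intro ln_ge_zero) (simp add: field_simps)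
  qed
  have g0: "0 \<le> ?g" using lnN lnd by simp
  have "\<epsilon>\<^sup>2 \<le> 1" using \<epsilon> by (simp add: power_le_one)
  then have eps: "1 \<le> 1 / \<epsilon>\<^sup>2" using \<epsilon> by (simp add: field_simps)
  have "?c * ?g * 1 \<le> ?c * ?g * (1 / \<epsilon>\<^sup>2)"
    using eps g0 by (intro mult_left_mono) auto
  then have r_large: "?c * ?g \<le> r"
    using r by (simp add: mult_ac)

  have size_m: "2 * 10 ^ 7 * (real d + ln (2 ^ p / (\<delta> / K))) * ln (exp 1 * real d / (\<delta> / K)) \<le> real (m i)"
    if "i \<in> {1..K}" for i
  proof -
    have "(real d + ln (real N / (\<delta> / K))) * ln (exp 1 * real d / (\<delta> / K)) \<le> (1 + ln K)\<^sup>2 * ?g"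
      using sketch_size_split[of K "real d" "real N" \<delta>] assms d \<delta> N by simp
    then have "2 * 10 ^ 7 * ((real d + ln (real N / (\<delta> / K))) * ln (exp 1 * real d / (\<delta> / K)))
        \<le> 2 * 10 ^ 7 * ((1 + ln K)\<^sup>2 * ?g)"
      by (rule mult_left_mono) simp
    also have "\<dots> \<le> r" using r_large by (simp only: mult_ac)
    also have "\<dots> \<le> m i" using m_range(1)[OF that] by simp
    finally show ?thesis by (simp add: N mult_ac)
  qed
  have size_r: "2 * 10 ^ 7 * (real d + ln (2 ^ p / \<delta>)) * ln (exp 1 * real d / \<delta>) \<le> real r"
  proof -
    have "1 \<le> (1 + ln (real K))\<^sup>2" using lnK by (simp add: one_le_power)
    then have "2 * 10 ^ 7 * ?g * 1 \<le> 2 * 10 ^ 7 * ?g * (1 + ln (real K))\<^sup>2"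
      using g0 by (intro mult_left_mono) auto
    then show ?thesis using r_large by (simp add: N mult_ac)
  qed

  let ?A = "nested_srht_pmf p m Q" and ?B = "srht_pmf p r"
  let ?\<Omega> = "pair_pmf ?A ?B"
  define good where "good = {(S, R). (\<forall>i\<in>{1..K}. embeds (1 / 100) (S i) X) \<and> embeds (1 / 100) R X}"
  have marg: "map_pmf (\<lambda>S. S i) ?A = srht_pmf p (m i)" if "i \<in> {1..K}" for i
    using law N that by (intro nested_srht_marginal) auto
  have fail_S: "measure_pmf.prob ?\<Omega> {(S, R). \<not> embeds (1 / 100) (S i) X} \<le> \<delta> / K" if i: "i \<in> {1..K}" for i
  proof (rule prob_pair_pmf_le')
    have "measure_pmf.prob ?A {S. \<not> embeds (1 / 100) (S i) X}
        = measure_pmf.prob (map_pmf (\<lambda>S. S i) ?A) {S. \<not> embeds (1 / 100) S X}"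
      by (simp add: vimage_def)
    also have "\<dots> \<le> \<delta> / K"
      unfolding marg[OF i]
    proof (rule srht_embedding)
      show "\<delta> / K < 1" using \<delta> assms by (simp add: field_simps)
    qed (use X inj d m_range[OF i] \<delta> assms size_m[OF i] N in auto)
    finally show "measure_pmf.prob ?A {S. (S, R) \<in> {(S, R). \<not> embeds (1 / 100) (S i) X}} \<le> \<delta> / K" for R
      by simp
  qed (use \<delta> in simp)
  have fail_R: "measure_pmf.prob ?\<Omega> {(S, R). \<not> embeds (1 / 100) R X} \<le> \<delta>"
  proof (rule prob_pair_pmf_le)
    show "measure_pmf.prob ?B {R. (S, R) \<in> {(S, R). \<not> embeds (1 / 100) R X}} \<le> \<delta>" for S
      using srht_embedding[OF X[unfolded N] inj d r_le \<delta> size_r] by simp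
  qed (use \<delta> in simp)
  have "- good = (\<Union>i\<in>{1..K}. {(S, R). \<not> embeds (1 / 100) (S i) X}) \<union> {(S, R). \<not> embeds (1 / 100) R X}"
    by (auto simp: good_def)
  then have "measure_pmf.prob ?\<Omega> (- good)
      \<le> measure_pmf.prob ?\<Omega> (\<Union>i\<in>{1..K}. {(S, R). \<not> embeds (1 / 100) (S i) X})
        + measure_pmf.prob ?\<Omega> {(S, R). \<not> embeds (1 / 100) R X}"
    by (simp add: measure_Un_le)
  also have "measure_pmf.prob ?\<Omega> (\<Union>i\<in>{1..K}. {(S, R). \<not> embeds (1 / 100) (S i) X})
      \<le> (\<Sum>i\<in>{1..K}. measure_pmf.prob ?\<Omega> {(S, R). \<not> embeds (1 / 100) (S i) X})"
    by (intro measure_pmf.finite_measure_subadditive_finite) auto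
  also have "\<dots> \<le> (\<Sum>i\<in>{1..K}. \<delta> / K)"
    by (intro sum_mono fail_S)
  also have "\<dots> = \<delta>" using assms by simp
  finally have "measure_pmf.prob ?\<Omega> (- good) \<le> 2 * \<delta>"
    using fail_R by simp
  then have prob_good: "1 - 2 * \<delta> \<le> measure_pmf.prob ?\<Omega> good"
    using measure_pmf.prob_compl[of good ?\<Omega>] by (simp add: Compl_eq_Diff_UNIV)

  let ?D = "pred_error \<mu> X \<beta> (ols X)" and ?e0 = "pred_error \<mu> X \<beta> (\<lambda>Y. \<beta>\<^sub>0)"
  let ?\<delta> = "\<lambda>S i. pred_error \<mu> X \<beta> (\<lambda>Y. least_squares (S i * X) (S i *\<^sub>v Y))"
  let ?err = "\<lambda>S R. pred_error \<mu> X \<beta> (\<lambda>Y. spcg K X Y S R a \<beta>\<^sub>0 T)"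
  have claim: "well_posed K X S R \<and>
      ?err S R \<le> (1 / 4) ^ T * ?e0
        + (\<Sum>i = 1..K. (1 + (1 / 4) ^ a i) * (1 / 4) ^ (T - stage_end a i) * ?\<delta> S i)
        + (1 + (1 / 4) ^ (T - stage_end a K)) * ?D \<and>
      (\<forall>C>0. (\<forall>i\<in>{1..K}. ?\<delta> S i \<le> C * ?D) \<longrightarrow>
        ?err S R \<le> (1 / 4) ^ T * ?e0 + (1 + (1 / 4) ^ (T - stage_end a K) * (1 + 5 / 3 * C)) * ?D)"
    if SR: "(S, R) \<in> set_pmf ?\<Omega>" "(S, R) \<in> good" for S R
  proof -
    have S: "S i \<in> carrier_mat (m i) N \<and> norm_close (S i * X) X" if "i \<in> {1..K}" for i
    proof -
      have "S i \<in> set_pmf (map_pmf (\<lambda>S. S i) ?A)" using SR(1) by auto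
      then have "S i \<in> carrier_mat (m i) N"
        unfolding marg[OF that] N by (rule srht_pmf_carrier) (rule m_range(2)[OF that])
      then show ?thesis
        using SR(2) that by (auto simp: good_def intro: embeds_norm_close)
    qed
    have R: "R \<in> carrier_mat r N"
      unfolding N using SR(1) r_le by (intro srht_pmf_carrier) auto
    have closeR: "norm_close (R * X) X"
      using SR(2) by (auto simp: good_def intro: embeds_norm_close)
    have rank_of: "full_column_rank (A * X)" if "A \<in> carrier_mat n N" "norm_close (A * X) X" for A n
    proof -
      have AX: "A * X \<in> carrier_mat n d" using that(1) X by (rule mult_carrier_mat)
      show ?thesis
        using full_column_rank_iff[OF AX] norm_close_inj[OF X inj AX that(2)] by simp
    qed
    have wp: "well_posed K X S R"
    proof -
      have "full_column_rank (S i * X)" if "i \<in> {1..K}" for i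
        using rank_of S[OF that] by blast
      then show ?thesis
        unfolding well_posed_def using rank_of[OF R closeR] by blast
    qed
    have bound: "?err S R \<le> (1 / 4) ^ T * ?e0
        + (\<Sum>i = 1..K. (1 + (1 / 4) ^ a i) * (1 / 4) ^ (T - stage_end a i) * ?\<delta> S i)
        + (1 + (1 / 4) ^ (T - stage_end a K)) * ?D"
      using X inj S R closeR a T \<beta> noise by (rule pred_error_spcg)
    have "?err S R \<le> (1 / 4) ^ T * ?e0 + (1 + (1 / 4) ^ (T - stage_end a K) * (1 + 5 / 3 * C)) * ?D"
      if C: "0 < C" "\<forall>i\<in>{1..K}. ?\<delta> S i \<le> C * ?D" for C
    proof -
      have "(\<Sum>i = 1..K. (1 + (1 / 4) ^ a i) * (1 / 4) ^ (T - stage_end a i) * ?\<delta> S i)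
          \<le> (1 / 4) ^ (T - stage_end a K) * (5 / 3 * (C * ?D))"
        using C pred_error_nonneg by (intro stage_sum_bound a T) auto
      then show ?thesis
        using bound by (simp add: algebra_simps)
    qed
    with wp bound show ?thesis by blast
  qed
  show "1 - 2 * \<delta> \<le> measure_pmf.prob ?\<Omega> {(S, R). well_posed K X S R \<and>
      ?err S R \<le> (1 / 4) ^ T * ?e0
        + (\<Sum>i = 1..K. (1 + (1 / 4) ^ a i) * (1 / 4) ^ (T - stage_end a i) * ?\<delta> S i)
        + (1 + (1 / 4) ^ (T - stage_end a K)) * ?D \<and>
      (\<forall>C>0. (\<forall>i\<in>{1..K}. ?\<delta> S i \<le> C * ?D) \<longrightarrow>
        ?err S R \<le> (1 / 4) ^ T * ?e0 + (1 + (1 / 4) ^ (T - stage_end a K) * (1 + 5 / 3 * C)) * ?D)}"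
    (is "_ \<le> measure_pmf.prob _ ?E")
  proof (rule order_trans[OF prob_good], rule measure_pmf.finite_measure_mono_AE)
    show "AE z in ?\<Omega>. z \<in> good \<longrightarrow> z \<in> ?E"
      unfolding AE_measure_pmf_iff using claim by blast
  qed simp
qed

end
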